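(* For all integers $r\ge k\ge 2$ and every $\alpha>0$ there exists $n_0$ such that every $k$-graph $H$ on $n\ge n_0$ vertices with $$\delta(H)\ \ge\ \left(1-\frac{1}{\binom{r-1}{k-1}+\binom{r-2}{k-2}}+\alpha\right)n$$ contains a copy of $C^{r-k+1}_{k,n}$, the $(r-k+1)$th power of a tight Hamilton cycle.
   Context: A $k$-graph is a $k$-uniform hypergraph. For a $k$-graph $H$, the minimum codegree $\delta(H)$ is the maximum number $m$ such that each set of $k-1$ vertices of $H$ lies in at least $m$ edges of $H$. For $j\ge 1$, the $j$th power of a $k$-cycle on $n$ vertices, denoted $C^{j}_{k,n}$, is the $k$-graph on $n$ cyclically ordered vertices whose edges are all $k$-subsets of all sets of $k+j-1$ consecutive vertices. (So $C^{1}_{k,n}$ is the tight Hamilton cycle, and the edges of $C^{r-k+1}_{k,n}$ are all $k$-subsets of sets of $r$ consecutive vertices.) *)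

theory Defs
  imports Complex_Main
begin

record 'a hypergraph =
  verts :: "'a set"
  edges :: "'a set set"

definition k_graph :: "nat \<Rightarrow> 'a hypergraph \<Rightarrow> bool" where
  "k_graph k H \<longleftrightarrow> finite (verts H) \<and> (\<forall>e\<in>edges H. e \<subseteq> verts H \<and> card e = k)"

(* The GREATEST exists as soon as the finite k-graph H has at least k - 1 vertices;
   on fewer vertices the condition is vacuous and the value is unspecified. *)
definition min_codegree :: "nat \<Rightarrow> 'a hypergraph \<Rightarrow> nat" where
  "min_codegree k H =
     (GREATEST m. \<forall>S. S \<subseteq> verts H \<and> card S = k - 1 \<longrightarrow> m \<le> card {e \<in> edges H. S \<subseteq> e})"

(* s consecutive vertices, starting at i, in the cyclic order 0, 1, ..., n - 1, 0, ...;
   all n vertices if s \<ge> n. *)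
definition cyclic_interval :: "nat \<Rightarrow> nat \<Rightarrow> nat \<Rightarrow> nat set" where
  "cyclic_interval n i s = (\<lambda>t. (i + t) mod n) ` {..<s}"

(* The j-th power of the k-cycle on n vertices, for j \<ge> 1. *)
definition cycle_power :: "nat \<Rightarrow> nat \<Rightarrow> nat \<Rightarrow> nat hypergraph" where
  "cycle_power j k n =
     \<lparr>verts = {..<n},
      edges = {e. card e = k \<and> (\<exists>i<n. e \<subseteq> cyclic_interval n i (k + j - 1))}\<rparr>"

(* Copies need not be induced. *)
definition contains_copy :: "'a hypergraph \<Rightarrow> 'b hypergraph \<Rightarrow> bool" where
  "contains_copy H F \<longleftrightarrow>
     (\<exists>f. inj_on f (verts F) \<and> f ` verts F \<subseteq> verts H \<and> (\<forall>e\<in>edges F. f ` e \<in> edges H))"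

end

theory Submission
  imports Defs "HOL-Library.Sublist" "HOL-Library.Multiset"
begin

text \<open>
  Let \<open>K\<close> be the complex of all cliques of \<open>H\<close>; the task is to order the vertices cyclically so that any
  \<open>r\<close> consecutive ones form a clique. With \<open>t\<close> the denominator in the codegree condition, two cliques
  \<open>C + a\<close> and \<open>C + b\<close> with fewer than \<open>r\<close> vertices contain together at most \<open>t\<close> sets of size \<open>k - 1\<close>,
  so they have linearly many common extensions; and a clique on \<open>0 < j < r\<close> vertices has
  at least \<open>(1 - j / r + \<gamma>) n\<close> extensions. These two properties suffice for the absorption method,
  without regularity and without probability:
  common extensions merge two tight walks that differ in one place, and blowing up such walks gives many
  short connections between any two ordered \<open>(r - 1)\<close>-cliques; every vertex has many absorbers;
  disjoint families of absorbers and of connections that serve all vertices and all pairs of cliques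
  are selected greedily with an exponential potential; finally almost all vertices are covered by
  complete \<open>r\<close>-partite tiles, in rounds that extract small tiles from the parts of large ones and of the
  uncovered rest while keeping the loads of all parts balanced.
\<close>

section \<open>Counting words\<close>

text \<open>The two binomials in \<open>t\<close> count the (k-1)-sets inside C + a and those inside
  C + b that contain b. Each excludes fewer than n / t vertices, so the union bound behind common
  extensions just succeeds; the proportion 1 - j / r then follows from an inequality of binomials,
  which is an equality for k = 2. Merging gives walks that may repeat vertices and whose length is
  not controlled, not paths. The repair is that such a walk, read as a sequence of places in a word
  of bounded length, depends only on which sets of places are cliques. One popular sequence is blown
  up, and repeated visits to a place then use different copies. In the tiling the obstacle is that
  extracting small tiles from few parts would ruin the old tiles. After j > 0 vertices of a clique
  there are more than (1 - j / r) n candidates for the next, so some lie in the j / r least loaded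
  share of the parts. These quantiles of the loads average to at most the mean load, so a new tile
  never favours heavily loaded parts, and a second-moment bound keeps the loads nearly
  equal.\<close>

definition words :: "'a set \<Rightarrow> nat \<Rightarrow> 'a list set" where
  "words V n = {xs. set xs \<subseteq> V \<and> length xs = n}"

lemma finite_words [intro, simp]: "finite V \<Longrightarrow> finite (words V n)"
  unfolding words_def by (rule finite_lists_length_eq)

lemma card_words [simp]: "finite V \<Longrightarrow> card (words V n) = card V ^ n"
  unfolding words_def by (rule card_lists_length_eq)

lemma words_0 [simp]: "words V 0 = {[]}"
  by (auto simp: words_def)

lemma card_words_append:
  fixes c d :: real
  assumes V: "finite V" and A: "A \<subseteq> words V a" "c * card V ^ a \<le> card A"
    and B: "\<And>x. x \<in> A \<Longrightarrow> B x \<subseteq> words V b" "\<And>x. x \<in> A \<Longrightarrow> d * card V ^ b \<le> card (B x)"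
    and d: "0 \<le> d"
  shows "c * d * card V ^ (a + b) \<le> card {x @ y |x y. x \<in> A \<and> y \<in> B x}"
proof -
  have fA: "finite A" using A V finite_subset by blast
  have fB: "finite (B x)" if "x \<in> A" for x using B(1)[OF that] V finite_subset by blast
  have eq: "{x @ y |x y. x \<in> A \<and> y \<in> B x} = (\<lambda>(x, y). x @ y) ` Sigma A B" by auto
  have inj: "inj_on (\<lambda>(x, y). x @ y) (Sigma A B)"
  proof (rule inj_onI)
    fix p q assume "p \<in> Sigma A B" "q \<in> Sigma A B" and eq: "(case p of (x, y) \<Rightarrow> x @ y) = (case q of (x, y) \<Rightarrow> x @ y)"
    then have "length (fst p) = length (fst q)" using subsetD[OF A(1)] by (auto simp: words_def)
    then show "p = q" using eq by (cases p; cases q) auto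
  qed
  have "c * d * card V ^ (a + b) = (c * card V ^ a) * (d * card V ^ b)"
    by (simp add: power_add)
  also have "\<dots> \<le> card A * (d * card V ^ b)" using A(2) d by (intro mult_right_mono) auto
  also have "\<dots> = (\<Sum>x\<in>A. d * card V ^ b)" by simp
  also have "\<dots> \<le> (\<Sum>x\<in>A. real (card (B x)))" using B(2) by (intro sum_mono) auto
  also have "\<dots> = card (Sigma A B)" using fA fB by (simp add: card_SigmaI)
  also have "\<dots> = card {x @ y |x y. x \<in> A \<and> y \<in> B x}" unfolding eq using inj by (simp add: card_image)
  finally show ?thesis .
qed

text \<open>The bound \<open>d\<close> may vary with the position; this is needed when the first
  letter comes from a much smaller set than the others.\<close>

lemma card_words_greedy_prod:
  fixes d :: "nat \<Rightarrow> real"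
  assumes V: "finite V" and d: "\<And>l. 0 \<le> d l" and P0: "P []"
    and step: "\<And>xs. set xs \<subseteq> V \<Longrightarrow> length xs < N \<Longrightarrow> P xs \<Longrightarrow> d (length xs) \<le> card {v \<in> V. P (xs @ [v])}"
  shows "(\<Prod>l<N. d l) \<le> card {xs \<in> words V N. P xs}"
  using step
proof (induction N)
  case 0
  have "{xs \<in> words V 0. P xs} = {[]}" using P0 by auto
  then show ?case by simp
next
  case (Suc N)
  let ?A = "{xs \<in> words V N. P xs}"
  let ?B = "\<lambda>xs. {v \<in> V. P (xs @ [v])}"
  have "(\<Prod>l<Suc N. d l) \<le> card ?A * d N"
    using Suc d by (simp add: mult_right_mono)
  also have "\<dots> = (\<Sum>xs\<in>?A. d N)" by simp
  also have "\<dots> \<le> (\<Sum>xs\<in>?A. real (card (?B xs)))"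
    using Suc.prems by (intro sum_mono) (auto simp: words_def)
  also have "\<dots> = card (Sigma ?A ?B)" using V by (simp add: card_SigmaI)
  also have "card (Sigma ?A ?B) = card ((\<lambda>(xs, v). xs @ [v]) ` Sigma ?A ?B)"
    by (intro card_image[symmetric]) (auto simp: inj_on_def)
  also have "\<dots> \<le> card {xs \<in> words V (Suc N). P xs}"
    using V by (intro card_mono finite_subset[OF _ finite_words[OF V]]) (auto simp: words_def)
  finally show ?case by simp
qed

lemma card_words_greedy:
  fixes \<gamma> :: real
  assumes "finite V" "0 \<le> \<gamma>" "P []"
    and "\<And>xs. set xs \<subseteq> V \<Longrightarrow> length xs < N \<Longrightarrow> P xs \<Longrightarrow> \<gamma> * card V \<le> card {v \<in> V. P (xs @ [v])}"
  shows "\<gamma> ^ N * card V ^ N \<le> card {xs \<in> words V N. P xs}"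
  using card_words_greedy_prod[of V "\<lambda>_. \<gamma> * card V" P N] assms by (simp add: power_mult_distrib)

lemma card_words_meeting:
  assumes V: "finite V" and U: "finite U"
  shows "card {xs \<in> words V N. set xs \<inter> U \<noteq> {}} \<le> N * card U * card V ^ (N - 1)"
proof -
  \<comment> \<open>A word meeting \<open>U\<close> is recovered from a position, the letter of
    \<open>U\<close> there and the other N - 1 letters.\<close>
  let ?f = "\<lambda>(i, u, ys). take i ys @ u # drop i ys"
  let ?D = "{..<N} \<times> U \<times> words V (N - 1)"
  have "xs \<in> ?f ` ?D" if that: "xs \<in> words V N" and that2: "set xs \<inter> U \<noteq> {}" for xs
  proof -
    obtain i where i: "i < length xs" "xs ! i \<in> U" using that2 by (auto simp: in_set_conv_nth)
    have "xs = ?f (i, xs ! i, take i xs @ drop (Suc i) xs)"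
      using i(1) id_take_nth_drop by (auto simp: min_def)
    moreover have "(i, xs ! i, take i xs @ drop (Suc i) xs) \<in> ?D"
      using that i by (auto simp: words_def dest: in_set_takeD in_set_dropD)
    ultimately show ?thesis by (rule image_eqI)
  qed
  then have "card {xs \<in> words V N. set xs \<inter> U \<noteq> {}} \<le> card (?f ` ?D)"
    using V U by (intro card_mono) auto
  also have "\<dots> \<le> card ?D" using V U by (intro card_image_le) auto
  finally show ?thesis using V by (simp add: card_cartesian_product mult_ac)
qed

lemma card_words_not_distinct:
  assumes V: "finite V"
  shows "card {xs \<in> words V N. \<not> distinct xs} \<le> N * N * card V ^ (N - 1)"
proof -
  \<comment> \<open>Coded by a position \<open>i\<close>, an earlier position \<open>j\<close> with
    the same letter, and the other letters; as \<open>j < i\<close>, deleting letter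
    \<open>i\<close> does not move letter \<open>j\<close>.\<close>
  let ?f = "\<lambda>(i, j, ys). take i ys @ (ys ! j) # drop i ys"
  let ?D = "{..<N} \<times> {..<N} \<times> words V (N - 1)"
  have "xs \<in> ?f ` ?D" if xs: "xs \<in> words V N" "\<not> distinct xs" for xs
  proof -
    obtain i j where ij: "i < length xs" "j < i" "xs ! i = xs ! j"
      using xs(2) unfolding distinct_conv_nth by (metis linorder_neqE_nat)
    let ?ys = "take i xs @ drop (Suc i) xs"
    have "xs = ?f (i, j, ?ys)"
      using ij id_take_nth_drop[of i xs] by (auto simp: min_def nth_append)
    moreover have "(i, j, ?ys) \<in> ?D"
      using xs ij by (auto simp: words_def dest: in_set_takeD in_set_dropD)
    ultimately show ?thesis by (rule image_eqI)
  qed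
  then have "card {xs \<in> words V N. \<not> distinct xs} \<le> card (?f ` ?D)"
    using V by (intro card_mono) auto
  also have "\<dots> \<le> card ?D" using V by (intro card_image_le) auto
  finally show ?thesis using V by (simp add: card_cartesian_product mult_ac)
qed

text \<open>Bad words have one degree of freedom less, so for large \<open>V\<close> they use up at
  most half of the density. Many factors 1/2 in later constants come from here.\<close>

lemma card_words_Diff:
  fixes c :: real
  assumes V: "finite V" and A: "A \<subseteq> words V N" "c * card V ^ N \<le> card A"
    and B: "card {xs \<in> words V N. P xs} \<le> k * card V ^ (N - 1)"
    and k: "2 * real k \<le> c * card V" and N: "N > 0"
  shows "c / 2 * card V ^ N \<le> card {xs \<in> A. \<not> P xs}"
proof -
  have fA: "finite A" using A V finite_subset by blast
  have "card A \<le> card {xs \<in> A. \<not> P xs} + card {xs \<in> A. P xs}"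
    using fA by (subst card_Un_disjoint[symmetric]) (auto intro!: card_mono)
  moreover have "card {xs \<in> A. P xs} \<le> card {xs \<in> words V N. P xs}"
    using A V by (intro card_mono) auto
  ultimately have "card A \<le> card {xs \<in> A. \<not> P xs} + k * card V ^ (N - 1)" using B by linarith
  then have 1: "real (card A) \<le> card {xs \<in> A. \<not> P xs} + k * real (card V ^ (N - 1))"
    by (metis of_nat_add of_nat_le_iff of_nat_mult)
  have "k * real (card V ^ (N - 1)) \<le> (c / 2 * card V) * card V ^ (N - 1)"
    using k by (intro mult_right_mono) auto
  also have "\<dots> = c / 2 * card V ^ N" using N by (cases N) auto
  finally show ?thesis using 1 A(2) by linarith
qed

text \<open>Jensen's inequality for powers, from the tangent of a^m at \<mu>. The summed tangents
  leave a linear term, which is nonnegative since \<open>sum f A\<close> is at least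
  \<open>card A * \<mu>\<close>.\<close>

lemma power_mean_sum:
  fixes f :: "'b \<Rightarrow> real" and \<mu> :: real
  assumes fin: "finite A" and f: "\<And>x. x \<in> A \<Longrightarrow> 0 \<le> f x" and \<mu>: "0 \<le> \<mu>" "card A * \<mu> \<le> sum f A"
  shows "card A * \<mu> ^ m \<le> (\<Sum>x\<in>A. f x ^ m)"
proof (cases m)
  case (Suc k)
  have tangent: "\<mu> ^ Suc k + Suc k * \<mu> ^ k * (a - \<mu>) \<le> a ^ Suc k" if "0 \<le> a" for a k
  proof (induction k)
    case (Suc k)
    have "\<mu> ^ Suc (Suc k) + Suc (Suc k) * \<mu> ^ Suc k * (a - \<mu>)
        = a * (\<mu> ^ Suc k + Suc k * \<mu> ^ k * (a - \<mu>)) - Suc k * \<mu> ^ k * (a - \<mu>)\<^sup>2"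
    proof -
      have "\<mu> * (\<mu> * p) + (1 + (1 + K)) * (\<mu> * p) * (a - \<mu>)
        = a * (\<mu> * p + (1 + K) * p * (a - \<mu>)) - (1 + K) * p * (a - \<mu>)\<^sup>2" for p K :: real
        by algebra
      from this[of "\<mu> ^ k" "real k"] show ?thesis by simp
    qed
    also have "\<dots> \<le> a * (\<mu> ^ Suc k + Suc k * \<mu> ^ k * (a - \<mu>))" using \<mu> by simp
    also have "\<dots> \<le> a * a ^ Suc k" using Suc that by (intro mult_left_mono) auto
    finally show ?case by simp
  qed (use that in auto)
  have "card A * \<mu> ^ m \<le> card A * \<mu> ^ Suc k + Suc k * \<mu> ^ k * (sum f A - card A * \<mu>)"
    using \<mu> Suc by auto
  also have "\<dots> = (\<Sum>x\<in>A. \<mu> ^ Suc k + Suc k * \<mu> ^ k * (f x - \<mu>))"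
    by (simp add: sum.distrib sum_distrib_left[symmetric] sum_distrib_right[symmetric] sum_subtractf algebra_simps)
  also have "\<dots> \<le> (\<Sum>x\<in>A. f x ^ m)" unfolding Suc using tangent f by (intro sum_mono) auto
  finally show ?thesis .
qed simp

text \<open>Complete s-partite structures inside the relation \<open>T\<close>:
  \<open>listset (map set F)\<close> is the set of transversals of \<open>F\<close>. Parts are
  words, possibly with repetitions or overlaps, so that the counts are powers; distinctness is
  restored afterwards.\<close>

definition blowups :: "'a set \<Rightarrow> 'a list set \<Rightarrow> nat \<Rightarrow> nat \<Rightarrow> 'a list list set" where
  "blowups V T s m = {F \<in> words (words V m) s. listset (map set F) \<subseteq> T}"

lemma listset_map_set_iff:
  "ys \<in> listset (map set F) \<longleftrightarrow> length ys = length F \<and> (\<forall>i<length F. ys ! i \<in> set (F ! i))"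
proof (induction F arbitrary: ys)
  case (Cons f F)
  show ?case by (cases ys) (auto simp: set_Cons_def Cons All_less_Suc2)
qed auto

text \<open>Supersaturation as in the theorem of Erdos on complete s-partite hypergraphs. The first
  part \<open>x\<close> is split off, and what remains is a blow-up in the common link
  \<open>Tx x\<close>. Convexity is used twice: for the m-th powers of the degrees, which count
  pairs of a word \<open>x\<close> and an element of its common link, and for the m^s-th powers of
  the link densities supplied by induction.\<close>

lemma card_blowups:
  fixes c :: real
  assumes V: "finite V" "0 < card V" and "T \<subseteq> words V s" "0 \<le> c" "c * card V ^ s \<le> card T"
  shows "c ^ (m ^ s) * card V ^ (s * m) \<le> card (blowups V T s m)"
  using assms(3-)
proof (induction s arbitrary: T c)
  case 0
  then consider "T = {}" | "T = {[]}" by auto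
  then show ?case
  proof cases
    case 2
    then have "blowups V T 0 m = {[]}" by (auto simp: blowups_def)
    then show ?thesis using 0 2 by simp
  qed (use 0 in auto)
next
  case (Suc s)
  let ?n = "real (card V)"
  define Tx where "Tx x = {y \<in> words V s. \<forall>a\<in>set x. a # y \<in> T}" for x
  have n: "?n > 0" using V by simp
  have "blowups V T (Suc s) m = (\<lambda>(x, F). x # F) ` Sigma (words V m) (\<lambda>x. blowups V (Tx x) s m)"
    (is "?L = ?R")
  proof (intro equalityI subsetI)
    fix G assume G: "G \<in> ?L"
    then obtain x F where xF: "G = x # F" by (cases G) (auto simp: blowups_def words_def)
    have F: "length F = s" "\<And>f. f \<in> set F \<Longrightarrow> set f \<subseteq> V" and x: "x \<in> words V m"
      using G xF by (auto simp: blowups_def words_def)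
    have "ys \<in> words V s" if "ys \<in> listset (map set F)" for ys
    proof -
      have "ys ! i \<in> V" if "i < length F" for i
        using F(2)[of "F ! i"] that \<open>ys \<in> _\<close> by (auto simp: listset_map_set_iff)
      then show ?thesis using that F(1) by (auto simp: words_def listset_map_set_iff in_set_conv_nth)
    qed
    then have "F \<in> blowups V (Tx x) s m"
      using G xF unfolding blowups_def Tx_def by (auto simp: words_def set_Cons_def)
    then show "G \<in> ?R" using x xF by (intro image_eqI[of _ _ "(x, F)"]) auto
  next
    fix G assume "G \<in> ?R"
    then obtain x F where G: "G = x # F" "x \<in> words V m" "F \<in> blowups V (Tx x) s m" by auto
    then show "G \<in> ?L" unfolding blowups_def Tx_def by (auto simp: words_def set_Cons_def)
  qed
  moreover have "inj_on (\<lambda>(x, F). x # F) (Sigma (words V m) (\<lambda>x. blowups V (Tx x) s m))"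
    by (auto simp: inj_on_def)
  ultimately have card_eq: "card (blowups V T (Suc s) m) = (\<Sum>x\<in>words V m. card (blowups V (Tx x) s m))"
    using V by (simp add: card_image card_SigmaI blowups_def)
  have fT: "finite T" using Suc.prems V finite_subset by blast
  define deg where "deg y = card {a \<in> V. a # y \<in> T}" for y
  have "T = (\<lambda>(y, a). a # y) ` Sigma (words V s) (\<lambda>y. {a \<in> V. a # y \<in> T})" (is "_ = ?R")
  proof (intro equalityI subsetI)
    fix t assume t: "t \<in> T"
    then have tw: "t \<in> words V (Suc s)" using Suc.prems by auto
    then obtain a y where "t = a # y" by (cases t) (auto simp: words_def)
    then show "t \<in> ?R" using t tw by (intro image_eqI[of _ _ "(y, a)"]) (auto simp: words_def)
  qed auto
  moreover have "inj_on (\<lambda>(y, a). a # y) (Sigma (words V s) (\<lambda>y. {a \<in> V. a # y \<in> T}))"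
    by (auto simp: inj_on_def)
  ultimately have "card T = card (Sigma (words V s) (\<lambda>y. {a \<in> V. a # y \<in> T}))"
    using card_image by fastforce
  then have cT: "card T = (\<Sum>y\<in>words V s. deg y)"
    using V unfolding deg_def by (simp add: card_SigmaI)
  \<comment> \<open>Pairs (x, y) in which every letter of \<open>x\<close> completes
    \<open>y\<close> are counted from both sides; for fixed \<open>y\<close> the letters of
    \<open>x\<close> are chosen independently.\<close>
  have swap: "(\<Sum>x\<in>words V m. card (Tx x)) = (\<Sum>y\<in>words V s. deg y ^ m)"
  proof -
    have "(\<Sum>x\<in>words V m. card (Tx x)) = (\<Sum>x\<in>words V m. \<Sum>y\<in>words V s. if \<forall>a\<in>set x. a # y \<in> T then 1 else 0)"
      unfolding Tx_def using V by (simp add: sum.If_cases Int_def)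
    also have "\<dots> = (\<Sum>y\<in>words V s. \<Sum>x\<in>words V m. if \<forall>a\<in>set x. a # y \<in> T then 1 else 0)"
      by (rule sum.swap)
    also have "\<dots> = (\<Sum>y\<in>words V s. card {x \<in> words V m. \<forall>a\<in>set x. a # y \<in> T})"
      using V by (simp add: sum.If_cases Int_def)
    also have "\<dots> = (\<Sum>y\<in>words V s. deg y ^ m)"
    proof (rule sum.cong[OF refl])
      fix y
      have "{x \<in> words V m. \<forall>a\<in>set x. a # y \<in> T} = words {a \<in> V. a # y \<in> T} m"
        by (auto simp: words_def)
      then show "card {x \<in> words V m. \<forall>a\<in>set x. a # y \<in> T} = deg y ^ m"
        using V by (simp add: deg_def)
    qed
    finally show ?thesis .
  qed
  define cx where "cx x = card (Tx x) / ?n ^ s" for x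
  have "card (words V s) * (c * ?n) ^ m \<le> (\<Sum>y\<in>words V s. real (deg y) ^ m)"
    using Suc.prems V by (intro power_mean_sum) (auto simp: cT[symmetric] mult_ac simp flip: of_nat_sum)
  then have "?n ^ s * (c * ?n) ^ m \<le> (\<Sum>x\<in>words V m. card (Tx x))"
    unfolding swap using V by simp
  then have "?n ^ m * c ^ m \<le> (\<Sum>x\<in>words V m. cx x)"
    unfolding cx_def sum_divide_distrib[symmetric] using n
    by (simp add: field_simps power_mult_distrib)
  then have "card (words V m) * (c ^ m) ^ (m ^ s) \<le> (\<Sum>x\<in>words V m. cx x ^ (m ^ s))"
    using V Suc.prems n by (intro power_mean_sum) (auto simp: cx_def)
  then have "?n ^ m * c ^ (m ^ Suc s) * ?n ^ (s * m) \<le> (\<Sum>x\<in>words V m. cx x ^ (m ^ s)) * ?n ^ (s * m)"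
    using V n by (intro mult_right_mono) (auto simp: power_mult mult.commute)
  also have "\<dots> = (\<Sum>x\<in>words V m. cx x ^ (m ^ s) * ?n ^ (s * m))" by (rule sum_distrib_right)
  also have "\<dots> \<le> (\<Sum>x\<in>words V m. real (card (blowups V (Tx x) s m)))"
  proof (rule sum_mono)
    fix x
    show "cx x ^ (m ^ s) * ?n ^ (s * m) \<le> real (card (blowups V (Tx x) s m))"
      using n Suc.IH[of "Tx x" "cx x"] by (simp add: cx_def) (auto simp: Tx_def)
  qed
  also have "\<dots> = card (blowups V T (Suc s) m)" using card_eq by simp
  finally show ?case by (simp add: power_add mult_ac)
qed

lemma card_concat_blowups:
  fixes c :: real
  assumes V: "finite V" "0 < card V" and T: "T \<subseteq> words V s" "0 \<le> c" "c * card V ^ s \<le> card T"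
    and big: "2 * real (s * m * (s * m)) \<le> c ^ (m ^ s) * card V" and pos: "0 < s * m"
  shows "c ^ (m ^ s) / 2 * card V ^ (s * m) \<le> card {xs \<in> concat ` blowups V T s m. distinct xs}"
proof -
  have parts: "length F = s \<and> (\<forall>f\<in>set F. length f = m)" if "F \<in> words (words V m) s" for F
    using that by (auto simp: words_def)
  have inj: "inj_on concat (words (words V m) s)"
  proof (rule inj_onI)
    fix F G assume FG: "F \<in> words (words V m) s" "G \<in> words (words V m) s" "concat F = concat G"
    then show "F = G"
      using parts[OF FG(1)] parts[OF FG(2)]
      by (subst (asm) concat_eq_concat_iff) (auto, metis in_set_zipE)
  qed
  have len: "length (concat F) = s * m" if "F \<in> words (words V m) s" for F
  proof -
    have "map length F = replicate s m"
      using parts[OF that] by (simp add: list_eq_iff_nth_eq)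
    then show ?thesis by (simp add: length_concat sum_list_replicate)
  qed
  have "card (concat ` blowups V T s m) = card (blowups V T s m)"
    by (intro card_image inj_on_subset[OF inj]) (auto simp: blowups_def)
  then have "c ^ (m ^ s) * card V ^ (s * m) \<le> card (concat ` blowups V T s m)"
    using card_blowups[OF V T] by simp
  moreover have "concat ` blowups V T s m \<subseteq> words V (s * m)"
    using len by (auto simp: blowups_def) (auto simp: words_def)
  ultimately have "c ^ (m ^ s) / 2 * card V ^ (s * m) \<le> card {xs \<in> concat ` blowups V T s m. \<not> \<not> distinct xs}"
    using card_words_not_distinct[OF V(1)] big pos by (intro card_words_Diff[OF V(1)]) auto
  then show ?thesis by simp
qed

section \<open>Tight lists\<close>

definition ext :: "'a set set \<Rightarrow> 'a set \<Rightarrow> 'a set" where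
  "ext K A = {v. v \<notin> A \<and> insert v A \<in> K}"

text \<open>\<open>sublist\<close> means contiguous. Only windows of at most r entries need to be
  distinct, so a tight list is a walk that may return to a vertex; it is a path if it is also
  \<open>distinct\<close>. Shorter windows are included so that lists with fewer than r entries are
  constrained as well.\<close>

definition tight :: "'a set set \<Rightarrow> nat \<Rightarrow> 'a list \<Rightarrow> bool" where
  "tight K r xs \<longleftrightarrow> (\<forall>ys. sublist ys xs \<and> length ys \<le> r \<longrightarrow> distinct ys \<and> set ys \<in> K)"

lemma tight_sublist: "tight K r xs \<Longrightarrow> sublist ys xs \<Longrightarrow> tight K r ys"
  unfolding tight_def using sublist_order.order_trans by blast

lemma tight_append1: "tight K r (xs @ ys) \<Longrightarrow> tight K r xs"
  and tight_append2: "tight K r (xs @ ys) \<Longrightarrow> tight K r ys"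
  by (auto elim: tight_sublist)

lemma tight_windowD:
  assumes "tight K r xs" "length xs \<le> r"
  shows "distinct xs" "set xs \<in> K"
  using assms unfolding tight_def by auto

lemma tight_take [intro]: "tight K r xs \<Longrightarrow> tight K r (take n xs)"
  and tight_drop [intro]: "tight K r xs \<Longrightarrow> tight K r (drop n xs)"
  by (auto elim: tight_sublist)

lemma sublist_append_cases:
  assumes "sublist us (xs @ ys @ zs)" "length us \<le> Suc (length ys)"
  shows "sublist us (xs @ ys) \<or> sublist us (ys @ zs)"
proof -
  obtain ps ss where e: "xs @ ys @ zs = ps @ us @ ss" using assms(1) by (auto simp: sublist_def)
  show ?thesis
  proof (cases "length xs \<le> length ps")
    case True
    obtain w where "xs = ps @ w \<and> w @ ys @ zs = us @ ss \<or> xs @ w = ps \<and> ys @ zs = w @ us @ ss"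
      using e unfolding append_eq_append_conv2[of xs "ys @ zs" ps "us @ ss"] by blast
    then have "ys @ zs = w @ us @ ss" using True by auto
    then show ?thesis by (auto simp: sublist_def)
  next
    case False
    then have "length (ps @ us) \<le> length (xs @ ys)" using assms(2) by simp
    moreover have "prefix (ps @ us) (xs @ ys @ zs)" "prefix (xs @ ys) (xs @ ys @ zs)" by (simp add: e, simp)
    ultimately have "prefix (ps @ us) (xs @ ys)" by (meson prefix_length_prefix)
    then show ?thesis by (auto simp: sublist_def prefix_def)
  qed
qed

text \<open>A window that met both \<open>xs\<close> and \<open>zs\<close> would contain all of
  \<open>ys\<close> and have at least r + 1 entries.\<close>

lemma tight_glue:
  assumes "tight K r (xs @ ys)" "tight K r (ys @ zs)" "r \<le> Suc (length ys)"
  shows "tight K r (xs @ ys @ zs)"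
  unfolding tight_def
proof (intro allI impI)
  fix us assume us: "sublist us (xs @ ys @ zs) \<and> length us \<le> r"
  then have "sublist us (xs @ ys) \<or> sublist us (ys @ zs)"
    using assms(3) by (intro sublist_append_cases) auto
  then show "distinct us \<and> set us \<in> K" using assms(1,2) us unfolding tight_def by blast
qed

lemma tight_rev [simp]: "tight K r (rev xs) \<longleftrightarrow> tight K r xs"
proof -
  have "tight K r (rev xs)" if "tight K r xs" for xs
    unfolding tight_def
  proof (intro allI impI)
    fix ys assume ys: "sublist ys (rev xs) \<and> length ys \<le> r"
    then have "sublist (rev ys) xs" by (simp add: sublist_rev_left)
    then have "distinct (rev ys) \<and> set (rev ys) \<in> K" using that ys unfolding tight_def by auto
    then show "distinct ys \<and> set ys \<in> K" by simp
  qed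
  from this this[of "rev xs"] show ?thesis by auto
qed

lemma sublist_map_conv: "sublist ys (map f xs) \<longleftrightarrow> (\<exists>zs. sublist zs xs \<and> ys = map f zs)"
  by (metis map_mono_sublist sublist_map_rightE)

definition down :: "'a set set \<Rightarrow> bool" where
  "down K \<longleftrightarrow> (\<forall>A\<in>K. \<forall>B. B \<subseteq> A \<longrightarrow> B \<in> K)"

lemma downD: "down K \<Longrightarrow> A \<in> K \<Longrightarrow> B \<subseteq> A \<Longrightarrow> B \<in> K"
  by (auto simp: down_def)

lemma tight_clique:
  assumes "down K" "distinct xs" "set xs \<in> K"
  shows "tight K r xs"
  unfolding tight_def
proof (intro allI impI)
  fix ys assume "sublist ys xs \<and> length ys \<le> r"
  then obtain ps ss where "xs = ps @ ys @ ss" by (auto simp: sublist_def)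
  then show "distinct ys \<and> set ys \<in> K" using assms downD[OF assms(1,3), of "set ys"] by auto
qed

text \<open>Only windows that end in \<open>v\<close> are new. The recurring term
  \<open>drop (Suc (length xs) - r) xs\<close> is the list of the last r - 1 entries, or all of
  \<open>xs\<close> if there are fewer.\<close>

lemma tight_snoc:
  assumes down: "down K" and xs: "tight K r xs" and C: "set (drop (Suc (length xs) - r) xs) \<subseteq> C"
    and v: "v \<in> ext K C" and r: "r > 0"
  shows "tight K r (xs @ [v])"
  unfolding tight_def
proof (intro allI impI)
  fix ys assume ys: "sublist ys (xs @ [v]) \<and> length ys \<le> r"
  consider "sublist ys xs" | zs where "ys = zs @ [v]" "suffix zs xs"
  proof -
    have "ys = [] \<or> (\<exists>zs. ys = zs @ [v] \<and> suffix zs xs) \<or> sublist ys xs"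
      using ys sublist_snoc[of ys xs v] suffix_snoc[of ys xs v] by simp
    then show ?thesis using that by (elim disjE exE) simp_all
  qed
  then show "distinct ys \<and> set ys \<in> K"
  proof cases
    case 1
    then show ?thesis using xs ys by (auto simp: tight_def)
  next
    case 2
    then have "suffix zs (drop (Suc (length xs) - r) xs)"
      using ys 2 suffix_length_le[OF 2(2)] by (intro suffix_length_suffix[OF 2(2) suffix_drop]) auto
    then have "set zs \<subseteq> C" using C by (metis set_mono_suffix subset_trans)
    moreover have "sublist zs xs" "length zs \<le> r" using 2 ys by auto
    then have "distinct zs" using xs unfolding tight_def by blast
    moreover have "set ys \<subseteq> insert v C" "insert v C \<in> K" "v \<notin> C"
      using 2 v \<open>set zs \<subseteq> C\<close> by (auto simp: ext_def)
    ultimately show ?thesis using 2 downD[OF down, of "insert v C" "set ys"] by auto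
  qed
qed

text \<open>\<open>\<omega>\<close> is a walk on the indices of the parts, and place
  \<open>t\<close> of the walk takes entry \<open>g t\<close> of its part. Within one window every
  part is visited at most once, so the window coincides with one of the image of
  \<open>\<omega>\<close> under a single transversal.\<close>

lemma tight_lift:
  assumes down: "down K" "{} \<in> K" and len: "\<And>f. f \<in> set F \<Longrightarrow> length f = m"
    and F: "listset (map set F) \<subseteq> T" and \<omega>: "set \<omega> \<subseteq> {..<length F}"
    and T: "\<And>h. h \<in> T \<Longrightarrow> tight K r (map (nth h) \<omega>)"
    and g: "\<And>t. t < length \<omega> \<Longrightarrow> g t < m"
    and dist: "distinct (map (\<lambda>t. F ! (\<omega> ! t) ! g t) [0..<length \<omega>])"
  shows "tight K r (map (\<lambda>t. F ! (\<omega> ! t) ! g t) [0..<length \<omega>])"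
  unfolding tight_def
proof (intro allI impI)
  fix ys assume ys: "sublist ys (map (\<lambda>t. F ! (\<omega> ! t) ! g t) [0..<length \<omega>]) \<and> length ys \<le> r"
  then obtain ts where ts: "sublist ts [0..<length \<omega>]" "ys = map (\<lambda>t. F ! (\<omega> ! t) ! g t) ts"
    by (auto simp: sublist_map_conv)
  have tsl: "t < length \<omega>" if "t \<in> set ts" for t using that set_mono_sublist[OF ts(1)] by auto
  have m: "0 < m" if "i < length F" "set ts \<noteq> {}" for i
    using g tsl that by fastforce
  have sub: "sublist (map (nth \<omega>) ts) \<omega>"
    using map_mono_sublist[OF ts(1), of "nth \<omega>"] by (simp add: map_nth)
  show "distinct ys \<and> set ys \<in> K"
  proof (cases "ts = []")
    case True
    then show ?thesis using ts down by simp
  next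
    case False
    \<comment> \<open>The copy that the window uses when it visits part \<open>i\<close>, and 0 for
      unvisited parts. \<open>SOME\<close> is seen to pick the right visit only after
      \<open>h\<close> is known to lie in \<open>T\<close>: tightness for \<open>h\<close> is what
      makes \<open>\<omega>\<close> injective on the window.\<close>
    define \<sigma> where "\<sigma> i = (if \<exists>t\<in>set ts. \<omega> ! t = i then g (SOME t. t \<in> set ts \<and> \<omega> ! t = i) else 0)" for i
    define h where "h = map (\<lambda>i. F ! i ! \<sigma> i) [0..<length F]"
    have \<sigma>m: "\<sigma> i < m" if "i < length F" for i
    proof (cases "\<exists>t\<in>set ts. \<omega> ! t = i")
      case True
      then have "(SOME t. t \<in> set ts \<and> \<omega> ! t = i) \<in> set ts"
        using someI_ex[of "\<lambda>t. t \<in> set ts \<and> \<omega> ! t = i"] by blast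
      then show ?thesis using True g tsl by (simp add: \<sigma>_def)
    qed (use m that False in \<open>auto simp: \<sigma>_def\<close>)
    have "h \<in> listset (map set F)" using \<sigma>m len by (auto simp: listset_map_set_iff h_def)
    then have "tight K r (map (nth h) \<omega>)" using F T by auto
    moreover have "sublist (map (nth h) (map (nth \<omega>) ts)) (map (nth h) \<omega>)"
      using sub map_mono_sublist by blast
    moreover have "length (map (nth h) (map (nth \<omega>) ts)) \<le> r" using ys ts by simp
    ultimately have w: "distinct (map (nth h) (map (nth \<omega>) ts))" "set (map (nth h) (map (nth \<omega>) ts)) \<in> K"
      unfolding tight_def by blast+
    then have inj: "inj_on (nth \<omega>) (set ts)" by (auto simp: distinct_map inj_on_def)
    have "h ! (\<omega> ! t) = F ! (\<omega> ! t) ! g t" if t: "t \<in> set ts" for t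
    proof -
      have "(SOME t'. t' \<in> set ts \<and> \<omega> ! t' = \<omega> ! t) = t"
        using t inj by (intro some_equality) (auto dest: inj_onD)
      moreover have "\<omega> ! t < length F" using \<omega> tsl[OF t] by (meson lessThan_iff nth_mem subset_iff)
      ultimately show ?thesis using t by (auto simp: h_def \<sigma>_def)
    qed
    then have "map (nth h) (map (nth \<omega>) ts) = ys" using ts(2) by simp
    then show ?thesis using w by simp
  qed
qed

section \<open>Greedy selection\<close>

text \<open>Derandomised selection. Index \<open>i\<close> has weight (1/2)^(hits so far). When the
  vertices already used are excluded, every \<open>A i\<close> keeps density c / 2, so by averaging
  some word lies in sets carrying a c / 2 share of the total weight. Adding it halves these weights,
  and the total shrinks by the factor 1 - c / 4.\<close>

lemma greedy_potential:
  fixes c :: real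
  assumes V: "finite V" "0 < card V" and I: "finite I" "I \<noteq> {}" and N: "0 < N"
    and A: "\<And>i. i \<in> I \<Longrightarrow> A i \<subseteq> words V N" "\<And>i. i \<in> I \<Longrightarrow> c * card V ^ N \<le> card (A i)"
    and c: "0 < c" "c \<le> 1" and U: "finite U" "2 * real (N * (card U + t * N)) \<le> c * card V"
  shows "\<exists>\<F>. finite \<F> \<and> card \<F> \<le> t \<and> \<F> \<subseteq> (\<Union>i\<in>I. A i) \<and> (\<forall>f\<in>\<F>. \<forall>g\<in>\<F>. f \<noteq> g \<longrightarrow> set f \<inter> set g = {})
     \<and> (\<forall>f\<in>\<F>. set f \<inter> U = {}) \<and> (\<Sum>i\<in>I. (1 / 2) ^ card (\<F> \<inter> A i)) \<le> card I * (1 - c / 4) ^ t"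
  using U(2)
proof (induction t)
  case 0
  show ?case by (intro exI[of _ "{}"]) (use I in auto)
next
  case (Suc t)
  have "N * (card U + t * N) \<le> N * (card U + Suc t * N)" by simp
  then have "real (N * (card U + t * N)) \<le> real (N * (card U + Suc t * N))" by (rule of_nat_mono)
  then have Ut: "2 * real (N * (card U + t * N)) \<le> c * card V"
    using Suc.prems by argo
  from Suc.IH[OF this] obtain \<F> where \<F>: "finite \<F>" "card \<F> \<le> t" "\<F> \<subseteq> (\<Union>i\<in>I. A i)"
     "\<forall>f\<in>\<F>. \<forall>g\<in>\<F>. f \<noteq> g \<longrightarrow> set f \<inter> set g = {}" "\<forall>f\<in>\<F>. set f \<inter> U = {}"
     "(\<Sum>i\<in>I. (1 / 2) ^ card (\<F> \<inter> A i)) \<le> card I * (1 - c / 4) ^ t" by blast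
  define w where "w i = (1 / 2 :: real) ^ card (\<F> \<inter> A i)" for i
  define \<Phi> where "\<Phi> = (\<Sum>i\<in>I. w i)"
  define X where "X = U \<union> \<Union> (set ` \<F>)"
  define A' where "A' i = {f \<in> A i. set f \<inter> X = {}}" for i
  have w: "w i > 0" for i by (simp add: w_def)
  have \<Phi>: "\<Phi> > 0" unfolding \<Phi>_def using I w by (intro sum_pos) auto
  have "card (set f) \<le> N" if "f \<in> \<F>" for f
    using that \<F>(3) A(1) card_length[of f] by (auto simp: words_def)
  then have "card (\<Union> (set ` \<F>)) \<le> card \<F> * N"
    using card_UN_le[OF \<F>(1), of set] sum_bounded_above[of \<F> "\<lambda>f. card (set f)" N] by simp
  then have "card X \<le> card U + t * N"
    unfolding X_def using \<F>(2) mult_le_mono1[OF \<F>(2), of N] card_Un_le[of U "\<Union> (set ` \<F>)"]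
      \<open>card (\<Union> (set ` \<F>)) \<le> card \<F> * N\<close> by linarith
  then have "N * card X \<le> N * (card U + t * N)" by simp
  then have "real (N * card X) \<le> real (N * (card U + t * N))" by (rule of_nat_mono)
  then have X: "finite X" "2 * real (N * card X) \<le> c * card V"
    using U(1) \<F>(1) Ut by (simp add: X_def, argo)
  have A': "c / 2 * card V ^ N \<le> card (A' i)" if "i \<in> I" for i
    using card_words_Diff[OF V(1) A(1)[OF that] A(2)[OF that] card_words_meeting[OF V(1) X(1)] X(2) N]
    by (simp add: A'_def)
  have finA: "finite (A i)" if "i \<in> I" for i using A(1)[OF that] V finite_subset by blast
  have "\<exists>f\<in>words V N. c / 2 * \<Phi> \<le> (\<Sum>i\<in>I. if f \<in> A' i then w i else 0)"
  proof (rule ccontr)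
    assume "\<not> ?thesis"
    moreover have "words V N \<noteq> {}" using V card_gt_0_iff[of "words V N"] by simp
    ultimately have "(\<Sum>f\<in>words V N. \<Sum>i\<in>I. if f \<in> A' i then w i else 0) < (\<Sum>f\<in>words V N. c / 2 * \<Phi>)"
      using V by (intro sum_strict_mono) (auto simp: not_le)
    also have "\<dots> = (\<Sum>i\<in>I. w i * (c / 2 * card V ^ N))"
      using V by (simp add: \<Phi>_def sum_distrib_left sum_distrib_right mult_ac)
    also have "\<dots> \<le> (\<Sum>i\<in>I. w i * card (A' i))"
      using A' w by (intro sum_mono mult_left_mono) (auto simp: less_imp_le)
    also have "\<dots> = (\<Sum>i\<in>I. \<Sum>f\<in>words V N. if f \<in> A' i then w i else 0)"
    proof (rule sum.cong[OF refl])
      fix i assume "i \<in> I"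
      then have "words V N \<inter> A' i = A' i" using A(1) by (auto simp: A'_def)
      then show "w i * card (A' i) = (\<Sum>f\<in>words V N. if f \<in> A' i then w i else 0)"
        using V by (simp add: sum.If_cases)
    qed
    also have "\<dots> = (\<Sum>f\<in>words V N. \<Sum>i\<in>I. if f \<in> A' i then w i else 0)" by (rule sum.swap)
    finally show False by simp
  qed
  then obtain f where f: "f \<in> words V N" "c / 2 * \<Phi> \<le> (\<Sum>i\<in>I. if f \<in> A' i then w i else 0)" by blast
  have "\<exists>i\<in>I. f \<in> A' i"
  proof (rule ccontr)
    assume "\<not> ?thesis"
    then have "(\<Sum>i\<in>I. if f \<in> A' i then w i else 0) = 0" by (intro sum.neutral) auto
    then show False using f(2) \<Phi> c mult_pos_pos[of "c / 2" \<Phi>] by linarith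
  qed
  then obtain i0 where i0: "i0 \<in> I" "f \<in> A' i0" by blast
  then have fX: "set f \<inter> X = {}" "set f \<noteq> {}" using f N by (auto simp: A'_def words_def)
  have f\<F>: "f \<notin> \<F>"
  proof
    assume "f \<in> \<F>"
    then have "set f \<subseteq> X" by (auto simp: X_def)
    then show False using fX by (simp add: Int_absorb2)
  qed
  have "(\<Sum>i\<in>I. (1 / 2) ^ card (insert f \<F> \<inter> A i)) = (\<Sum>i\<in>I. w i - (if f \<in> A' i then w i else 0) / 2)"
  proof (rule sum.cong[OF refl])
    fix i assume "i \<in> I"
    have "f \<in> A' i \<longleftrightarrow> f \<in> A i" using fX by (simp add: A'_def)
    then show "(1 / 2) ^ card (insert f \<F> \<inter> A i) = w i - (if f \<in> A' i then w i else 0) / 2"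
      using f\<F> \<F>(1) by (auto simp: w_def)
  qed
  also have "\<dots> = \<Phi> - (\<Sum>i\<in>I. if f \<in> A' i then w i else 0) / 2"
    by (simp add: \<Phi>_def sum_subtractf sum_divide_distrib)
  also have "\<dots> \<le> \<Phi> * (1 - c / 4)" using f(2) by (simp add: field_simps)
  also have "\<dots> \<le> card I * (1 - c / 4) ^ t * (1 - c / 4)"
    using \<F>(6) c unfolding \<Phi>_def w_def by (intro mult_right_mono) auto
  finally have "(\<Sum>i\<in>I. (1 / 2) ^ card (insert f \<F> \<inter> A i)) \<le> card I * (1 - c / 4) ^ Suc t"
    by (simp add: mult_ac)
  moreover have "\<forall>g\<in>\<F>. set f \<inter> set g = {}" "set f \<inter> U = {}" using fX(1) by (auto simp: X_def)
  ultimately show ?case using \<F> f\<F> i0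
    by (intro exI[of _ "insert f \<F>"]) (auto simp: A'_def)
qed

text \<open>A single term of the potential is at most the whole, and exp (-1) \<le> 1/2, so
  logarithms turn the bound on the potential into a lower bound on the hits. The loss is only
  logarithmic in the number of indices, which lets linearly many words serve polynomially many
  indices.\<close>

lemma greedy_selection:
  fixes c :: real
  assumes V: "finite V" "0 < card V" and I: "finite I" "I \<noteq> {}" and N: "0 < N"
    and A: "\<And>i. i \<in> I \<Longrightarrow> A i \<subseteq> words V N" "\<And>i. i \<in> I \<Longrightarrow> c * card V ^ N \<le> card (A i)"
    and c: "0 < c" "c \<le> 1" and U: "finite U" "2 * real (N * (card U + t * N)) \<le> c * card V"
  shows "\<exists>\<F>. finite \<F> \<and> card \<F> \<le> t \<and> \<F> \<subseteq> (\<Union>i\<in>I. A i) \<and> (\<forall>f\<in>\<F>. \<forall>g\<in>\<F>. f \<noteq> g \<longrightarrow> set f \<inter> set g = {})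
     \<and> (\<forall>f\<in>\<F>. set f \<inter> U = {}) \<and> (\<forall>i\<in>I. c * t / 4 - ln (card I) \<le> card (\<F> \<inter> A i))"
proof -
  have "\<exists>\<F>. finite \<F> \<and> card \<F> \<le> t \<and> \<F> \<subseteq> (\<Union>i\<in>I. A i) \<and> (\<forall>f\<in>\<F>. \<forall>g\<in>\<F>. f \<noteq> g \<longrightarrow> set f \<inter> set g = {})
     \<and> (\<forall>f\<in>\<F>. set f \<inter> U = {}) \<and> (\<Sum>i\<in>I. (1 / 2) ^ card (\<F> \<inter> A i)) \<le> card I * (1 - c / 4) ^ t"
    by (rule greedy_potential[of V I N A c U t, OF assms])
  then obtain \<F> where \<F>: "finite \<F>" "card \<F> \<le> t" "\<F> \<subseteq> (\<Union>i\<in>I. A i)"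
     "\<forall>f\<in>\<F>. \<forall>g\<in>\<F>. f \<noteq> g \<longrightarrow> set f \<inter> set g = {}" "\<forall>f\<in>\<F>. set f \<inter> U = {}"
     "(\<Sum>i\<in>I. (1 / 2) ^ card (\<F> \<inter> A i)) \<le> card I * (1 - c / 4) ^ t" by (elim exE conjE)
  have "c * t / 4 - ln (card I) \<le> card (\<F> \<inter> A i)" if i: "i \<in> I" for i
  proof -
    let ?h = "card (\<F> \<inter> A i)"
    have "exp (-1 :: real) \<le> 1 / 2"
      using exp_ge_add_one_self[of 1] by (simp add: exp_minus field_simps)
    then have "exp (- 1 :: real) ^ ?h \<le> (1 / 2) ^ ?h" by (intro power_mono) auto
    also have "\<dots> \<le> (\<Sum>i\<in>I. (1 / 2) ^ card (\<F> \<inter> A i))"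
      using i I by (intro member_le_sum) auto
    also have "\<dots> \<le> card I * (1 - c / 4) ^ t" by fact
    also have "\<dots> \<le> exp (ln (card I)) * exp (- c / 4) ^ t"
      using I c exp_ge_add_one_self[of "- c / 4"] by (intro mult_mono power_mono) (auto simp: card_gt_0_iff)
    finally have "exp (- real ?h) \<le> exp (ln (card I) - c * t / 4)"
      by (simp add: exp_of_nat_mult[symmetric] exp_add[symmetric] mult_ac)
    then show ?thesis by simp
  qed
  with \<F> show ?thesis by (intro exI[of _ \<F>]) simp
qed

section \<open>Dense clique complexes\<close>

text \<open>\<open>A = {}\<close> is excluded in the first bound, which for \<gamma> > 0 would
  exceed \<open>card V\<close>. In the second bound \<open>a = b\<close> is allowed; this gives a
  plain extension bound for nonempty cliques with fewer than r vertices.\<close>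

definition dense_complex :: "nat \<Rightarrow> real \<Rightarrow> 'a set \<Rightarrow> 'a set set \<Rightarrow> bool" where
  "dense_complex r \<gamma> V K \<longleftrightarrow> finite V \<and> down K \<and> {} \<in> K \<and> \<Union> K \<subseteq> V \<and> (\<forall>v\<in>V. {v} \<in> K) \<and>
     (\<forall>A\<in>K. 0 < card A \<and> card A < r \<longrightarrow> (1 - card A / r + \<gamma>) * real (card V) \<le> card (ext K A)) \<and>
     (\<forall>C a b. a \<notin> C \<and> b \<notin> C \<and> insert a C \<in> K \<and> insert b C \<in> K \<and> Suc (card C) < r \<longrightarrow>
        \<gamma> * real (card V) \<le> real (card (ext K (insert a C) \<inter> ext K (insert b C))))"

lemma dense_complexD:
  fixes \<gamma> :: real
  assumes "dense_complex r \<gamma> V K"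
  shows "finite V" "down K" "{} \<in> K" "A \<in> K \<Longrightarrow> A \<subseteq> V" "v \<in> V \<Longrightarrow> {v} \<in> K"
    "A \<in> K \<Longrightarrow> 0 < card A \<Longrightarrow> card A < r \<Longrightarrow> (1 - card A / r + \<gamma>) * card V \<le> card (ext K A)"
    "a \<notin> C \<Longrightarrow> b \<notin> C \<Longrightarrow> insert a C \<in> K \<Longrightarrow> insert b C \<in> K \<Longrightarrow> Suc (card C) < r \<Longrightarrow>
        \<gamma> * card V \<le> card (ext K (insert a C) \<inter> ext K (insert b C))"
    "A \<in> K \<Longrightarrow> finite A" "ext K A \<subseteq> V"
proof -
  show "A \<in> K \<Longrightarrow> A \<subseteq> V" "finite V" using assms unfolding dense_complex_def by auto
  then show "A \<in> K \<Longrightarrow> finite A" by (rule finite_subset)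
  show "ext K A \<subseteq> V" using assms unfolding dense_complex_def ext_def by auto
qed (use assms in \<open>unfold dense_complex_def, blast+\<close>)

text \<open>An end of a tight path: the r - 1 vertices, in order, on which the possible
  continuations of the path depend.\<close>

definition ordered_clique :: "'a set set \<Rightarrow> nat \<Rightarrow> 'a list \<Rightarrow> bool" where
  "ordered_clique K r X \<longleftrightarrow> Suc (length X) = r \<and> distinct X \<and> set X \<in> K"

text \<open>The differing vertices play \<open>a\<close> and \<open>b\<close>, the shared ones form
  \<open>C\<close>. An index \<open>i\<close> beyond the lists means that they are equal; then any
  place may be singled out, with \<open>a = b\<close>.\<close>

lemma common_extensions:
  fixes \<gamma> :: real
  assumes K: "dense_complex r \<gamma> V K" and U: "distinct U" "set U \<in> K" "distinct W" "set W \<in> K"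
    and len: "length U = length W" "length U < r" "U \<noteq> []" and eq: "\<And>j. j < length U \<Longrightarrow> j \<noteq> i \<Longrightarrow> U ! j = W ! j"
  shows "\<gamma> * card V \<le> card (ext K (set U) \<inter> ext K (set W))"
proof -
  obtain k where k: "k < length U" "\<And>j. j < length U \<Longrightarrow> j \<noteq> k \<Longrightarrow> U ! j = W ! j"
  proof (cases "i < length U")
    case False
    then have "\<And>j. j < length U \<Longrightarrow> U ! j = W ! j" using eq by auto
    then show ?thesis by (intro that[of 0]) (use len in auto)
  qed (use that[of i] eq in auto)
  let ?C = "set (take k U @ drop (Suc k) U)"
  have W: "take k U = take k W" "drop (Suc k) U = drop (Suc k) W"
    by (rule nth_equalityI; use k len in simp)+
  have U': "U = take k U @ U ! k # drop (Suc k) U" and W': "W = take k U @ W ! k # drop (Suc k) U"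
    using k(1) len(1) W id_take_nth_drop[of k U] id_take_nth_drop[of k W] by auto
  have s: "set U = insert (U ! k) ?C" "set W = insert (W ! k) ?C"
    using arg_cong[OF U', of set] arg_cong[OF W', of set] by simp_all
  have "distinct (take k U @ U ! k # drop (Suc k) U)" "distinct (take k W @ W ! k # drop (Suc k) U)"
    using U(1,3) U' W' W by argo+
  then have s': "U ! k \<notin> ?C" "W ! k \<notin> ?C" unfolding W(1)[symmetric] by simp_all
  have "Suc (card ?C) = length U" using s(1) s'(1) distinct_card[OF U(1)] by (metis List.finite_set card_insert_disjoint)
  then show ?thesis using dense_complexD(7)[OF K s'] s U(2,4) len(2) by metis
qed

text \<open>While \<open>z\<close> grows, the last r - 1 entries after \<open>X\<close> and after
  \<open>Y\<close> still differ in at most one place, which moves to the left and finally drops out.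
  For \<open>X = Y\<close> this counts the tight continuations of a single clique.\<close>

lemma card_common_tight_words:
  fixes \<gamma> :: real
  assumes K: "dense_complex r \<gamma> V K" and r: "2 \<le> r" and \<gamma>: "0 \<le> \<gamma>"
    and X: "ordered_clique K r X" and Y: "ordered_clique K r Y"
    and eq: "\<And>j. j < length X \<Longrightarrow> j \<noteq> i \<Longrightarrow> X ! j = Y ! j"
  shows "\<gamma> ^ (r - 1) * card V ^ (r - 1) \<le> card {z \<in> words V (r - 1). tight K r (X @ z) \<and> tight K r (Y @ z)}"
proof (rule card_words_greedy[OF dense_complexD(1)[OF K] \<gamma>])
  note down = dense_complexD(2)[OF K]
  show "tight K r (X @ []) \<and> tight K r (Y @ [])"
    using X Y tight_clique[OF down] by (simp add: ordered_clique_def)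
  fix z assume z: "set z \<subseteq> V" "length z < r - 1" "tight K r (X @ z) \<and> tight K r (Y @ z)"
  let ?l = "length z"
  have len: "Suc (length X) = r" "Suc (length Y) = r" using X Y by (auto simp: ordered_clique_def)
  have wX: "tight K r (drop ?l X @ z)" using tight_drop[of K r "X @ z" ?l] z len by simp
  have wY: "tight K r (drop ?l Y @ z)" using tight_drop[of K r "Y @ z" ?l] z len by simp
  have l: "length (drop ?l X @ z) = r - 1" "length (drop ?l Y @ z) = r - 1" using z len by auto
  have "\<gamma> * card V \<le> card (ext K (set (drop ?l X @ z)) \<inter> ext K (set (drop ?l Y @ z)))"
  \<comment> \<open>The differing place, shifted by the number of entries dropped so far;
    \<open>r\<close> is an out-of-range value for the time after it has left the window.\<close>
  proof (rule common_extensions[OF K, where i = "if i < ?l then r else i - ?l"])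
    show "distinct (drop ?l X @ z)" "set (drop ?l X @ z) \<in> K" by (rule tight_windowD[OF wX], use l(1) r in linarith)+
    show "distinct (drop ?l Y @ z)" "set (drop ?l Y @ z) \<in> K" by (rule tight_windowD[OF wY], use l(2) r in linarith)+
    show "drop ?l X @ z \<noteq> []" using l(1) r by (intro notI) simp
    fix j assume j: "j < length (drop ?l X @ z)" "j \<noteq> (if i < ?l then r else i - ?l)"
    show "(drop ?l X @ z) ! j = (drop ?l Y @ z) ! j"
    proof (cases "j < length X - ?l")
      case True
      then have "X ! (?l + j) = Y ! (?l + j)" using j by (intro eq) (auto split: if_splits)
      moreover have "length Y = length X" "?l \<le> length X" using len z(2) by linarith+
      ultimately show ?thesis using True by (simp add: nth_append)
    next
      case False
      have "length Y = length X" using len by linarith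
      then show ?thesis using False by (simp add: nth_append)
    qed
  qed (use l r in auto)
  also have "card (ext K (set (drop ?l X @ z)) \<inter> ext K (set (drop ?l Y @ z)))
      \<le> card {v \<in> V. tight K r (X @ z @ [v]) \<and> tight K r (Y @ z @ [v])}"
  proof (intro card_mono subsetI)
    fix v assume v: "v \<in> ext K (set (drop ?l X @ z)) \<inter> ext K (set (drop ?l Y @ z))"
    have d: "drop (Suc (length (X @ z)) - r) (X @ z) = drop ?l X @ z"
      "drop (Suc (length (Y @ z)) - r) (Y @ z) = drop ?l Y @ z" using len z(2) by auto
    have "tight K r ((X @ z) @ [v])"
      using v z r by (intro tight_snoc[OF down, of r _ "set (drop ?l X @ z)"]) (auto simp only: d)
    moreover have "tight K r ((Y @ z) @ [v])"
      using v z r by (intro tight_snoc[OF down, of r _ "set (drop ?l Y @ z)"]) (auto simp only: d)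
    ultimately have "tight K r ((X @ z) @ [v])" "tight K r ((Y @ z) @ [v])" .
    then show "v \<in> {v \<in> V. tight K r (X @ z @ [v]) \<and> tight K r (Y @ z @ [v])}"
      using v dense_complexD(9)[OF K] by auto
  qed (use dense_complexD(1)[OF K] in auto)
  finally show "\<gamma> * card V \<le> card {v \<in> V. tight K r (X @ z @ [v]) \<and> tight K r (Y @ z @ [v])}" by simp
qed

section \<open>Walks on ordered cliques\<close>

definition tight_step :: "'a set set \<Rightarrow> nat \<Rightarrow> 'a set \<Rightarrow> 'a list \<Rightarrow> 'a list \<Rightarrow> bool" where
  "tight_step K r S X Y \<longleftrightarrow>
     (\<exists>L. length L = r \<and> distinct L \<and> set L \<in> K \<and> set L \<subseteq> S \<and> X = butlast L \<and> Y = tl L)"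

text \<open>Steps must stay inside \<open>S\<close>, so that a walk can be located among the letters
  of a word of fixed length although its number of steps is not bounded.\<close>

abbreviation reach :: "'a set set \<Rightarrow> nat \<Rightarrow> 'a set \<Rightarrow> 'a list \<Rightarrow> 'a list \<Rightarrow> bool" where
  "reach K r S \<equiv> (tight_step K r S)\<^sup>*\<^sup>*"

lemma reach_mono: "reach K r S X Y \<Longrightarrow> S \<subseteq> S' \<Longrightarrow> reach K r S' X Y"
proof (induction rule: rtranclp_induct)
  case (step Y Z)
  then have "tight_step K r S' Y Z" unfolding tight_step_def by blast
  then show ?case using step by auto
qed simp

text \<open>Going once around a clique undoes a step.\<close>

lemma reach_sym:
  assumes "reach K r S X Y"
  shows "reach K r S Y X"
proof -
  have rot: "reach K r S (butlast L) (butlast (rotate n L))"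
    if L: "length L = r" "distinct L" "set L \<in> K" "set L \<subseteq> S" for L n
  proof (induction n)
    case (Suc n)
    let ?L = "rotate n L"
    have "tl ?L = butlast (rotate1 ?L)" by (cases ?L) auto
    then have "tight_step K r S (butlast ?L) (butlast (rotate (Suc n) L))"
      using L unfolding tight_step_def by (intro exI[of _ ?L]) simp
    then show ?case using Suc by auto
  qed simp
  have undo: "reach K r S Y X" if step: "tight_step K r S X Y" for X Y
  proof -
    obtain L where L: "length L = r" "distinct L" "set L \<in> K" "set L \<subseteq> S" "X = butlast L" "Y = tl L"
      using step by (auto simp: tight_step_def)
    show ?thesis
    proof (cases L)
      case (Cons a l)
      have "reach K r S (butlast (rotate1 L)) (butlast (rotate (length l) (rotate1 L)))"
        using L by (intro rot) auto
      moreover have "rotate (length l) (rotate1 L) = L"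
        using rotate_id[of "Suc (length l)" L] Cons by (simp add: rotate1_rotate_swap)
      ultimately show ?thesis using L Cons by simp
    qed (use L in simp)
  qed
  show ?thesis using assms
  proof (induction rule: rtranclp_induct)
    case (step Y Z)
    then show ?case using undo[OF step(2)] by (meson rtranclp_trans)
  qed simp
qed

lemma tight_imp_reach:
  assumes "tight K r u" "set u \<subseteq> S" "r \<le> Suc (length u)" "2 \<le> r"
  shows "reach K r S (take (r - 1) u) (drop (Suc (length u) - r) u)"
  using assms
proof (induction u rule: rev_induct)
  case (snoc b u)
  show ?case
  proof (cases "r \<le> Suc (length u)")
    case True
    let ?L = "drop (Suc (length u) - r) u @ [b]"
    have "tight K r u" using snoc.prems tight_append1 by blast
    then have "reach K r S (take (r - 1) u) (drop (Suc (length u) - r) u)"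
      using snoc True by auto
    moreover have "tight_step K r S (drop (Suc (length u) - r) u) (drop (Suc (length (u @ [b])) - r) (u @ [b]))"
      unfolding tight_step_def
    proof (intro exI[of _ ?L] conjI)
      have len: "length ?L = r" using True snoc.prems by simp
      have "tight K r ?L"
        using tight_drop[OF snoc.prems(1), of "Suc (length u) - r"] snoc.prems by simp
      then show "distinct ?L" "set ?L \<in> K" using tight_windowD[of K r ?L] len by auto
      show "length ?L = r" by fact
      show "set ?L \<subseteq> S" using snoc.prems by (auto dest: in_set_dropD)
      show "drop (Suc (length (u @ [b])) - r) (u @ [b]) = tl ?L"
        using True snoc.prems
        by (simp add: Suc_diff_le drop_append tl_append2 drop_Suc flip: drop_tl)
    qed simp
    ultimately show ?thesis using True snoc.prems by auto
  next
    case False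
    then have "r = Suc (length (u @ [b]))" using snoc.prems by simp
    then show ?thesis by simp
  qed
qed auto

lemma reach_imp_tight:
  assumes "reach K r S X Y" "ordered_clique K r X" "set X \<subseteq> S" "down K"
  shows "\<exists>w. tight K r (w @ Y) \<and> set (w @ Y) \<subseteq> S \<and> take (r - 1) (w @ Y) = X \<and> Suc (length Y) = r"
  using assms(1)
proof (induction rule: rtranclp_induct)
  case base
  then show ?case using assms tight_clique by (intro exI[of _ "[]"]) (auto simp: ordered_clique_def)
next
  case (step Y Z)
  from step.IH step.hyps(2) obtain w L where w: "tight K r (w @ Y)" "set (w @ Y) \<subseteq> S" "take (r - 1) (w @ Y) = X" "Suc (length Y) = r"
    and L: "length L = r" "distinct L" "set L \<in> K" "set L \<subseteq> S" "Y = butlast L" "Z = tl L"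
    by (auto simp: tight_step_def)
  then obtain y where y: "L = y # Z" by (cases L) auto
  have "L = Y @ [last L]" using append_butlast_last_id[of L] L(5) y by (metis list.discI)
  have "tight K r (w @ Y @ [last L])"
  proof (intro tight_glue[OF w(1)])
    show "tight K r (Y @ [last L])"
      using tight_clique[OF assms(4) L(2,3)] \<open>L = Y @ [last L]\<close> by metis
  qed (use w(4) in simp)
  moreover have e: "w @ Y @ [last L] = (w @ [y]) @ Z" using \<open>L = Y @ [last L]\<close> y by (metis append_Cons append_Nil append_assoc)
  ultimately have "tight K r ((w @ [y]) @ Z)" by argo
  moreover have "take (r - 1) ((w @ [y]) @ Z) = X"
    unfolding e[symmetric] using w(3,4) by (simp flip: append_assoc)
  moreover have "Suc (length Z) = r" using y L(1) by auto
  moreover have "set ((w @ [y]) @ Z) \<subseteq> S" using w(2) L(4) y by auto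
  ultimately show ?case by (intro exI[of _ "w @ [y]"]) auto
qed

text \<open>The entries at \<open>insert i D\<close> are kept and the others are replaced by common
  new vertices. At every moment the partial fillings of \<open>X\<close> and \<open>Y\<close> can
  differ in place \<open>i\<close> only, so the next vertex is a common extension.\<close>

lemma card_common_fillings:
  fixes \<gamma> :: real
  assumes K: "dense_complex r \<gamma> V K" and \<gamma>: "0 \<le> \<gamma>" "\<gamma> \<le> 1"
    and X: "ordered_clique K r X" and Y: "ordered_clique K r Y"
    and D: "D \<subseteq> {..<r - 1}" "\<And>j. j \<in> D \<Longrightarrow> X ! j = Y ! j" and i: "i < r - 1" "i \<notin> D"
    and fill_def: "\<And>Z g. fill Z g = map (\<lambda>j. if j \<in> insert i D then Z ! j else g ! j) [0..<r - 1]"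
  shows "\<gamma> ^ (r - 1) * card V ^ (r - 1)
    \<le> card {g \<in> words V (r - 1). ordered_clique K r (fill X g) \<and> ordered_clique K r (fill Y g)}"
proof -
  note KD = dense_complexD[OF K]
  define \<phi> where "\<phi> Z g j = (if j \<in> insert i D then Z ! j else g ! j)" for Z g :: "'a list" and j
  \<comment> \<open>Places already decided once \<open>l\<close> letters of \<open>g\<close> are
    chosen: the kept ones and those before \<open>l\<close>.\<close>
  define I where "I l = {j. j < r - 1 \<and> (j \<in> insert i D \<or> j < l)}" for l
  define Q where "Q Z g \<longleftrightarrow> inj_on (\<phi> Z g) (I (length g)) \<and> \<phi> Z g ` I (length g) \<in> K" for Z g
  have len: "Suc (length X) = r" "Suc (length Y) = r" using X Y by (auto simp: ordered_clique_def)
  have finI: "finite (I l)" for l by (simp add: I_def)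
  have Q0: "Q Z []" if "ordered_clique K r Z" for Z
  proof -
    have "\<phi> Z [] ` I 0 \<subseteq> set Z" using that by (auto simp: \<phi>_def I_def ordered_clique_def)
    moreover have "inj_on (\<phi> Z []) (I 0)"
      using that by (auto simp: inj_on_def \<phi>_def I_def ordered_clique_def nth_eq_iff_index_eq)
    ultimately show ?thesis using that downD[OF KD(2)] by (auto simp: Q_def ordered_clique_def)
  qed
  have snoc: "Q Z (g @ [v])" if "Q Z g" "length g < r - 1"
    "length g \<in> insert i D \<or> v \<in> ext K (\<phi> Z g ` I (length g))" for Z g v
  proof -
    let ?l = "length g"
    have cong: "\<phi> Z (g @ [v]) j = \<phi> Z g j" if "j \<in> I ?l" for j
      using that by (auto simp: \<phi>_def I_def nth_append)
    show ?thesis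
    proof (cases "?l \<in> insert i D")
      case True
      then have "I (Suc ?l) = I ?l" by (auto simp: I_def less_Suc_eq)
      moreover have "inj_on (\<phi> Z (g @ [v])) (I ?l) \<longleftrightarrow> inj_on (\<phi> Z g) (I ?l)" using cong by (intro inj_on_cong)
      moreover have "\<phi> Z (g @ [v]) ` I ?l = \<phi> Z g ` I ?l" using cong by (intro image_cong) auto
      ultimately show ?thesis using that(1) by (simp add: Q_def)
    next
      case False
      then have I: "I (Suc ?l) = insert ?l (I ?l)" "?l \<notin> I ?l" using that(2) by (auto simp: I_def)
      have v: "v \<notin> \<phi> Z g ` I ?l" "insert v (\<phi> Z g ` I ?l) \<in> K" using that False by (auto simp: ext_def)
      have "\<phi> Z (g @ [v]) ?l = v" using False by (simp add: \<phi>_def)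
      moreover have im: "\<phi> Z (g @ [v]) ` I ?l = \<phi> Z g ` I ?l" using cong by (intro image_cong) auto
      moreover have "inj_on (\<phi> Z (g @ [v])) (I ?l)"
        using that(1) cong inj_on_cong[of "I ?l" "\<phi> Z (g @ [v])" "\<phi> Z g"] by (simp add: Q_def)
      ultimately show ?thesis using v I by (simp add: Q_def)
    qed
  qed
  have "\<gamma> ^ (r - 1) * card V ^ (r - 1) \<le> card {g \<in> words V (r - 1). Q X g \<and> Q Y g}"
  proof (rule card_words_greedy[OF KD(1) \<gamma>(1)])
    show "Q X [] \<and> Q Y []" using Q0 X Y by blast
    fix g assume g: "set g \<subseteq> V" "length g < r - 1" "Q X g \<and> Q Y g"
    let ?l = "length g"
    show "\<gamma> * card V \<le> card {v \<in> V. Q X (g @ [v]) \<and> Q Y (g @ [v])}"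
    proof (cases "?l \<in> insert i D")
      \<comment> \<open>At a kept place the letter of \<open>g\<close> is ignored, so every vertex
        of \<open>V\<close> is allowed; this meets the bound because \<gamma> \<le> 1.\<close>
      case True
      then have "{v \<in> V. Q X (g @ [v]) \<and> Q Y (g @ [v])} = V" using snoc g by auto
      then show ?thesis using \<gamma> by (simp add: mult_left_le_one_le)
    next
      case False
      define C where "C = \<phi> X g ` (I ?l - {i})"
      have CY: "C = \<phi> Y g ` (I ?l - {i})" unfolding C_def
        using D by (intro image_cong) (auto simp: \<phi>_def)
      have iI: "i \<in> I ?l" using i by (auto simp: I_def)
      have ins: "\<phi> X g ` I ?l = insert (\<phi> X g i) C" "\<phi> Y g ` I ?l = insert (\<phi> Y g i) C"
        unfolding C_def using iI CY C_def by blast+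
      have nin: "\<phi> X g i \<notin> C" "\<phi> Y g i \<notin> C"
      proof -
        show "\<phi> X g i \<notin> C" unfolding C_def using g(3) iI by (auto simp: Q_def inj_on_def)
        show "\<phi> Y g i \<notin> C" unfolding CY using g(3) iI by (auto simp: Q_def inj_on_def)
      qed
      have "I ?l \<subseteq> {..<r - 1} - {?l}" using False by (auto simp: I_def)
      then have "card (I ?l) \<le> card ({..<r - 1} - {?l})" by (intro card_mono) auto
      then have "card (I ?l) \<le> r - 2" using g(2) by simp
      moreover have "card C \<le> card (I ?l) - 1"
        unfolding C_def using card_image_le[of "I ?l - {i}" "\<phi> X g"] finI iI by simp
      moreover have "card (I ?l) > 0" using iI finI card_gt_0_iff by blast
      ultimately have "Suc (card C) < r" by linarith
      then have "\<gamma> * card V \<le> card (ext K (insert (\<phi> X g i) C) \<inter> ext K (insert (\<phi> Y g i) C))"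
        using KD(7)[OF nin] g(3) ins by (simp add: Q_def)
      also have "\<dots> \<le> card {v \<in> V. Q X (g @ [v]) \<and> Q Y (g @ [v])}"
        using KD(1,9) snoc g ins by (intro of_nat_mono card_mono) auto
      finally show ?thesis .
    qed
  qed
  also have "\<dots> \<le> card {g \<in> words V (r - 1). ordered_clique K r (fill X g) \<and> ordered_clique K r (fill Y g)}"
  proof (intro of_nat_mono card_mono subsetI)
    have "ordered_clique K r (fill Z g)" if "Q Z g" "length g = r - 1" for Z g
    proof -
      have "I (r - 1) = {..<r - 1}" by (auto simp: I_def)
      moreover have "fill Z g = map (\<phi> Z g) [0..<r - 1]" by (simp add: fill_def \<phi>_def)
      ultimately show ?thesis using that len
        by (auto simp: ordered_clique_def Q_def distinct_map atLeast0LessThan)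
    qed
    then show "g \<in> {g \<in> words V (r - 1). ordered_clique K r (fill X g) \<and> ordered_clique K r (fill Y g)}"
      if "g \<in> {g \<in> words V (r - 1). Q X g \<and> Q Y g}" for g
      using that by (auto simp: words_def)
  qed (use KD(1) in auto)
  finally show ?thesis .
qed

text \<open>Two ordered cliques that agree in all but one position merge after \<open>r - 1\<close> common steps; in
  general one changes the positions of \<open>X\<close> one by one, filling up the rest with common vertices.\<close>

lemma card_reach_words:
  fixes \<gamma> :: real
  assumes r: "2 \<le> r" and \<gamma>: "0 < \<gamma>" "\<gamma> \<le> 1"
  shows "\<exists>s c. 0 < c \<and> (\<forall>(V :: 'a set) K X Y D. dense_complex r \<gamma> V K \<longrightarrow> ordered_clique K r X \<longrightarrow>
     ordered_clique K r Y \<longrightarrow> D \<subseteq> {..<r - 1} \<longrightarrow> card D + e = r - 1 \<longrightarrow> (\<forall>j\<in>D. X ! j = Y ! j) \<longrightarrow>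
     c * real (card V) ^ s \<le> card {g \<in> words V s. reach K r (set X \<union> set Y \<union> set g) X Y})"
proof (induction e)
  case 0
  show ?case
  proof (rule exI[of _ 0], rule exI[of _ 1], intro conjI allI impI)
    fix V :: "'a set" and K :: "'a set set" and X Y :: "'a list" and D :: "nat set"
    assume a: "ordered_clique K r X" "ordered_clique K r Y" "D \<subseteq> {..<r - 1}" "card D + 0 = r - 1" "\<forall>j\<in>D. X ! j = Y ! j"
    then have "D = {..<r - 1}" by (intro card_subset_eq) auto
    then have "X = Y" using a by (intro nth_equalityI) (auto simp: ordered_clique_def)
    then have "{g \<in> words V 0. reach K r (set X \<union> set Y \<union> set g) X Y} = {[]}" by auto
    then show "1 * real (card V) ^ 0 \<le> card {g \<in> words V 0. reach K r (set X \<union> set Y \<union> set g) X Y}" by simp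
  qed simp
next
  case (Suc e)
  then obtain s c where c: "0 < c" and IH: "\<forall>(V :: 'a set) K X Y D. dense_complex r \<gamma> V K \<longrightarrow> ordered_clique K r X \<longrightarrow>
     ordered_clique K r Y \<longrightarrow> D \<subseteq> {..<r - 1} \<longrightarrow> card D + e = r - 1 \<longrightarrow> (\<forall>j\<in>D. X ! j = Y ! j) \<longrightarrow>
     c * real (card V) ^ s \<le> card {g \<in> words V s. reach K r (set X \<union> set Y \<union> set g) X Y}"
    by (elim exE conjE)
  \<comment> \<open>A word consists of the filling, the common continuation \<open>z\<close> and the
    words of two walks from the induction hypothesis, each between cliques that may differ in
    \<open>e\<close> places.\<close>
  let ?s = "(r - 1) + ((r - 1) + (s + s))" and ?c = "\<gamma> ^ (r - 1) * (\<gamma> ^ (r - 1) * (c * c))"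
  show ?case
  proof (rule exI[of _ ?s], rule exI[of _ ?c], intro conjI allI impI)
    show "?c > 0" using c \<gamma> by simp
    fix V :: "'a set" and K :: "'a set set" and X Y :: "'a list" and D :: "nat set"
    assume K: "dense_complex r \<gamma> V K" and X: "ordered_clique K r X" and Y: "ordered_clique K r Y"
      and D: "D \<subseteq> {..<r - 1}" "card D + Suc e = r - 1" "\<forall>j\<in>D. X ! j = Y ! j"
    note V = dense_complexD(1)[OF K]
    have "D \<noteq> {..<r - 1}" using D(2) by auto
    then obtain i where i: "i < r - 1" "i \<notin> D" using D(1) by auto
    define fill where "fill Z g = map (\<lambda>j. if j \<in> insert i D then Z ! j else g ! j) [0..<r - 1]" for Z g :: "'a list"
    define G1 where "G1 = {g \<in> words V (r - 1). ordered_clique K r (fill X g) \<and> ordered_clique K r (fill Y g)}"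
    define G2 where "G2 g = {z \<in> words V (r - 1). tight K r (fill X g @ z) \<and> tight K r (fill Y g @ z)}" for g
    define R where "R A B = {g \<in> words V s. reach K r (set A \<union> set B \<union> set g) A B}" for A B
    define G where "G = {g @ h |g h. g \<in> G1 \<and> h \<in> {z @ y |z y. z \<in> G2 g \<and> y \<in> {a @ b |a b. a \<in> R X (fill X g) \<and> b \<in> R (fill Y g) Y}}}"
    have fill_nth: "fill Z g ! j = (if j \<in> insert i D then Z ! j else g ! j)" if "j < r - 1" for Z g j
      using that by (simp add: fill_def)
    have len: "length X = r - 1" "length Y = r - 1" using X Y by (auto simp: ordered_clique_def)
    have D': "insert i D \<subseteq> {..<r - 1}" "card (insert i D) + e = r - 1"
      using D i finite_subset[OF D(1)] by auto
    have c1: "\<gamma> ^ (r - 1) * card V ^ (r - 1) \<le> card G1"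
      unfolding G1_def
      by (rule card_common_fillings[OF K _ \<gamma>(2) X Y D(1) _ i fill_def]) (use \<gamma> D(3) in auto)
    have c2: "\<gamma> ^ (r - 1) * card V ^ (r - 1) \<le> card (G2 g)" if "g \<in> G1" for g
      unfolding G2_def
    proof (rule card_common_tight_words[OF K r])
      fix j assume "j < length (fill X g)" "j \<noteq> i"
      then show "fill X g ! j = fill Y g ! j" using D(3) by (auto simp: fill_def)
    qed (use that \<gamma> in \<open>auto simp: G1_def\<close>)
    have c3: "c * card V ^ s \<le> card (R X (fill X g))" "c * card V ^ s \<le> card (R (fill Y g) Y)" if "g \<in> G1" for g
    proof -
      have j: "j < r - 1" if "j \<in> insert i D" for j using that D'(1) by auto
      have "ordered_clique K r (fill X g)" "ordered_clique K r (fill Y g)" using that by (auto simp: G1_def)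
      note IH' = IH[rule_format, OF K _ _ D']
      show "c * card V ^ s \<le> card (R X (fill X g))"
        unfolding R_def using IH'[OF X \<open>ordered_clique K r (fill X g)\<close>] fill_nth j by auto
      show "c * card V ^ s \<le> card (R (fill Y g) Y)"
        unfolding R_def using IH'[OF \<open>ordered_clique K r (fill Y g)\<close> Y] fill_nth j by auto
    qed
    have "?c * card V ^ ?s \<le> card G"
      unfolding G_def
    proof (intro card_words_append[OF V])
      show "\<gamma> ^ (r - 1) * real (card V ^ (r - 1)) \<le> card G1" using c1 by simp
      fix g assume g: "g \<in> G1"
      show "\<gamma> ^ (r - 1) * real (card V ^ (r - 1)) \<le> card (G2 g)" using c2[OF g] by simp
      show "c * real (card V ^ s) \<le> card (R X (fill X g))" using c3[OF g] by simp
      show "c * real (card V ^ s) \<le> card (R (fill Y g) Y)" using c3[OF g] by simp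
    qed (use \<gamma> c in \<open>auto simp: G1_def G2_def R_def words_def\<close>)
    also have "\<dots> \<le> card {g \<in> words V ?s. reach K r (set X \<union> set Y \<union> set g) X Y}"
    proof (intro of_nat_mono card_mono subsetI)
      fix w assume "w \<in> G"
      then obtain g z a b where w: "w = g @ z @ a @ b" "g \<in> G1" "z \<in> G2 g" "a \<in> R X (fill X g)" "b \<in> R (fill Y g) Y"
        unfolding G_def by auto
      let ?S = "set X \<union> set Y \<union> set w"
      have gl: "length g = r - 1" "length z = r - 1" using w by (auto simp: G1_def G2_def words_def)
      have sub: "set (fill X g) \<subseteq> ?S" "set (fill Y g) \<subseteq> ?S"
        using gl len w(1) by (auto simp: fill_def)
      have r1: "reach K r ?S X (fill X g)" "reach K r ?S (fill Y g) Y"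
        using w sub by (auto simp: R_def elim!: reach_mono)
      have "reach K r ?S (fill Z g) z" if "tight K r (fill Z g @ z)" "set (fill Z g) \<subseteq> ?S" for Z
      proof -
        have l: "length (fill Z g) = r - 1" by (simp add: fill_def)
        have "set (fill Z g @ z) \<subseteq> ?S" using that(2) w(1) by auto
        moreover have "r \<le> Suc (length (fill Z g @ z))" "Suc (length (fill Z g @ z)) - r = r - 1" using l gl r by auto
        ultimately show ?thesis using tight_imp_reach[OF that(1), of ?S] l r by simp
      qed
      then have "reach K r ?S (fill X g) z" "reach K r ?S (fill Y g) z"
        using w(3) sub by (auto simp: G2_def)
      \<comment> \<open>From \<open>X\<close> to its filling and on to \<open>z\<close>; then the
        walk from the filling of \<open>Y\<close> to \<open>z\<close> is traversed backwards, and
        from there to \<open>Y\<close>.\<close>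
      then have "reach K r ?S X Y" using r1 reach_sym rtranclp_trans by meson
      moreover have "w \<in> words V ?s" using w by (auto simp: G1_def G2_def R_def words_def)
      ultimately show "w \<in> {g \<in> words V ?s. reach K r (set X \<union> set Y \<union> set g) X Y}" by simp
    qed (use V in auto)
    finally show "?c * real (card V) ^ ?s \<le> card {g \<in> words V ?s. reach K r (set X \<union> set Y \<union> set g) X Y}" by simp
  qed
qed

text \<open>The path \<open>z\<close> may use only some letters of \<open>g\<close>. Thus all
  connections can be sought among words of one length, although the length of \<open>z\<close> is
  not prescribed.\<close>

definition connectors :: "'a set set \<Rightarrow> nat \<Rightarrow> 'a list \<Rightarrow> 'a list \<Rightarrow> 'a list set" where
  "connectors K r X Y = {g. distinct g \<and> (\<exists>z. set z \<subseteq> set g \<and> distinct z \<and> tight K r (X @ z @ Y))}"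

lemma distinct_concat_nth:
  assumes "distinct (concat F)" "i < length F" "j < length F" "a < length (F ! i)" "b < length (F ! j)"
    "F ! i ! a = F ! j ! b"
  shows "i = j \<and> a = b"
proof -
  have sep: "set (F ! i) \<inter> set (F ! j) = {}" if "i < j" "j < length F" for i j
  proof -
    have "F ! i \<in> set (take j F)" "F ! j \<in> set (drop j F)"
      using that nth_mem[of i "take j F"] nth_mem[of 0 "drop j F"] by simp_all
    then have "set (F ! i) \<subseteq> set (concat (take j F))" "set (F ! j) \<subseteq> set (concat (drop j F))" by auto
    moreover have "distinct (concat (take j F) @ concat (drop j F))"
      using assms(1) by (metis append_take_drop_id concat_append)
    then have "set (concat (take j F)) \<inter> set (concat (drop j F)) = {}" unfolding distinct_append by blast
    ultimately show ?thesis by blast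
  qed
  have "F ! i ! a \<in> set (F ! i)" "F ! i ! a \<in> set (F ! j)" using assms(4-6) nth_mem by metis+
  then have ij: "i = j" using sep[of i j] sep[of j i] assms(2,3) by (cases i j rule: linorder_cases) auto
  have "F ! i \<in> set F" using assms(2) by simp
  then have "distinct (F ! i)" using assms(1) unfolding distinct_concat_iff by blast
  then show ?thesis using assms(4-6) ij by (simp add: nth_eq_iff_index_eq)
qed

text \<open>Place \<open>t\<close> of the index walk takes copy \<open>t\<close> of its part. Hence
  repeated visits to a part use different vertices, and the lifted walk is a path. It starts with
  the parts 0, ..., r - 2 and ends with the parts r - 1, ..., 2 (r - 1) - 1, where the transversals
  are known to continue \<open>X\<close> and to lead into \<open>Y\<close>.\<close>

lemma connector_from_blowup:
  assumes down: "down K" "{} \<in> K" and r: "2 \<le> r"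
    and F: "length F = s" "\<And>f. f \<in> set F \<Longrightarrow> length f = m" "listset (map set F) \<subseteq> T" "distinct (concat F)"
    and T: "\<And>h. h \<in> T \<Longrightarrow> tight K r (map (nth h) \<omega>)" "\<And>h. h \<in> T \<Longrightarrow> tight K r (X @ take (r - 1) h)"
       "\<And>h. h \<in> T \<Longrightarrow> tight K r (take (r - 1) (drop (r - 1) h) @ Y)"
    and \<omega>: "set \<omega> \<subseteq> {..<s}" "take (r - 1) \<omega> = [0..<r - 1]"
       "drop (Suc (length \<omega>) - r) \<omega> = [r - 1..<2 * (r - 1)]" "r \<le> Suc (length \<omega>)" "length \<omega> \<le> m"
    and s: "2 * (r - 1) \<le> s"
  shows "concat F \<in> connectors K r X Y"
proof -
  let ?l = "length \<omega>"
  define z where "z = map (\<lambda>t. F ! (\<omega> ! t) ! t) [0..<?l]"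
  have \<omega>s: "\<omega> ! t < s" if "t < ?l" for t using \<omega>(1) that by (meson lessThan_iff nth_mem subset_iff)
  have Fl: "length (F ! i) = m" if "i < s" for i using F(1,2) that by simp
  have m: "0 < m" using \<omega>(4,5) r by linarith
  have dz: "distinct z"
    unfolding z_def distinct_map
  proof (intro conjI inj_onI)
    fix t t' assume t: "t \<in> set [0..<?l]" "t' \<in> set [0..<?l]" "F ! (\<omega> ! t) ! t = F ! (\<omega> ! t') ! t'"
    then have "\<omega> ! t < length F" "\<omega> ! t' < length F" "t < length (F ! (\<omega> ! t))" "t' < length (F ! (\<omega> ! t'))"
      using \<omega>s F(1) Fl \<omega>(5) by auto
    then show "t = t'" using distinct_concat_nth[OF F(4)] t(3) by blast
  qed simp
  have tz: "tight K r z"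
    unfolding z_def
    by (rule tight_lift[OF down F(2,3) _ T(1)]) (use \<omega> F(1) dz in \<open>auto simp: z_def\<close>)
  have sz: "set z \<subseteq> set (concat F)"
  proof
    fix v assume "v \<in> set z"
    then obtain t where t: "t < ?l" "v = F ! (\<omega> ! t) ! t" by (auto simp: z_def)
    then have "F ! (\<omega> ! t) \<in> set F" "v \<in> set (F ! (\<omega> ! t))" using \<omega>s[of t] Fl[of "\<omega> ! t"] F(1) \<omega>(5) by auto
    then show "v \<in> set (concat F)" by auto
  qed
  have sel: "map (\<lambda>i. F ! i ! \<sigma> i) [0..<s] \<in> T" if "\<And>i. i < s \<Longrightarrow> \<sigma> i < m" for \<sigma>
    using that Fl F(1,3) by (auto simp: listset_map_set_iff intro!: subsetD[OF F(3)])
  have lz: "length z = ?l" by (simp add: z_def)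
  have \<omega>1: "\<omega> ! i = i" if "i < r - 1" for i
    using that \<omega>(2,4) by (metis add_0 diff_zero length_upt nth_take nth_upt)
  have \<omega>2: "\<omega> ! (Suc ?l - r + i) = r - 1 + i" if "i < r - 1" for i
  proof -
    have "[r - 1..<2 * (r - 1)] ! i = r - 1 + i" using that by (intro nth_upt) linarith
    then show ?thesis unfolding \<omega>(3)[symmetric] using \<omega>(4) that by simp
  qed
  have "take (r - 1) z = take (r - 1) (map (\<lambda>i. F ! i ! (if i < r - 1 then i else 0)) [0..<s])"
    using s \<omega>(4) lz \<omega>1 by (intro nth_equalityI) (auto simp: z_def)
  moreover have "map (\<lambda>i. F ! i ! (if i < r - 1 then i else 0)) [0..<s] \<in> T"
    using \<omega>(4,5) m by (intro sel) auto
  ultimately have "tight K r (X @ take (r - 1) z)" using T(2) by metis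
  moreover have "take (r - 1) z @ drop (r - 1) z = z" by simp
  ultimately have Xz: "tight K r (X @ z)"
    using tight_glue[of K r X "take (r - 1) z" "drop (r - 1) z"] tz lz \<omega>(4) r by simp
  let ?d = "Suc ?l - r"
  \<comment> \<open>A transversal that agrees with the end of \<open>z\<close>: part r - 1 + i
    contributes copy \<open>?d + i\<close>, the one visited there. Parts outside this range may
    contribute any copy, here 0.\<close>
  let ?h = "map (\<lambda>i. F ! i ! (if r - 1 \<le> i \<and> i < 2 * (r - 1) then ?d + (i - (r - 1)) else 0)) [0..<s]"
  have hT: "?h \<in> T"
    using \<omega>(4,5) m by (intro sel) auto
  have "drop ?d z = take (r - 1) (drop (r - 1) ?h)"
  proof (rule nth_equalityI)
    fix i assume "i < length (drop ?d z)"
    then have i: "i < r - 1" using lz \<omega>(4) by simp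
    then have "?d + i < ?l" "r - 1 + i < s" using s \<omega>(4) by auto
    moreover have "r + i - Suc 0 < 2 * (r - Suc 0)" "r - Suc 0 \<le> r + i - Suc 0" using i by arith+
    ultimately show "drop ?d z ! i = take (r - 1) (drop (r - 1) ?h) ! i"
      using i \<omega>2[OF i] lz by (simp add: z_def)
  qed (use s lz \<omega>(4) in simp)
  then have "tight K r (drop ?d z @ Y)" using T(3)[OF hT] by (simp only:)
  then have "tight K r (take ?d z @ drop ?d z @ Y)"
    using tz lz \<omega>(4) by (intro tight_glue) auto
  then have "tight K r (z @ Y)" by (metis append.assoc append_take_drop_id)
  then have "tight K r (X @ z @ Y)" using tight_glue[OF Xz] lz \<omega>(4) by simp
  then show ?thesis using dz sz F(4) by (auto simp: connectors_def)
qed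

text \<open>A word \<open>x @ y @ g\<close> carries a continuation \<open>x\<close> of
  \<open>X\<close>, a backward continuation \<open>y\<close> of \<open>Y\<close>, and room
  \<open>g\<close> for a walk from \<open>x\<close> to \<open>y\<close>. Read as a walk on places,
  it depends only on which sets of places are cliques. There are boundedly many such patterns, so a
  positive proportion of the words shares one index walk, and their blow-ups are connectors.\<close>

lemma card_connectors:
  fixes \<gamma> :: real
  assumes r: "2 \<le> r" and \<gamma>: "0 < \<gamma>" "\<gamma> \<le> 1"
  shows "\<exists>N c n0. 0 < N \<and> 0 < c \<and> c \<le> 1 \<and> (\<forall>(V :: 'a set) K X Y. dense_complex r \<gamma> V K \<longrightarrow> n0 \<le> card V \<longrightarrow>
     ordered_clique K r X \<longrightarrow> ordered_clique K r Y \<longrightarrow> c * real (card V) ^ N \<le> card (words V N \<inter> connectors K r X Y))"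
proof -
  obtain s c where c: "0 < c" and reach: "\<And>(V :: 'a set) K X Y. dense_complex r \<gamma> V K \<Longrightarrow> ordered_clique K r X \<Longrightarrow>
     ordered_clique K r Y \<Longrightarrow> c * real (card V) ^ s \<le> card {g \<in> words V s. reach K r (set X \<union> set Y \<union> set g) X Y}"
  proof -
    from card_reach_words[OF r \<gamma>, of "r - 1", where 'a = 'a]
    obtain s c where "0 < c" and *: "\<forall>(V :: 'a set) K X Y D. dense_complex r \<gamma> V K \<longrightarrow> ordered_clique K r X \<longrightarrow>
     ordered_clique K r Y \<longrightarrow> D \<subseteq> {..<r - 1} \<longrightarrow> card D + (r - 1) = r - 1 \<longrightarrow> (\<forall>j\<in>D. X ! j = Y ! j) \<longrightarrow>
     c * real (card V) ^ s \<le> card {g \<in> words V s. reach K r (set X \<union> set Y \<union> set g) X Y}"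
      by (elim exE conjE)
    show thesis by (rule that[OF \<open>0 < c\<close>]) (rule *[rule_format, where D = "{}"]; simp)
  qed
  let ?R = "r - 1"
  define s' where "s' = ?R + (?R + s)"
  define W where "W p \<omega> \<longleftrightarrow> tight p r \<omega> \<and> set \<omega> \<subseteq> {..<s'} \<and> take ?R \<omega> = [0..<?R] \<and>
    drop (Suc (length \<omega>) - r) \<omega> = [?R..<2 * ?R] \<and> r \<le> Suc (length \<omega>)" for p \<omega>
  \<comment> \<open>One index walk per clique pattern, fixed independently of \<open>V\<close>, so
    that \<open>m\<close> and the constants do not depend on \<open>V\<close> or \<open>K\<close>.
    For a pattern without such a walk the value is arbitrary.\<close>
  define om where "om p = (SOME \<omega>. W p \<omega>)" for p
  define \<Omega> where "\<Omega> = om ` Pow (Pow {..<s'})"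
  have \<Omega>: "finite \<Omega>" "\<Omega> \<noteq> {}" by (auto simp: \<Omega>_def)
  \<comment> \<open>Enough copies in each part for every walk in \<open>\<Omega>\<close>, one per
    step; \<open>Suc\<close> keeps \<open>m\<close> positive.\<close>
  define m where "m = Suc (Max (length ` \<Omega>))"
  have m: "length \<omega> \<le> m" if "\<omega> \<in> \<Omega>" for \<omega> using \<Omega> that by (simp add: m_def le_SucI)
  define c0 where "c0 = \<gamma> ^ ?R * (\<gamma> ^ ?R * c)"
  define c1 where "c1 = c0 / 2 / card \<Omega>"
  define c2 where "c2 = c1 ^ (m ^ s') / 2"
  define N where "N = s' * m"
  have s': "0 < s'" using r by (simp add: s'_def)
  have pos: "0 < c0" "0 < c1" "0 < c2" "0 < N" "0 < card \<Omega>"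
    using c \<gamma> \<Omega> s' by (auto simp: c0_def c1_def c2_def N_def m_def card_gt_0_iff)
  define n0 where "n0 = Suc (nat \<lceil>2 * real (s' * s') / c0\<rceil> + nat \<lceil>2 * real (N * N) / (c1 ^ (m ^ s'))\<rceil>)"
  have main: "c2 * real (card V) ^ N \<le> card (words V N \<inter> connectors K r X Y)"
    if K: "dense_complex r \<gamma> V K" and n: "n0 \<le> card V" and X: "ordered_clique K r X" and Y: "ordered_clique K r Y"
    for V :: "'a set" and K X Y
  proof -
    note KD = dense_complexD[OF K] and V = dense_complexD(1)[OF K]
    have Vpos: "0 < card V" using n by (simp add: n0_def)
    have big: "2 * real (s' * s') \<le> c0 * card V" "2 * real (N * N) \<le> c1 ^ (m ^ s') * card V"
    proof -
      have "2 * real (s' * s') / c0 \<le> card V" "2 * real (N * N) / (c1 ^ (m ^ s')) \<le> card V"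
        using n unfolding n0_def by linarith+
      then show "2 * real (s' * s') \<le> c0 * card V" "2 * real (N * N) \<le> c1 ^ (m ^ s') * card V"
        using pos by (simp_all add: field_simps)
    qed
    define Fw where "Fw = {x \<in> words V ?R. tight K r (X @ x)}"
    define Bw where "Bw = {y \<in> words V ?R. tight K r (y @ Y)}"
    have cF: "\<gamma> ^ ?R * card V ^ ?R \<le> card {z \<in> words V ?R. tight K r (Z @ z)}" if "ordered_clique K r Z" for Z
      using card_common_tight_words[OF K r _ that that, of 0] \<gamma> by simp
    have cB: "\<gamma> ^ ?R * card V ^ ?R \<le> card Bw"
    proof -
      \<comment> \<open>Backward continuations of \<open>Y\<close> are the reversed forward
        continuations of \<open>rev Y\<close>.\<close>
      have "Bw = rev ` {z \<in> words V ?R. tight K r (rev Y @ z)}" (is "_ = _ ` ?Z")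
      proof (intro equalityI subsetI)
        fix y assume "y \<in> Bw"
        then have "rev y \<in> ?Z" using tight_rev[of K r "y @ Y"] by (auto simp: Bw_def words_def)
        then show "y \<in> rev ` ?Z" by (metis image_eqI rev_rev_ident)
      next
        fix y assume "y \<in> rev ` ?Z"
        then show "y \<in> Bw" using tight_rev[of K r "y @ Y"] by (auto simp: Bw_def words_def)
      qed
      then have "card Bw = card ?Z" by (simp add: card_image)
      moreover have "ordered_clique K r (rev Y)" using Y by (simp add: ordered_clique_def)
      ultimately show ?thesis using cF by metis
    qed
    define T0 where "T0 = {x @ h |x h. x \<in> Fw \<and> h \<in> {y @ g |y g. y \<in> Bw \<and> g \<in> {g \<in> words V s. reach K r (set x \<union> set y \<union> set g) x y}}}"
    have oc: "ordered_clique K r x" if "x \<in> Fw \<or> x \<in> Bw" for x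
    proof -
      have "tight K r x" "length x = r - 1" using that tight_append1 tight_append2 by (auto simp: Fw_def Bw_def words_def)
      then show ?thesis using tight_windowD[of K r x] r by (simp add: ordered_clique_def)
    qed
    have "c0 * card V ^ s' \<le> card T0"
      unfolding T0_def c0_def s'_def
    proof (intro card_words_append[OF V])
      show "\<gamma> ^ ?R * real (card V ^ ?R) \<le> card Fw" using cF[OF X] by (simp add: Fw_def)
      show "\<gamma> ^ ?R * real (card V ^ ?R) \<le> card Bw" using cB by simp
      show "c * real (card V ^ s) \<le> card {g \<in> words V s. reach K r (set x \<union> set y \<union> set g) x y}"
        if "x \<in> Fw" "y \<in> Bw" for x y using reach[OF K oc oc] that by simp
    qed (use \<gamma> c in \<open>auto simp: Fw_def Bw_def words_def\<close>)
    moreover have T0w: "T0 \<subseteq> words V s'" by (auto simp: T0_def Fw_def Bw_def words_def s'_def)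
    ultimately have cT: "c0 / 2 * card V ^ s' \<le> card {h \<in> T0. \<not> \<not> distinct h}"
      using card_words_not_distinct[OF V] big(1) s' by (intro card_words_Diff[OF V]) auto
    define T1 where "T1 = {h \<in> T0. distinct h}"
    \<comment> \<open>The complex as seen on the places of \<open>h\<close>; it decides which index
      walks are tight along \<open>h\<close>.\<close>
    define pat where "pat h = {I. I \<subseteq> {..<s'} \<and> nth h ` I \<in> K}" for h
    have finT: "finite T1" using T0w V finite_subset[of T1] by (auto simp: T1_def)
    have pat_tight: "tight K r (map (nth h) \<omega>) \<longleftrightarrow> tight (pat h) r \<omega>"
      if "distinct h" "length h = s'" "set \<omega> \<subseteq> {..<s'}" for h \<omega>
    proof -
      have *: "distinct (map (nth h) ys) \<and> set (map (nth h) ys) \<in> K \<longleftrightarrow> distinct ys \<and> set ys \<in> pat h"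
        if "sublist ys \<omega>" for ys
      proof -
        have "set ys \<subseteq> {..<s'}" using set_mono_sublist[OF that] \<open>set \<omega> \<subseteq> {..<s'}\<close> by blast
        moreover from this have "inj_on (nth h) (set ys)"
          using \<open>distinct h\<close> \<open>length h = s'\<close> by (intro inj_on_nth) auto
        ultimately show ?thesis by (auto simp: pat_def distinct_map)
      qed
      have "tight K r (map (nth h) \<omega>) \<longleftrightarrow>
          (\<forall>ys. sublist ys \<omega> \<and> length ys \<le> r \<longrightarrow> distinct (map (nth h) ys) \<and> set (map (nth h) ys) \<in> K)"
        unfolding tight_def sublist_map_conv by (metis length_map)
      then show ?thesis using * unfolding tight_def by metis
    qed
    have W: "W (pat h) (om (pat h))" if h: "h \<in> T1" for h
    proof -
      from h obtain x y g where xyg: "h = x @ y @ g" "x \<in> Fw" "y \<in> Bw" "g \<in> words V s"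
          "reach K r (set x \<union> set y \<union> set g) x y" "distinct h" by (auto simp: T1_def T0_def)
      have l: "length x = ?R" "length y = ?R" "length h = s'" using xyg by (auto simp: Fw_def Bw_def words_def s'_def)
      have "set x \<union> set y \<union> set g = set h" using xyg(1) by auto
      then obtain w where w: "tight K r (w @ y)" "set (w @ y) \<subseteq> set h" "take ?R (w @ y) = x"
        using reach_imp_tight[OF xyg(5) oc _ KD(2)] xyg(2) by auto
      \<comment> \<open>The walk inside \<open>set h\<close> is pulled back to places. This needs
        \<open>h\<close> to be distinct, hence the passage from \<open>T0\<close> to
        \<open>T1\<close>.\<close>
      define ix where "ix v = (THE i. i < s' \<and> h ! i = v)" for v
      have ix: "ix (h ! i) = i" if "i < s'" for i
        unfolding ix_def using that l(3) \<open>distinct h\<close> by (intro the_equality) (auto simp: nth_eq_iff_index_eq)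
      have ixs: "ix v < s' \<and> h ! ix v = v" if "v \<in> set h" for v
        using that ix l(3) by (auto simp: in_set_conv_nth)
      have ixx: "map ix x = [0..<?R]"
      proof (rule nth_equalityI)
        fix i assume "i < length (map ix x)"
        then have "h ! i = x ! i" "i < s'" using xyg(1) l by (auto simp: nth_append s'_def)
        then show "map ix x ! i = [0..<?R] ! i" using ix[of i] \<open>i < length (map ix x)\<close> l by simp
      qed (use l in simp)
      have ixy: "map ix y = [?R..<2 * ?R]"
      proof (rule nth_equalityI)
        fix i assume "i < length (map ix y)"
        then have "h ! (?R + i) = y ! i" "?R + i < s'" using xyg(1) l by (auto simp: nth_append s'_def)
        then show "map ix y ! i = [?R..<2 * ?R] ! i" using ix[of "?R + i"] \<open>i < length (map ix y)\<close> l by simp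
      qed (use l in simp)
      let ?\<omega> = "map ix (w @ y)"
      have mapw: "map (nth h) ?\<omega> = w @ y" unfolding map_map
        by (rule map_idI) (use ixs w(2) in auto)
      have "set ?\<omega> \<subseteq> {..<s'}" using ixs w(2) by auto
      moreover from this have "tight (pat h) r ?\<omega>"
        using pat_tight[OF \<open>distinct h\<close> l(3), of ?\<omega>] w(1) mapw by metis
      moreover have "take ?R ?\<omega> = [0..<?R]" using w(3) ixx by (metis take_map)
      moreover have "drop (Suc (length ?\<omega>) - r) ?\<omega> = [?R..<2 * ?R]"
      proof -
        have "Suc (length ?\<omega>) - r = length w" using l r by simp
        then show ?thesis using ixy by simp
      qed
      moreover have "r \<le> Suc (length ?\<omega>)" using l r by simp
      ultimately have "W (pat h) ?\<omega>" by (simp add: W_def)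
      then show ?thesis unfolding om_def by (rule someI)
    qed
    have "\<exists>\<omega>\<in>\<Omega>. c1 * card V ^ s' \<le> card {h \<in> T1. om (pat h) = \<omega>}"
    proof (rule ccontr)
      assume "\<not> ?thesis"
      then have lt: "card {h \<in> T1. om (pat h) = \<omega>} < c1 * card V ^ s'" if "\<omega> \<in> \<Omega>" for \<omega> using that by force
      have "pat h \<in> Pow (Pow {..<s'})" for h by (auto simp: pat_def)
      then have "om (pat h) \<in> \<Omega>" for h unfolding \<Omega>_def by (rule imageI)
      then have "T1 \<subseteq> (\<Union>\<omega>\<in>\<Omega>. {h \<in> T1. om (pat h) = \<omega>})" by blast
      then have "card T1 \<le> card (\<Union>\<omega>\<in>\<Omega>. {h \<in> T1. om (pat h) = \<omega>})"
        using finT \<Omega>(1) by (intro card_mono) auto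
      also have "\<dots> \<le> (\<Sum>\<omega>\<in>\<Omega>. card {h \<in> T1. om (pat h) = \<omega>})" by (rule card_UN_le[OF \<Omega>(1)])
      finally have "real (card T1) \<le> real (\<Sum>\<omega>\<in>\<Omega>. card {h \<in> T1. om (pat h) = \<omega>})" by (rule of_nat_mono)
      also have "\<dots> = (\<Sum>\<omega>\<in>\<Omega>. real (card {h \<in> T1. om (pat h) = \<omega>}))" by simp
      also have "\<dots> < (\<Sum>\<omega>\<in>\<Omega>. c1 * card V ^ s')" using lt \<Omega> by (intro sum_strict_mono) auto
      also have "\<dots> = c0 / 2 * card V ^ s'" using pos by (simp add: c1_def)
      finally show False using cT by (simp add: T1_def)
    qed
    then obtain \<omega> where \<omega>: "\<omega> \<in> \<Omega>" "c1 * card V ^ s' \<le> card {h \<in> T1. om (pat h) = \<omega>}" by blast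
    define T where "T = {h \<in> T1. om (pat h) = \<omega>}"
    have T: "T \<subseteq> words V s'" using T0w by (auto simp: T_def T1_def)
    have "T \<noteq> {}"
    proof
      assume "T = {}"
      then have "c1 * real (card V ^ s') \<le> 0" using \<omega>(2) by (simp flip: T_def)
      moreover have "0 < c1 * real (card V ^ s')" using pos(2) Vpos by (intro mult_pos_pos) auto
      ultimately show False by linarith
    qed
    then have W\<omega>: "set \<omega> \<subseteq> {..<s'}" "take ?R \<omega> = [0..<?R]"
      "drop (Suc (length \<omega>) - r) \<omega> = [?R..<2 * ?R]" "r \<le> Suc (length \<omega>)"
      using W by (auto simp: T_def W_def)
    have hT: "tight K r (map (nth h) \<omega>)" "tight K r (X @ take ?R h)" "tight K r (take ?R (drop ?R h) @ Y)" if "h \<in> T" for h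
    proof -
      have h: "h \<in> T1" "distinct h" "length h = s'" using that T by (auto simp: T_def T1_def words_def)
      then show "tight K r (map (nth h) \<omega>)"
        using pat_tight[OF h(2,3) W\<omega>(1)] W[OF h(1)] that by (simp add: T_def W_def)
      from h obtain x y g where "h = x @ y @ g" "x \<in> Fw" "y \<in> Bw" by (auto simp: T1_def T0_def)
      then show "tight K r (X @ take ?R h)" "tight K r (take ?R (drop ?R h) @ Y)"
        by (auto simp: Fw_def Bw_def words_def)
    qed
    have "c1 ^ (m ^ s') / 2 * card V ^ (s' * m) \<le> card {xs \<in> concat ` blowups V T s' m. distinct xs}"
      using \<omega>(2) pos big(2) by (intro card_concat_blowups[OF V Vpos T]) (auto simp: T_def N_def)
    also have "\<dots> \<le> card (words V N \<inter> connectors K r X Y)"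
    proof (intro of_nat_mono card_mono subsetI)
      fix xs assume "xs \<in> {xs \<in> concat ` blowups V T s' m. distinct xs}"
      then obtain F where F: "xs = concat F" "F \<in> blowups V T s' m" "distinct (concat F)" by auto
      then have F': "length F = s'" "\<And>f. f \<in> set F \<Longrightarrow> length f = m" "\<And>f. f \<in> set F \<Longrightarrow> set f \<subseteq> V" "listset (map set F) \<subseteq> T"
        by (auto simp: blowups_def words_def)
      have "map length F = replicate s' m" using F'(1,2) by (simp add: list_eq_iff_nth_eq)
      then have "length xs = N" by (simp add: F(1) length_concat sum_list_replicate N_def)
      moreover have "xs \<in> connectors K r X Y"
        unfolding F(1) using hT W\<omega> m[OF \<omega>(1)]
        by (intro connector_from_blowup[OF KD(2,3) r F'(1,2,4) F(3), of \<omega>]) (auto simp: s'_def)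
      ultimately show "xs \<in> words V N \<inter> connectors K r X Y" using F'(3) by (auto simp: words_def F(1))
    qed (use V in auto)
    finally show ?thesis by (simp add: c2_def N_def)
  qed
  have mono: "min c2 1 * real (card V) ^ N \<le> c2 * real (card V) ^ N" for V :: "'a set"
    by (intro mult_right_mono) auto
  show ?thesis
  proof (rule exI[of _ N], rule exI[of _ "min c2 1"], rule exI[of _ n0], intro conjI allI impI)
    fix V :: "'a set" and K X Y
    assume "dense_complex r \<gamma> V K" "n0 \<le> card V" "ordered_clique K r X" "ordered_clique K r Y"
    then show "min c2 1 * real (card V) ^ N \<le> card (words V N \<inter> connectors K r X Y)"
      by (rule order_trans[OF mono main])
  qed (use pos in auto)
qed

section \<open>Absorbing and joining\<close>

text \<open>The vertex goes into the middle, with r - 1 entries on either side, so both versions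
  have the same end cliques and are interchangeable inside a longer path.\<close>

definition absorbers :: "'a set set \<Rightarrow> nat \<Rightarrow> 'a \<Rightarrow> 'a list set" where
  "absorbers K r v = {a. length a = 2 * (r - 1) \<and> distinct a \<and> v \<notin> set a \<and> tight K r a \<and>
     tight K r (take (r - 1) a @ v # drop (r - 1) a)}"

text \<open>Letters are chosen one by one. In the second half, the last r - 1 entries of the list
  without \<open>v\<close> and of the list with \<open>v\<close> share all vertices but one: the
  former begins with an entry of the first half that the latter has already lost in favour of
  \<open>v\<close>. This is the situation of common extensions. Half of \<gamma> pays for
  distinctness.\<close>

lemma card_absorbers:
  fixes \<gamma> :: real
  assumes K: "dense_complex r \<gamma> V K" and r: "2 \<le> r" and v: "v \<in> V" and \<gamma>: "0 < \<gamma>"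
    and n: "2 * (2 * real r) \<le> \<gamma> * card V"
  shows "(\<gamma> / 2) ^ (2 * (r - 1)) * card V ^ (2 * (r - 1)) \<le> card (words V (2 * (r - 1)) \<inter> absorbers K r v)"
proof -
  note KD = dense_complexD[OF K]
  let ?ins = "\<lambda>a. take (r - 1) a @ v # drop (r - 1) a"
  define P where "P a \<longleftrightarrow> distinct a \<and> v \<notin> set a \<and> tight K r a \<and> tight K r (?ins a)" for a
  have "(\<gamma> / 2) ^ (2 * (r - 1)) * card V ^ (2 * (r - 1)) \<le> card {a \<in> words V (2 * (r - 1)). P a}"
  proof (rule card_words_greedy[OF KD(1)])
    show "P []" using KD(3) KD(5)[OF v] tight_clique[OF KD(2)] by (simp add: P_def)
    fix a assume a: "set a \<subseteq> V" "length a < 2 * (r - 1)" "P a"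
    have "\<exists>E. \<gamma> * card V \<le> card E \<and> E \<subseteq> V \<and> (\<forall>u\<in>E - insert v (set a). P (a @ [u]))"
    proof (cases "length a < r - 1")
      \<comment> \<open>In the first half \<open>v\<close> still stands at the end, so any extension
        of the clique formed by \<open>v\<close> and the letters so far will do. The
        common-extension property is applied with both vertices equal to \<open>v\<close>.\<close>
      case True
      have va: "tight K r (a @ [v])" using a(3) True by (simp add: P_def)
      then have cl: "insert v (set a) \<in> K" using tight_windowD(2)[OF va] True by simp
      have "card (set a) = length a" using a(3) by (simp add: P_def distinct_card)
      then have "\<gamma> * card V \<le> card (ext K (insert v (set a)) \<inter> ext K (insert v (set a)))"
        using KD(7)[OF _ _ cl cl] a(3) True by (simp add: P_def)
      moreover have "P (a @ [u])" if u: "u \<in> ext K (insert v (set a)) - insert v (set a)" for u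
      proof -
        have "insert u (insert v (set a)) \<in> K" using u by (auto simp: ext_def)
        then have "tight K r (a @ [u, v])"
          using a(3) u by (intro tight_clique[OF KD(2)]) (auto simp: P_def insert_commute)
        moreover from this have "tight K r (a @ [u])" using tight_append1[of K r "a @ [u]" "[v]"] by simp
        ultimately show ?thesis using a(3) u True by (auto simp: P_def)
      qed
      ultimately show ?thesis using KD(9) by (intro exI[of _ "ext K (insert v (set a))"]) auto
    next
      case False
      define b where "b = take (r - 1) a"
      define c where "c = drop (r - 1) a"
      let ?k = "length c"
      have abc: "a = b @ c" "length b = r - 1" "?k < r - 1" using a(2) False by (auto simp: b_def c_def)
      have da: "distinct (b @ c)" "v \<notin> set (b @ c)" and ta: "tight K r (b @ c)" and ti: "tight K r (b @ v # c)"
        using a(3) unfolding P_def b_def[symmetric] c_def[symmetric] by (simp_all add: abc(1))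
      define C where "C = set (drop (Suc ?k) b @ c)"
      have dr: "drop ?k b = b ! ?k # drop (Suc ?k) b" using abc by (intro Cons_nth_drop_Suc[symmetric]) simp
      have d1: "drop (Suc (length (b @ c)) - r) (b @ c) = b ! ?k # drop (Suc ?k) b @ c"
      proof -
        have "Suc (length (b @ c)) - r = ?k" using abc r by simp
        then show ?thesis using abc dr by simp
      qed
      have d2: "drop (Suc (length (b @ v # c)) - r) (b @ v # c) = drop (Suc ?k) b @ v # c"
      proof -
        have "Suc (length (b @ v # c)) - r = Suc ?k" using abc r by simp
        then show ?thesis using abc by simp
      qed
      have s: "set (b ! ?k # drop (Suc ?k) b @ c) = insert (b ! ?k) C" "set (drop (Suc ?k) b @ v # c) = insert v C"
        by (auto simp: C_def)
      have "set (drop (Suc ?k) b) \<subseteq> set b" by (rule set_drop_subset)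
      then have vC: "v \<notin> C" using da(2) by (auto simp: C_def)
      have "distinct (drop ?k (b @ c))" using da(1) by (rule distinct_drop)
      then have db: "distinct (b ! ?k # drop (Suc ?k) b @ c)" using abc dr by simp
      then have bC: "b ! ?k \<notin> C" and dC: "distinct (drop (Suc ?k) b @ c)" by (auto simp: C_def)
      have "card C = length (drop (Suc ?k) b @ c)" unfolding C_def using dC by (rule distinct_card)
      then have cC: "Suc (card C) < r" using abc by simp
      have "tight K r (b ! ?k # drop (Suc ?k) b @ c)" using tight_drop[OF ta] d1 by metis
      then have K1: "insert (b ! ?k) C \<in> K" using tight_windowD(2) s(1) abc by fastforce
      have "tight K r (drop (Suc ?k) b @ v # c)" using tight_drop[OF ti] d2 by metis
      then have K2: "insert v C \<in> K" using tight_windowD(2) s(2) abc by fastforce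
      let ?E = "ext K (insert (b ! ?k) C) \<inter> ext K (insert v C)"
      have "P (a @ [u])" if u: "u \<in> ?E - insert v (set a)" for u
      proof -
        have "tight K r ((b @ c) @ [u])" using u s r d1
          by (intro tight_snoc[OF KD(2) ta, of "insert (b ! ?k) C"]) auto
        moreover have "tight K r ((b @ v # c) @ [u])" using u s r d2
          by (intro tight_snoc[OF KD(2) ti, of "insert v C"]) auto
        ultimately show ?thesis using da u abc by (auto simp: P_def)
      qed
      then show ?thesis using KD(7)[OF bC vC K1 K2 cC] KD(9) by (intro exI[of _ ?E]) auto
    qed
    then obtain E where E: "\<gamma> * card V \<le> card E" "E \<subseteq> V" "\<forall>u\<in>E - insert v (set a). P (a @ [u])" by blast
    have "card (insert v (set a)) \<le> 2 * r" using a(2) card_length[of a] card_insert_le_m1[of "2 * r" "set a" v] by simp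
    moreover have "card E - card (insert v (set a)) \<le> card (E - insert v (set a))"
      by (rule diff_card_le_card_Diff) simp
    ultimately have "real (card E) \<le> card (E - insert v (set a)) + 2 * real r" by linarith
    moreover have "card (E - insert v (set a)) \<le> card {u \<in> V. P (a @ [u])}"
      using E KD(1) by (intro card_mono) auto
    ultimately show "\<gamma> / 2 * card V \<le> card {u \<in> V. P (a @ [u])}" using E(1) n by linarith
  qed (use \<gamma> in simp)
  also have "{a \<in> words V (2 * (r - 1)). P a} = words V (2 * (r - 1)) \<inter> absorbers K r v"
    by (auto simp: P_def absorbers_def words_def)
  finally show ?thesis .
qed

lemma tight_join:
  assumes "tight K r u" "tight K r q" "r \<le> Suc (length u)" "r \<le> Suc (length q)"
    and "tight K r (drop (Suc (length u) - r) u @ z @ take (r - 1) q)"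
  shows "tight K r (u @ z @ q)"
proof -
  let ?d = "Suc (length u) - r"
  have "tight K r (drop ?d u @ z @ q)"
    using tight_glue[of K r "drop ?d u @ z" "take (r - 1) q" "drop (r - 1) q"] assms by simp
  then have "tight K r (take ?d u @ drop ?d u @ (z @ q))"
    using assms(1,3) tight_glue[of K r "take ?d u" "drop ?d u" "z @ q"] by simp
  then show ?thesis by (metis append.assoc append_take_drop_id)
qed

lemma ordered_clique_ends:
  assumes "tight K r u" "r \<le> Suc (length u)" "0 < r"
  shows "ordered_clique K r (take (r - 1) u)" "ordered_clique K r (drop (Suc (length u) - r) u)"
proof -
  have l: "length (take (r - 1) u) = r - 1" "length (drop (Suc (length u) - r) u) = r - 1" using assms by auto
  show "ordered_clique K r (take (r - 1) u)"
    using tight_windowD[OF tight_take[OF assms(1)], of "r - 1"] l assms(3) by (simp add: ordered_clique_def)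
  show "ordered_clique K r (drop (Suc (length u) - r) u)"
    using tight_windowD[OF tight_drop[OF assms(1)], of "Suc (length u) - r"] l assms(3) by (simp add: ordered_clique_def)
qed

text \<open>The joined path is kept as a list of blocks, so that the absorbers can still be found in it.\<close>

lemma join_paths:
  assumes conn: "\<And>X Y U. ordered_clique K r X \<Longrightarrow> ordered_clique K r Y \<Longrightarrow> U \<subseteq> Z \<Longrightarrow> finite U \<Longrightarrow> card U \<le> t * N \<Longrightarrow>
      \<exists>z. distinct z \<and> set z \<subseteq> Z - U \<and> length z \<le> N \<and> tight K r (X @ z @ Y)"
    and r: "0 < r" and "ps \<noteq> []" "length ps \<le> t" "\<And>p. p \<in> set ps \<Longrightarrow> tight K r p \<and> r \<le> Suc (length p)"
      "distinct (concat ps)" "set (concat ps) \<inter> Z = {}"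
  shows "\<exists>bs. tight K r (concat bs) \<and> distinct (concat bs) \<and> set ps \<subseteq> set bs \<and> r \<le> Suc (length (concat bs)) \<and>
     set (concat bs) \<subseteq> set (concat ps) \<union> Z \<and> card (set (concat bs) \<inter> Z) \<le> (length ps - 1) * N"
  using assms(3-)
proof (induction ps rule: rev_nonempty_induct)
  case (single p)
  then show ?case by (intro exI[of _ "[p]"]) simp
next
  case (snoc q ps)
  from snoc.IH snoc.prems obtain bs where bs: "tight K r (concat bs)" "distinct (concat bs)" "set ps \<subseteq> set bs"
    "r \<le> Suc (length (concat bs))" "set (concat bs) \<subseteq> set (concat ps) \<union> Z"
    "card (set (concat bs) \<inter> Z) \<le> (length ps - 1) * N" by auto
  have q: "tight K r q" "r \<le> Suc (length q)" using snoc.prems by auto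
  have "(length ps - 1) * N \<le> t * N" using snoc.prems by (intro mult_le_mono1) simp
  then have "card (set (concat bs) \<inter> Z) \<le> t * N" using bs(6) by linarith
  then obtain z where z: "distinct z" "set z \<subseteq> Z - (set (concat bs) \<inter> Z)" "length z \<le> N"
      "tight K r (drop (Suc (length (concat bs)) - r) (concat bs) @ z @ take (r - 1) q)"
    using conn[OF ordered_clique_ends(2)[OF bs(1,4) r] ordered_clique_ends(1)[OF q r], of "set (concat bs) \<inter> Z"] by auto
  have qd: "set q \<inter> (set (concat bs) \<union> set z) = {}" 
  proof -
    have "set q \<inter> set (concat ps) = {}" "set q \<inter> Z = {}" using snoc.prems(3,4) by auto
    moreover have "set z \<subseteq> Z" using z(2) by blast
    ultimately show ?thesis using bs(5) by blast
  qed
  have "tight K r (concat (bs @ [z, q]))" using tight_join[OF bs(1) q(1) bs(4) q(2) z(4)] by simp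
  moreover have "distinct (concat (bs @ [z, q]))" using bs(2) z(1,2) qd snoc.prems by auto
  moreover have "card (set (concat (bs @ [z, q])) \<inter> Z) \<le> (length (ps @ [q]) - 1) * N"
  proof -
    have "set (concat (bs @ [z, q])) \<inter> Z \<subseteq> (set (concat bs) \<inter> Z) \<union> set z" using snoc.prems by auto
    then have "card (set (concat (bs @ [z, q])) \<inter> Z) \<le> card ((set (concat bs) \<inter> Z) \<union> set z)" by (intro card_mono) auto
    also have "\<dots> \<le> card (set (concat bs) \<inter> Z) + card (set z)" by (rule card_Un_le)
    also have "\<dots> \<le> (length ps - 1) * N + N" using bs(6) z(3) card_length[of z] by linarith
    also have "\<dots> = length ps * N" using snoc.hyps by (cases ps) auto
    finally show ?thesis by simp
  qed
  ultimately show ?case using bs q z(2)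
    by (intro exI[of _ "bs @ [z, q]"]) auto
qed

text \<open>Each vertex of \<open>W\<close> is inserted into an absorber of its own. After one
  insertion every remaining vertex has lost at most one absorber while there is one vertex less to
  absorb, so the counting hypothesis persists. The final \<open>Y\<close> repeats the beginning and
  so encodes that the path closes to a cycle.\<close>

lemma absorb_all:
  assumes "finite W" "tight K r (concat bs @ Y)" "take (r - 1) (concat bs) = Y" "distinct (concat bs)"
    "W \<inter> set (concat bs) = {}" "finite \<A>" "\<A> \<subseteq> set bs" "\<And>w. w \<in> W \<Longrightarrow> card W \<le> card (\<A> \<inter> absorbers K r w)" and r: "2 \<le> r"
  shows "\<exists>xs. tight K r (xs @ Y) \<and> take (r - 1) xs = Y \<and> distinct xs \<and> set xs = set (concat bs) \<union> W"
  using assms(1-8)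
proof (induction W arbitrary: bs \<A> rule: finite_induct)
  case empty
  then show ?case by (intro exI[of _ "concat bs"]) simp
next
  case (insert w W)
  have "0 < card (\<A> \<inter> absorbers K r w)" using insert.prems(7)[of w] insert.hyps by simp
  then obtain a where a: "a \<in> \<A>" "a \<in> absorbers K r w" by (metis Int_iff card_gt_0_iff ex_in_conv)
  then obtain b1 b2 where bs: "bs = b1 @ a # b2" using insert.prems(6) by (meson split_list subsetD)
  define a1 where "a1 = take (r - 1) a"
  define a2 where "a2 = drop (r - 1) a"
  have a12: "a = a1 @ a2" "length a1 = r - 1" "length a2 = r - 1" "tight K r (a1 @ w # a2)"
    using a(2) by (auto simp: a1_def a2_def absorbers_def)
  let ?bs = "b1 @ (a1 @ w # a2) # b2"
  have t: "tight K r (concat b1 @ a1 @ a2 @ concat b2 @ Y)" using insert.prems(1) bs a12(1) by simp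
  have "tight K r (concat b1 @ a1)" using tight_append1[of K r "concat b1 @ a1"] t by simp
  moreover have "tight K r (a2 @ concat b2 @ Y)" using tight_append2[of K r "concat b1 @ a1"] t by simp
  moreover have "tight K r ((a1 @ [w]) @ a2 @ concat b2 @ Y)"
    using tight_glue[of K r "a1 @ [w]" a2 "concat b2 @ Y"] a12 calculation by simp
  ultimately have "tight K r (concat b1 @ a1 @ ([w] @ a2 @ concat b2 @ Y))"
    using a12 tight_glue[of K r "concat b1" a1 "w # a2 @ concat b2 @ Y"] by simp
  then have t': "tight K r (concat ?bs @ Y)" by simp
  \<comment> \<open>The new vertex comes after the r - 1 entries of \<open>a1\<close>, so the
    beginning of the list does not change even if \<open>a\<close> is the first block.\<close>
  have Y': "take (r - 1) (concat ?bs) = Y"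
    using insert.prems(2) a12(1,2) unfolding bs by simp
  have d': "distinct (concat ?bs)" using insert.prems(3,4) a12(1) unfolding bs by auto
  have s': "set (concat ?bs) = Set.insert w (set (concat bs))" using a12(1) unfolding bs by auto
  have "\<exists>xs. tight K r (xs @ Y) \<and> take (r - 1) xs = Y \<and> distinct xs \<and> set xs = set (concat ?bs) \<union> W"
  proof (rule insert.IH[OF t' Y' d', of "\<A> - {a}"])
    show "W \<inter> set (concat ?bs) = {}" using insert.prems(4) insert.hyps(2) unfolding s' by auto
    show "\<A> - {a} \<subseteq> set ?bs" using insert.prems(6) unfolding bs by auto
    fix w' assume "w' \<in> W"
    then have "Suc (card W) \<le> card (\<A> \<inter> absorbers K r w')" using insert.prems(7)[of w'] insert.hyps by simp
    moreover have "card (\<A> \<inter> absorbers K r w') \<le> Suc (card (\<A> \<inter> absorbers K r w' - {a}))"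
      using insert.prems(5) by (metis card_Diff_singleton_if diff_le_self Suc_pred' card_gt_0_iff le_SucI le_refl finite_Int empty_iff)
    moreover have "\<A> \<inter> absorbers K r w' - {a} = (\<A> - {a}) \<inter> absorbers K r w'" by blast
    ultimately show "card W \<le> card ((\<A> - {a}) \<inter> absorbers K r w')" by simp
  qed (use insert.prems(5) in simp)
  then show ?case unfolding s' by auto
qed

section \<open>Almost perfect tilings\<close>

lemma pigeonhole_fiber:
  fixes x :: real
  assumes "finite A" "finite B" "B \<noteq> {}" "f ` A \<subseteq> B" "x * card B \<le> card A"
  shows "\<exists>b\<in>B. x \<le> card {a \<in> A. f a = b}"
proof (rule ccontr)
  assume "\<not> ?thesis"
  then have "(\<Sum>b\<in>B. real (card {a \<in> A. f a = b})) < (\<Sum>b\<in>B. x)"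
    using assms by (intro sum_strict_mono) auto
  moreover have "card A \<le> (\<Sum>b\<in>B. card {a \<in> A. f a = b})"
    using card_UN_le[OF assms(2), of "\<lambda>b. {a \<in> A. f a = b}"] card_mono[of "\<Union>b\<in>B. {a \<in> A. f a = b}" A] assms(1,2,4)
    by fastforce
  then have "real (card A) \<le> (\<Sum>b\<in>B. real (card {a \<in> A. f a = b}))" by (metis of_nat_le_iff of_nat_sum)
  ultimately show False using assms(5) by (simp add: mult.commute)
qed

text \<open>\<open>\<theta> j\<close> is the least level that at least a proportion j / r of the
  loads do not exceed. The bound on the sum says that a lower Riemann sum of the quantile function
  is at most its integral; it is checked level by level.\<close>

lemma quantiles:
  fixes l :: "nat \<Rightarrow> nat"
  assumes N: "0 < N"
  shows "\<exists>\<theta>. (\<exists>i<N. l i \<le> \<theta> 0) \<and> (\<forall>j<r. j * N \<le> r * card {i. i < N \<and> l i \<le> \<theta> j}) \<and>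
     N * (\<Sum>j<r. \<theta> j) \<le> r * (\<Sum>i<N. l i)"
proof -
  \<comment> \<open>For j = 0 the first conjunct makes \<open>\<theta> 0\<close> the minimum load;
    otherwise it would be 0.\<close>
  define C where "C j t \<longleftrightarrow> 0 < card {i. i < N \<and> l i \<le> t} \<and> j * N \<le> r * card {i. i < N \<and> l i \<le> t}" for j t
  define \<theta> where "\<theta> j = (LEAST t. C j t)" for j
  define L where "L = (\<Sum>i<N. l i)"
  have L: "l i \<le> L" if "i < N" for i using that member_le_sum[of i "{..<N}" l] by (simp add: L_def)
  have "{i. i < N \<and> l i \<le> L} = {..<N}" using L by auto
  then have CL: "C j L" if "j \<le> r" for j using N that by (simp add: C_def)
  have \<theta>: "C j (\<theta> j)" "\<theta> j \<le> L" if "j \<le> r" for j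
    unfolding \<theta>_def using CL[OF that] by (auto intro: LeastI Least_le)
  have layer: "N * card {j. j < r \<and> t < \<theta> j} \<le> r * card {i. i < N \<and> t < l i}" for t
  proof -
    let ?S = "{j. j < r \<and> t < \<theta> j}" and ?q = "card {i. i < N \<and> t < l i}" and ?c = "card {i. i < N \<and> l i \<le> t}"
    have "{..<N} = {i. i < N \<and> t < l i} \<union> {i. i < N \<and> l i \<le> t}" by auto
    moreover have "card ({i. i < N \<and> t < l i} \<union> {i. i < N \<and> l i \<le> t}) = ?q + ?c"
      by (intro card_Un_disjoint) auto
    ultimately have qc: "?q + ?c = N" by (metis card_lessThan)
    have notC: "\<not> C j t" if "j \<in> ?S" for j using that not_less_Least[of t "C j"] by (auto simp: \<theta>_def)
    show ?thesis
    proof (cases "?S = {} \<or> ?c = 0")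
      case True
      then show ?thesis
      proof
        assume c: "?c = 0"
        have "card ?S \<le> card {..<r}" by (intro card_mono) auto
        then show ?thesis using qc c by (simp add: mult.commute)
      next
        assume S: "?S = {}"
        show ?thesis unfolding S by simp
      qed
    next
      case False
      \<comment> \<open>Level \<open>t\<close> lies below \<open>\<theta> j\<close> for at most r -
        j0 values of j, while less than a proportion j0 / r of the loads are at most
        \<open>t\<close>.\<close>
      define j0 where "j0 = Min ?S"
      have j0: "j0 \<in> ?S" unfolding j0_def using False by (intro Min_in) auto
      then have "r * ?c < j0 * N" using notC[OF j0] False by (auto simp: C_def)
      moreover have "?S \<subseteq> {j0..<r}" by (auto simp: j0_def)
      then have "card ?S \<le> r - j0" using card_mono[of "{j0..<r}" ?S] by simp
      then have "N * card ?S \<le> N * (r - j0)" by simp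
      moreover have "N * (r - j0) + j0 * N = N * r" using j0 add_mult_distrib2[of N "r - j0" j0] by (simp add: mult.commute)
      moreover have "r * ?q + r * ?c = N * r" using qc by (simp flip: add_mult_distrib2)
      ultimately show ?thesis by linarith
    qed
  qed
  have count: "x = (\<Sum>t<L. if t < x then 1 else 0)" if "x \<le> L" for x
  proof -
    have "{..<L} \<inter> {t. t < x} = {..<x}" using that by auto
    then show ?thesis by (simp add: sum.If_cases)
  qed
  have "(\<Sum>j<r. \<theta> j) = (\<Sum>j<r. \<Sum>t<L. if t < \<theta> j then 1 else 0)"
    using count \<theta>(2) by (intro sum.cong) auto
  also have "\<dots> = (\<Sum>t<L. \<Sum>j<r. if t < \<theta> j then 1 else 0)" by (rule sum.swap)
  also have "\<dots> = (\<Sum>t<L. card {j. j < r \<and> t < \<theta> j})"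
    by (simp add: sum.If_cases Int_def)
  finally have 1: "(\<Sum>j<r. \<theta> j) = (\<Sum>t<L. card {j. j < r \<and> t < \<theta> j})" .
  have "(\<Sum>i<N. l i) = (\<Sum>i<N. \<Sum>t<L. if t < l i then 1 else 0)"
    using count L by (intro sum.cong) auto
  also have "\<dots> = (\<Sum>t<L. \<Sum>i<N. if t < l i then 1 else 0)" by (rule sum.swap)
  also have "\<dots> = (\<Sum>t<L. card {i. i < N \<and> t < l i})"
    by (simp add: sum.If_cases Int_def)
  finally have 2: "(\<Sum>i<N. l i) = (\<Sum>t<L. card {i. i < N \<and> t < l i})" .
  have "N * (\<Sum>j<r. \<theta> j) \<le> r * (\<Sum>i<N. l i)"
    unfolding 1 2 sum_distrib_left by (intro sum_mono layer)
  moreover have "{i. i < N \<and> l i \<le> \<theta> 0} \<noteq> {}" using \<theta>(1)[of 0] by (auto simp: C_def card_gt_0_iff)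
  then have "\<exists>i<N. l i \<le> \<theta> 0" by auto
  moreover have "\<forall>j<r. j * N \<le> r * card {i. i < N \<and> l i \<le> \<theta> j}" using \<theta>(1) by (auto simp: C_def)
  ultimately show ?thesis by (intro exI[of _ \<theta>]) blast
qed

text \<open>Only the bound on extensions of a single clique, counted inside \<open>V\<close>. The
  complex need not live on \<open>V\<close>, so the same \<open>K\<close> serves after a few
  vertices have been deleted.\<close>

definition ext_dense :: "nat \<Rightarrow> real \<Rightarrow> 'a set \<Rightarrow> 'a set set \<Rightarrow> bool" where
  "ext_dense r \<gamma> V K \<longleftrightarrow> finite V \<and> down K \<and> {} \<in> K \<and> (\<forall>v\<in>V. {v} \<in> K) \<and>
     (\<forall>A\<in>K. A \<subseteq> V \<and> 0 < card A \<and> card A < r \<longrightarrow> (1 - card A / r + \<gamma>) * real (card V) \<le> card (ext K A \<inter> V))"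

definition tile :: "'a set set \<Rightarrow> nat \<Rightarrow> nat \<Rightarrow> 'a list list \<Rightarrow> bool" where
  "tile K r m F \<longleftrightarrow> length F = r \<and> (\<forall>f\<in>set F. length f = m) \<and> (\<forall>h\<in>listset (map set F). set h \<in> K)"

text \<open>\<open>Ts\<close> lists tiles and a tile lists its parts; hence \<open>concat Ts\<close>
  lists parts and \<open>concat (concat Ts)\<close> lists vertices.\<close>

definition tiling :: "'a set \<Rightarrow> 'a set set \<Rightarrow> nat \<Rightarrow> nat \<Rightarrow> 'a list list list \<Rightarrow> bool" where
  "tiling V K r m Ts \<longleftrightarrow> (\<forall>F\<in>set Ts. tile K r m F) \<and> distinct (concat (concat Ts)) \<and> set (concat (concat Ts)) \<subseteq> V"

text \<open>\<open>U\<close> holds the vertices of the tiles extracted so far, and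
  \<open>l i\<close> is the load of part i in units of m. After j > 0 vertices a clique has at least
  (1 - j / r + \<gamma>) n extensions, while the parts with load at most \<open>\<theta> j\<close>
  hold about j n / r vertices; the overlap of about \<gamma> n loses little when \<open>U\<close>
  and the parts already visited are removed. Such a clique meets r parts whose total load is at most
  r times the average. By pigeonhole many of these cliques use the same r parts, and a blow-up among
  them is the tile.\<close>

lemma low_load_tile:
  fixes \<gamma> :: real
  assumes ED: "ext_dense r \<gamma> V K" and r: "2 \<le> r" and \<gamma>: "0 < \<gamma>" "\<gamma> \<le> 1" and m: "0 < m" and M: "0 < M"
    and Cs: "distinct (concat Cs)" "\<And>C. C \<in> set Cs \<Longrightarrow> length C = M" "set (concat Cs) \<subseteq> V"
      "card V \<le> length Cs * M + M"
    and U: "finite U" "\<And>i. i < length Cs \<Longrightarrow> card (U \<inter> set (Cs ! i)) = m * l i" "card U \<le> r * m * t"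
    and l: "(\<Sum>i<length Cs. l i) = r * t"
    and small: "r * m * t \<le> \<gamma> / 8 * card V" "8 * ((r + 2) * M) \<le> \<gamma> * card V"
    and big: "2 * real (r * m * (r * m)) \<le> ((\<gamma> / 4) ^ (r - 1) / 2 / r ^ r) ^ (m ^ r) * (r * M)"
  shows "\<exists>E c. tile K r m E \<and> distinct (concat E) \<and> set (concat E) \<inter> U = {} \<and>
     length c = r \<and> distinct c \<and> set c \<subseteq> {..<length Cs} \<and> (\<forall>j<r. set (E ! j) \<subseteq> set (Cs ! (c ! j))) \<and>
     length Cs * (\<Sum>j<r. l (c ! j)) \<le> r * (r * t)"
proof -
  define N where "N = length Cs"
  have V: "finite V" "down K" "{} \<in> K" "\<And>v. v \<in> V \<Longrightarrow> {v} \<in> K"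
    "\<And>A. A \<in> K \<Longrightarrow> A \<subseteq> V \<Longrightarrow> 0 < card A \<Longrightarrow> card A < r \<Longrightarrow> (1 - card A / r + \<gamma>) * card V \<le> card (ext K A \<inter> V)"
    using ED by (auto simp: ext_dense_def)
  let ?n = "real (card V)"
  have nNM: "?n \<le> real N * M + M" using Cs(4) unfolding N_def by (metis of_nat_add of_nat_le_iff of_nat_mult)
  have "\<gamma> * ?n \<le> ?n" using \<gamma> by (simp add: mult_left_le_one_le)
  then have "8 * (real (r + 2) * M) \<le> ?n" using small(2) by (simp add: algebra_simps)
  moreover have "4 * real M \<le> real (r + 2) * M" using r by (intro mult_right_mono) auto
  ultimately have n32: "32 * real M \<le> ?n" by linarith
  have NM2: "?n \<le> 2 * (real N * M)" using nNM n32 by linarith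
  have "0 < real N * M" using n32 nNM M by linarith
  then have N: "0 < N" by (simp add: zero_less_mult_iff)
  have Ci: "distinct (Cs ! i)" "length (Cs ! i) = M" "card (set (Cs ! i)) = M" "set (Cs ! i) \<subseteq> V" if "i < N" for i
  proof -
    have i: "Cs ! i \<in> set Cs" using that by (simp add: N_def)
    then show d: "distinct (Cs ! i)" using Cs(1) unfolding distinct_concat_iff by blast
    show "length (Cs ! i) = M" using Cs(2) i by blast
    then show "card (set (Cs ! i)) = M" using d by (simp add: distinct_card)
    show "set (Cs ! i) \<subseteq> V" using Cs(3) i by auto
  qed
  have Cdisj: "i = j" if "i < N" "j < N" "v \<in> set (Cs ! i)" "v \<in> set (Cs ! j)" for i j v
    using distinct_concat_nth[OF Cs(1)] that unfolding N_def by (metis in_set_conv_nth)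
  define cl where "cl v = (THE i. i < N \<and> v \<in> set (Cs ! i))" for v
  have cl: "cl v = i" if "i < N" "v \<in> set (Cs ! i)" for v i
    unfolding cl_def using that Cdisj by (intro the_equality) auto
  obtain \<theta> where \<theta>: "\<exists>i<N. l i \<le> \<theta> 0" "\<forall>j<r. j * N \<le> r * card {i. i < N \<and> l i \<le> \<theta> j}"
      "N * (\<Sum>j<r. \<theta> j) \<le> r * (\<Sum>i<N. l i)"
    using quantiles[OF N, of l r] by blast
  \<comment> \<open>For the first vertex the quantile argument guarantees no share of the parts (j =
    0), so it comes from one least loaded part; by averaging at most half of that part is
    used.\<close>
  obtain i0 where i0: "i0 < N" "\<And>i. i < N \<Longrightarrow> l i0 \<le> l i"
  proof -
    have "finite (l ` {..<N})" "l ` {..<N} \<noteq> {}" using N by auto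
    from Min_in[OF this] obtain i where "i < N" "l i = Min (l ` {..<N})" by auto
    then show thesis by (intro that[of i]) auto
  qed
  have "N * l i0 \<le> (\<Sum>i<N. l i)" using i0 sum_bounded_below[of "{..<N}" "l i0" l] by simp
  then have "N * l i0 \<le> r * t" using l by (simp add: N_def)
  then have "m * (N * l i0) \<le> m * (r * t)" by simp
  then have "real (m * (N * l i0)) \<le> real (r * m * t)" by (simp only: of_nat_le_iff mult_ac)
  also have "\<dots> \<le> 1 / 8 * ?n" using small(1) \<open>\<gamma> * ?n \<le> ?n\<close> by simp
  also have "\<dots> \<le> real N * (M / 2)" using NM2 by (simp add: field_simps)
  finally have "real N * real (m * l i0) \<le> real N * (M / 2)" by (simp add: mult_ac)
  then have half: "real (m * l i0) \<le> M / 2" using N by simp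
  define G where "G j = {v. v \<notin> U \<and> (\<exists>i<N. v \<in> set (Cs ! i) \<and> l i \<le> \<theta> j \<and> (j = 0 \<longrightarrow> i = i0))}" for j
  define P where "P h \<longleftrightarrow> set h \<in> K \<and> distinct h \<and> distinct (map cl h) \<and> (\<forall>j<length h. h ! j \<in> G j)" for h
  define d where "d j = (if j = 0 then M / 2 else \<gamma> / 4 * ?n)" for j :: nat
  have snoc: "P (h @ [v])" if "P h" "v \<in> ext K (set h)" "v \<in> G (length h)" "cl v \<notin> cl ` set h" for h v
    using that by (auto simp: P_def ext_def nth_append less_Suc_eq)
  have "(\<Prod>j<r. d j) \<le> card {h \<in> words V r. P h}"
  proof (rule card_words_greedy_prod[OF V(1)])
    show "P []" using V(3) by (simp add: P_def)
    fix h assume h: "set h \<subseteq> V" "length h < r" "P h"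
    show "d (length h) \<le> card {v \<in> V. P (h @ [v])}"
    proof (cases "h = []")
      case True
      have "set (Cs ! i0) - U \<subseteq> {v \<in> V. P (h @ [v])}"
      proof
        fix v assume v: "v \<in> set (Cs ! i0) - U"
        moreover have "l i0 \<le> \<theta> 0" using \<theta>(1) i0(2) le_trans by blast
        ultimately have "v \<in> G 0" using i0(1) by (auto simp: G_def)
        moreover have "v \<in> V" using v Ci(4)[OF i0(1)] by auto
        ultimately show "v \<in> {v \<in> V. P (h @ [v])}" using V(4)[of v] True by (simp add: P_def)
      qed
      then have "card (set (Cs ! i0) - U) \<le> card {v \<in> V. P (h @ [v])}" using V(1) by (intro card_mono) auto
      moreover have "card (set (Cs ! i0)) \<le> card (set (Cs ! i0) - U) + card (U \<inter> set (Cs ! i0))"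
        by (metis Int_commute card_Diff_subset_Int finite_Int finite_set U(1) le_diff_conv order_refl)
      ultimately have "M \<le> card {v \<in> V. P (h @ [v])} + m * l i0"
        using U(2)[of i0] Ci(3)[OF i0(1)] i0(1) by (simp add: N_def)
      then have "real M \<le> card {v \<in> V. P (h @ [v])} + real (m * l i0)" by (metis of_nat_add of_nat_le_iff)
      then show ?thesis using half True by (simp add: d_def)
    next
      case False
      let ?L = "length h"
      define Low where "Low = (\<Union>i\<in>{i. i < N \<and> l i \<le> \<theta> ?L}. set (Cs ! i))"
      define Bad where "Bad = U \<union> (\<Union>v\<in>set h. set (Cs ! cl v))"
      have hK: "set h \<in> K" "card (set h) = ?L" using h(3) by (auto simp: P_def distinct_card)
      have e: "(1 - ?L / r + \<gamma>) * ?n \<le> card (ext K (set h) \<inter> V)"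
        using V(5)[OF hK(1) h(1)] hK(2) h(2) False by simp
      have "card Low = (\<Sum>i\<in>{i. i < N \<and> l i \<le> \<theta> ?L}. card (set (Cs ! i)))"
        unfolding Low_def
      proof (rule card_UN_disjoint)
        show "\<forall>i\<in>{i. i < N \<and> l i \<le> \<theta> ?L}. \<forall>j\<in>{i. i < N \<and> l i \<le> \<theta> ?L}. i \<noteq> j \<longrightarrow> set (Cs ! i) \<inter> set (Cs ! j) = {}"
          using Cdisj by blast
      qed auto
      also have "\<dots> = M * card {i. i < N \<and> l i \<le> \<theta> ?L}" using Ci(3) by simp
      finally have cLow: "card Low = M * card {i. i < N \<and> l i \<le> \<theta> ?L}" .
      have "real (?L * N) \<le> real (r * card {i. i < N \<and> l i \<le> \<theta> ?L})" using \<theta>(2) h(2) by (intro of_nat_mono) simp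
      then have "real ?L / r * N \<le> card {i. i < N \<and> l i \<le> \<theta> ?L}" using r by (simp add: field_simps)
      then have "real M * (real ?L / r * N) \<le> card Low" unfolding cLow of_nat_mult by (intro mult_left_mono) auto
      moreover have "real ?L / r * (?n - M) \<le> real ?L / r * (real N * M)" using nNM by (intro mult_left_mono) auto
      moreover have "real ?L / r * M \<le> 1 * real M" using h(2) by (intro mult_right_mono) auto
      moreover have "real M * (real ?L / r * N) = real ?L / r * (real N * M)" by (simp add: mult_ac)
      ultimately have low: "real ?L / r * ?n - M \<le> card Low" unfolding right_diff_distrib by linarith
      have LowV: "Low \<subseteq> V" using Ci(4) by (auto simp: Low_def)
      have clh: "cl v < N" if v: "v \<in> set h" for v
      proof -
        obtain j where "j < length h" "v = h ! j" using v by (metis in_set_conv_nth)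
        then have "v \<in> G j" using h(3) by (simp add: P_def)
        then obtain i where "i < N" "v \<in> set (Cs ! i)" unfolding G_def by blast
        then show ?thesis using cl by simp
      qed
      have "card (\<Union>v\<in>set h. set (Cs ! cl v)) \<le> (\<Sum>v\<in>set h. card (set (Cs ! cl v)))" by (rule card_UN_le) simp
      also have "\<dots> = ?L * M" using Ci(3) clh hK(2) by simp
      also have "\<dots> \<le> r * M" using h(2) by simp
      finally have "card Bad \<le> r * m * t + r * M"
        unfolding Bad_def using U(3) card_Un_le[of U "\<Union>v\<in>set h. set (Cs ! cl v)"] by linarith
      then have "real (card Bad) \<le> real (r * m * t + r * M)" by (rule of_nat_mono)
      then have bad: "real (card Bad) \<le> \<gamma> / 8 * ?n + real (r * M)"
        using small(1) unfolding of_nat_add of_nat_mult by linarith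
      have "card (ext K (set h) \<inter> V) + card Low = card ((ext K (set h) \<inter> V) \<union> Low) + card ((ext K (set h) \<inter> V) \<inter> Low)"
        using V(1) LowV finite_subset by (intro card_Un_Int) auto
      moreover have "card ((ext K (set h) \<inter> V) \<union> Low) \<le> card V" using V(1) LowV by (intro card_mono) auto
      moreover have "card ((ext K (set h) \<inter> V) \<inter> Low) - card Bad \<le> card ((ext K (set h) \<inter> V) \<inter> Low - Bad)"
        using U(1) by (intro diff_card_le_card_Diff) (simp add: Bad_def)
      moreover have "card ((ext K (set h) \<inter> V) \<inter> Low - Bad) \<le> card {v \<in> V. P (h @ [v])}"
      proof (intro card_mono subsetI)
        fix v assume v: "v \<in> (ext K (set h) \<inter> V) \<inter> Low - Bad"
        then obtain i where i: "i < N" "l i \<le> \<theta> ?L" "v \<in> set (Cs ! i)" by (auto simp: Low_def)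
        then have "v \<in> G ?L" using v False by (auto simp: G_def Bad_def)
        moreover have "cl v \<notin> cl ` set h"
        proof
          assume "cl v \<in> cl ` set h"
          then obtain w where "w \<in> set h" "cl w = i" using cl[OF i(1,3)] by auto
          then show False using v i(3) by (auto simp: Bad_def)
        qed
        ultimately show "v \<in> {v \<in> V. P (h @ [v])}" using snoc[OF h(3)] v by auto
      qed (use V(1) in simp)
      ultimately have "card (ext K (set h) \<inter> V) + card Low \<le> card V + card Bad + card {v \<in> V. P (h @ [v])}" by linarith
      then have "real (card (ext K (set h) \<inter> V) + card Low) \<le> real (card V + card Bad + card {v \<in> V. P (h @ [v])})"
        by (rule of_nat_mono)
      then have "real (card (ext K (set h) \<inter> V)) + card Low \<le> ?n + card Bad + card {v \<in> V. P (h @ [v])}"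
        by (simp only: of_nat_add)
      then have "(1 - ?L / r + \<gamma>) * ?n + (real ?L / r * ?n - M) \<le> ?n + (\<gamma> / 8 * ?n + real (r * M)) + card {v \<in> V. P (h @ [v])}"
        using e low bad by linarith
      then have "\<gamma> * ?n - M - \<gamma> / 8 * ?n - real (r * M) \<le> card {v \<in> V. P (h @ [v])}" by (simp add: algebra_simps)
      moreover have "8 * (real (r * M) + M) \<le> \<gamma> * ?n" using small(2) by (simp add: algebra_simps)
      ultimately show ?thesis using False \<gamma> by (simp add: d_def)
    qed
  qed (simp add: d_def \<gamma>(1) less_imp_le)
  moreover have "(\<Prod>j<r. d j) = M / 2 * (\<gamma> / 4 * ?n) ^ (r - 1)"
    using r prod.lessThan_Suc_shift[of d "r - 1"] by (simp add: d_def)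
  ultimately have cnt: "M / 2 * (\<gamma> / 4 * ?n) ^ (r - 1) \<le> card {h \<in> words V r. P h}" by simp
  let ?A = "{h \<in> words V r. P h}"
  let ?f = "\<lambda>h. map cl (tl h)"
  have Gcl: "cl v < N \<and> v \<in> set (Cs ! cl v) \<and> v \<notin> U \<and> l (cl v) \<le> \<theta> j \<and> (j = 0 \<longrightarrow> cl v = i0)" if "v \<in> G j" for v j
    using that cl by (auto simp: G_def)
  \<comment> \<open>Fixing the other r - 1 parts costs a factor N^(r - 1), about (n / M)^(r - 1). So
    the density of the cliques inside the r chosen parts is bounded below independently of
    M.\<close>
  have "\<exists>cs\<in>words {..<N} (r - 1). M / 2 * (\<gamma> / 4 * M) ^ (r - 1) \<le> card {h \<in> ?A. ?f h = cs}"
  proof (rule pigeonhole_fiber)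
    show "?f ` ?A \<subseteq> words {..<N} (r - 1)"
    proof clarify
      fix h assume h: "h \<in> words V r" "P h"
      have "cl v < N" if v: "v \<in> set (tl h)" for v
      proof -
        have "v \<in> set h" using v by (metis list.set_sel(2) tl_Nil)
        then obtain j where "j < length h" "v = h ! j" by (metis in_set_conv_nth)
        then show ?thesis using h(2) Gcl by (auto simp: P_def)
      qed
      then show "map cl (tl h) \<in> words {..<N} (r - 1)" using h(1) by (auto simp: words_def)
    qed
    have "real N * M \<le> ?n"
    proof -
      have "card (set (concat Cs)) = length (concat Cs)" by (rule distinct_card[OF Cs(1)])
      also have "map length Cs = replicate N M" using Ci(2) by (simp add: N_def list_eq_iff_nth_eq)
      then have "length (concat Cs) = N * M" by (simp add: length_concat sum_list_replicate)
      finally have "N * M \<le> card V" using card_mono[OF V(1) Cs(3)] by simp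
      then show ?thesis by (metis of_nat_le_iff of_nat_mult)
    qed
    then have "(\<gamma> / 4 * (real N * M)) ^ (r - 1) \<le> (\<gamma> / 4 * ?n) ^ (r - 1)"
      using \<gamma> by (intro power_mono mult_left_mono) auto
    then have "M / 2 * (\<gamma> / 4 * (real N * M)) ^ (r - 1) \<le> M / 2 * (\<gamma> / 4 * ?n) ^ (r - 1)" by (intro mult_left_mono) auto
    then show "M / 2 * (\<gamma> / 4 * M) ^ (r - 1) * card (words {..<N} (r - 1)) \<le> card ?A"
    proof -
      have "(\<gamma> / 4 * (real N * M)) ^ (r - 1) = (\<gamma> / 4 * M) ^ (r - 1) * N ^ (r - 1)"
      proof -
        have e: "\<gamma> / 4 * (real N * M) = \<gamma> / 4 * M * N" by simp
        show ?thesis unfolding e by (simp only: power_mult_distrib of_nat_power)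
      qed
      moreover have "card (words {..<N} (r - 1)) = N ^ (r - 1)" by simp
      ultimately show ?thesis using cnt \<open>M / 2 * (\<gamma> / 4 * (real N * M)) ^ (r - 1) \<le> _\<close> by (simp add: mult_ac)
    qed
    show "words {..<N} (r - 1) \<noteq> {}" using N card_gt_0_iff[of "words {..<N} (r - 1)"] by simp
  qed (use V(1) in auto)
  then obtain cs where cs: "cs \<in> words {..<N} (r - 1)" "M / 2 * (\<gamma> / 4 * M) ^ (r - 1) \<le> card {h \<in> ?A. ?f h = cs}" by blast
  define T where "T = {h \<in> ?A. ?f h = cs}"
  define c where "c = i0 # cs"
  have c: "length c = r" "set c \<subseteq> {..<N}" using cs(1) r i0(1) by (auto simp: c_def words_def)
  have hT: "set h \<in> K" "map cl h = c" "distinct c" "length h = r"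
     "\<And>j. j < r \<Longrightarrow> h ! j \<in> set (Cs ! (c ! j)) \<and> h ! j \<notin> U \<and> l (c ! j) \<le> \<theta> j" if "h \<in> T" for h
  proof -
    have h: "P h" "length h = r" "map cl (tl h) = cs" using that by (auto simp: T_def words_def)
    then show "set h \<in> K" "length h = r" by (auto simp: P_def)
    have "h \<noteq> []" using h(2) r by auto
    then have "cl (hd h) = i0" using h(1) Gcl[of "hd h" 0] by (simp add: P_def hd_conv_nth)
    then show hc: "map cl h = c" using h(3) \<open>h \<noteq> []\<close> by (cases h) (auto simp: c_def)
    then show "distinct c" using h(1) by (auto simp: P_def)
    show "h ! j \<in> set (Cs ! (c ! j)) \<and> h ! j \<notin> U \<and> l (c ! j) \<le> \<theta> j" if "j < r" for j
    proof -
      have "c ! j = cl (h ! j)" using hc that h(2) by (metis nth_map)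
      then show ?thesis using Gcl[of "h ! j" j] h that by (auto simp: P_def)
    qed
  qed
  have Mpos: "0 < M / 2 * (\<gamma> / 4 * M) ^ (r - 1)" using M \<gamma> by simp
  then have "T \<noteq> {}" using cs(2) unfolding T_def by (metis card.empty of_nat_0 not_le)
  then have dc: "distinct c" using hT(3) by blast
  define V' where "V' = (\<Union>j<r. set (Cs ! (c ! j)))"
  have "card V' = (\<Sum>j<r. card (set (Cs ! (c ! j))))"
    unfolding V'_def
  proof (rule card_UN_disjoint)
    show "\<forall>i\<in>{..<r}. \<forall>j\<in>{..<r}. i \<noteq> j \<longrightarrow> set (Cs ! (c ! i)) \<inter> set (Cs ! (c ! j)) = {}"
    proof (intro ballI impI)
      fix i j assume ij: "i \<in> {..<r}" "j \<in> {..<r}" "i \<noteq> j"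
      then have "c ! i \<noteq> c ! j" "c ! i < N" "c ! j < N"
        using dc c(1) subsetD[OF c(2) nth_mem[of i c]] subsetD[OF c(2) nth_mem[of j c]] by (auto simp: nth_eq_iff_index_eq)
      then show "set (Cs ! (c ! i)) \<inter> set (Cs ! (c ! j)) = {}" using Cdisj by blast
    qed
  qed auto
  also have "\<dots> = r * M" using Ci(3) c nth_mem by (simp add: subset_iff)
  finally have V': "card V' = r * M" .
  have V'fin: "finite V'" by (simp add: V'_def)
  have TV': "T \<subseteq> words V' r"
  proof
    fix h assume h: "h \<in> T"
    have "set h \<subseteq> V'"
    proof
      fix v assume "v \<in> set h"
      then obtain j where "j < r" "v = h ! j" using hT(4)[OF h] by (metis in_set_conv_nth)
      then show "v \<in> V'" using hT(5)[OF h] by (auto simp: V'_def)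
    qed
    then show "h \<in> words V' r" using hT(4)[OF h] by (simp add: words_def)
  qed
  define \<kappa> where "\<kappa> = (\<gamma> / 4) ^ (r - 1) / 2 / real r ^ r"
  have \<kappa>: "0 < \<kappa>" using \<gamma> r by (simp add: \<kappa>_def)
  have "\<kappa> * card V' ^ r = (\<gamma> / 4) ^ (r - 1) / 2 * real M ^ r"
    using r by (simp add: \<kappa>_def V' power_mult_distrib)
  also have "\<dots> = M / 2 * (\<gamma> / 4 * M) ^ (r - 1)" using r power_Suc[of "real M" "r - 1"]
    unfolding power_mult_distrib by simp
  finally have "\<kappa> * card V' ^ r \<le> card T" using cs(2) by (simp add: T_def)
  then have "\<kappa> ^ (m ^ r) / 2 * card V' ^ (r * m) \<le> card {xs \<in> concat ` blowups V' T r m. distinct xs}"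
    using big V' M m r \<kappa> by (intro card_concat_blowups[OF V'fin _ TV']) (auto simp: \<kappa>_def)
  moreover have "0 < \<kappa> ^ (m ^ r) / 2 * real (card V' ^ (r * m))" using \<kappa> V' M r by simp
  ultimately have "{xs \<in> concat ` blowups V' T r m. distinct xs} \<noteq> {}" by (metis card.empty of_nat_0 not_le)
  then obtain E where E: "E \<in> blowups V' T r m" "distinct (concat E)" by auto
  then have E': "length E = r" "\<And>f. f \<in> set E \<Longrightarrow> length f = m" "listset (map set E) \<subseteq> T"
    by (auto simp: blowups_def words_def)
  have Ej: "v \<in> set (Cs ! (c ! j)) \<and> v \<notin> U" if j: "j < r" "v \<in> set (E ! j)" for j v
  proof -
    \<comment> \<open>Every entry of a part occurs in a transversal, so what is known about
      \<open>T\<close> holds for every vertex of the tile.\<close>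
    have "(map hd E)[j := v] \<in> listset (map set E)"
      unfolding listset_map_set_iff
    proof (intro conjI allI impI)
      fix i assume "i < length E"
      then have "E ! i \<noteq> []" using E'(2)[of "E ! i"] m by auto
      then show "(map hd E)[j := v] ! i \<in> set (E ! i)" using \<open>i < length E\<close> j by (cases "i = j") auto
    qed simp
    then have "(map hd E)[j := v] \<in> T" using E'(3) by blast
    from hT(5)[OF this j(1)] show ?thesis using j(1) E'(1) by simp
  qed
  have "set (concat E) \<inter> U = {}"
  proof -
    have "v \<notin> U" if v: "v \<in> set (concat E)" for v
    proof -
      obtain f where "f \<in> set E" "v \<in> set f" using v by auto
      then obtain j where "j < r" "v \<in> set (E ! j)" using E'(1) by (metis in_set_conv_nth)
      then show ?thesis using Ej by blast
    qed
    then show ?thesis by blast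
  qed
  moreover have "tile K r m E" unfolding tile_def using E' hT(1) by blast
  moreover have "N * (\<Sum>j<r. l (c ! j)) \<le> r * (r * t)"
  proof -
    obtain h where "h \<in> T" using \<open>T \<noteq> {}\<close> by blast
    then have "(\<Sum>j<r. l (c ! j)) \<le> (\<Sum>j<r. \<theta> j)" using hT(5) by (intro sum_mono) auto
    then have "N * (\<Sum>j<r. l (c ! j)) \<le> N * (\<Sum>j<r. \<theta> j)" by simp
    also have "\<dots> \<le> r * (\<Sum>i<N. l i)" by (rule \<theta>(3))
    also have "\<dots> = r * (r * t)" using l by (simp add: N_def)
    finally show ?thesis .
  qed
  ultimately show ?thesis using E(2) c dc Ej unfolding N_def by (intro exI[of _ E] exI[of _ c]) blast
qed

section \<open>Many new tiles with small load variance\<close>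

lemma tile_length: "tile K r m F \<Longrightarrow> length (concat F) = r * m"
proof -
  assume "tile K r m F"
  then have "map length F = replicate r m" by (auto simp: tile_def list_eq_iff_nth_eq)
  then show ?thesis by (simp add: length_concat sum_list_replicate)
qed

lemma tiling_length: "\<forall>F\<in>set Ts. tile K r m F \<Longrightarrow> length (concat (concat Ts)) = length Ts * (r * m)"
  by (induction Ts) (auto simp: tile_length)

lemma listset_map_set_mono:
  assumes "h \<in> listset (map set (map g F))" "\<And>f. set (g f) \<subseteq> set f"
  shows "h \<in> listset (map set F)"
  using assms(1) subsetD[OF assms(2)] unfolding listset_map_set_iff by simp

text \<open>A tile raises the sum of squared loads by twice the loads of its r parts plus r. As
  these r loads together are at most r times the average, the second moment grows no faster than for
  uniformly spread tiles, and the variance of the loads stays at most their mean.\<close>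

lemma extract_tiles:
  fixes \<gamma> :: real
  assumes ED: "ext_dense r \<gamma> V K" and r: "2 \<le> r" and \<gamma>: "0 < \<gamma>" "\<gamma> \<le> 1" and m: "0 < m" and M: "0 < M"
    and Cs: "distinct (concat Cs)" "\<And>C. C \<in> set Cs \<Longrightarrow> length C = M" "set (concat Cs) \<subseteq> V"
      "card V \<le> length Cs * M + M"
    and small: "r * m * t \<le> \<gamma> / 8 * card V" "8 * ((r + 2) * M) \<le> \<gamma> * card V"
    and big: "2 * real (r * m * (r * m)) \<le> ((\<gamma> / 4) ^ (r - 1) / 2 / r ^ r) ^ (m ^ r) * (r * M)"
  shows "\<exists>Es l. tiling V K r m Es \<and> length Es = t \<and>
     (\<forall>i<length Cs. card (set (concat (concat Es)) \<inter> set (Cs ! i)) = m * l i) \<and>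
     (\<Sum>i<length Cs. l i) = r * t \<and> length Cs * (\<Sum>i<length Cs. (l i)\<^sup>2) \<le> (r * t)\<^sup>2 + length Cs * (r * t)"
  using small(1)
proof (induction t)
  case 0
  show ?case by (intro exI[of _ "[]"] exI[of _ "\<lambda>_. 0"]) (simp add: tiling_def)
next
  case (Suc t)
  let ?N = "length Cs"
  have "real r * real m * real t \<le> real r * real m * real (Suc t)" by (intro mult_left_mono) auto
  then have sm: "real r * real m * real t \<le> \<gamma> / 8 * card V" using Suc.prems by linarith
  from Suc.IH[OF this] obtain Es l where Es: "tiling V K r m Es" "length Es = t"
     "\<And>i. i < ?N \<Longrightarrow> card (set (concat (concat Es)) \<inter> set (Cs ! i)) = m * l i"
     "(\<Sum>i<?N. l i) = r * t" "?N * (\<Sum>i<?N. (l i)\<^sup>2) \<le> (r * t)\<^sup>2 + ?N * (r * t)" by auto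
  let ?U = "set (concat (concat Es))"
  have "length (concat (concat Es)) = t * (r * m)"
    using Es(1,2) tiling_length[of Es K r m] by (simp add: tiling_def)
  then have "card ?U \<le> r * m * t" using card_length[of "concat (concat Es)"] by (simp add: mult_ac)
  from low_load_tile[OF ED r \<gamma> m M Cs _ Es(3) this Es(4) sm small(2) big]
  obtain E c where E: "tile K r m E" "distinct (concat E)" "set (concat E) \<inter> ?U = {}" and
     c: "length c = r" "distinct c" "set c \<subseteq> {..<?N}" and
     Ec: "\<And>j. j < r \<Longrightarrow> set (E ! j) \<subseteq> set (Cs ! (c ! j))" and load: "?N * (\<Sum>j<r. l (c ! j)) \<le> r * (r * t)" by auto
  have lenE: "length E = r" "\<And>f. f \<in> set E \<Longrightarrow> length f = m" using E(1) by (auto simp: tile_def)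
  define l' where "l' i = l i + (if i \<in> set c then 1 else 0)" for i
  have cN: "c ! j < ?N" if "j < r" for j using c(1) subsetD[OF c(3) nth_mem[of j c]] that by auto
  have Cdisj: "i = j" if "i < ?N" "j < ?N" "v \<in> set (Cs ! i)" "v \<in> set (Cs ! j)" for i j v
    using distinct_concat_nth[OF Cs(1)] that by (metis in_set_conv_nth)
  have part: "card (set (concat E) \<inter> set (Cs ! i)) = (if i \<in> set c then m else 0)" if i: "i < ?N" for i
  proof -
    have in_part: "\<exists>j<r. v \<in> set (E ! j) \<and> c ! j = i" if v: "v \<in> set (concat E)" "v \<in> set (Cs ! i)" for v
    proof -
      obtain f where "f \<in> set E" "v \<in> set f" using v(1) by auto
      then obtain j where j: "j < r" "v \<in> set (E ! j)" using lenE(1) by (metis in_set_conv_nth)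
      then have "c ! j = i" using Cdisj[OF cN[OF j(1)] i] Ec[OF j(1)] v(2) by blast
      then show ?thesis using j by blast
    qed
    show ?thesis
    proof (cases "i \<in> set c")
      case True
      then obtain j where j: "j < r" "c ! j = i" using c(1) by (metis in_set_conv_nth)
      have Ej: "E ! j \<in> set E" using j(1) lenE(1) by simp
      have "set (concat E) \<inter> set (Cs ! i) = set (E ! j)"
      proof (intro equalityI subsetI)
        fix v assume "v \<in> set (concat E) \<inter> set (Cs ! i)"
        then obtain j' where j': "j' < r" "v \<in> set (E ! j')" "c ! j' = i" using in_part by blast
        then have "j' = j" using j c(1,2) by (metis nth_eq_iff_index_eq)
        then show "v \<in> set (E ! j)" using j' by simp
      next
        fix v assume "v \<in> set (E ! j)"
        then show "v \<in> set (concat E) \<inter> set (Cs ! i)" using Ec[OF j(1)] j(2) Ej by auto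
      qed
      moreover have "distinct (E ! j)" using E(2) Ej unfolding distinct_concat_iff by blast
      ultimately show ?thesis using True lenE(2)[OF Ej] by (simp add: distinct_card)
    next
      case False
      then have "set (concat E) \<inter> set (Cs ! i) = {}" using in_part c(1) nth_mem by fastforce
      then show ?thesis using False by simp
    qed
  qed
  have sum_c: "(\<Sum>i<?N. if i \<in> set c then x i else 0) = (\<Sum>j<r. x (c ! j))" for x :: "nat \<Rightarrow> nat"
  proof -
    have "(\<Sum>i<?N. if i \<in> set c then x i else 0) = (\<Sum>i\<in>set c. x i)"
      using c(3) by (simp add: sum.If_cases Int_absorb1)
    also have "\<dots> = sum_list (map x c)" using c(2) by (simp add: sum_list_distinct_conv_sum_set)
    also have "\<dots> = (\<Sum>j<r. x (c ! j))" using c(1) by (simp add: sum_list_sum_nth atLeast0LessThan)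
    finally show ?thesis .
  qed
  show ?case
  proof (intro exI[of _ "E # Es"] exI[of _ l'] conjI allI impI)
    show "tiling V K r m (E # Es)"
    proof -
      have "v \<in> V" if v: "v \<in> set (concat E)" for v
      proof -
        obtain f where "f \<in> set E" "v \<in> set f" using v by auto
        then obtain j where j: "j < r" "v \<in> set (E ! j)" using lenE(1) by (metis in_set_conv_nth)
        then have "v \<in> set (concat Cs)" using Ec[OF j(1)] cN[OF j(1)] nth_mem by fastforce
        then show ?thesis using Cs(3) by blast
      qed
      then show ?thesis using Es(1) E by (auto simp: tiling_def)
    qed
    show "length (E # Es) = Suc t" using Es(2) by simp
    show "card (set (concat (concat (E # Es))) \<inter> set (Cs ! i)) = m * l' i" if i: "i < ?N" for i
    proof -
      have "set (concat (concat (E # Es))) \<inter> set (Cs ! i) = (set (concat E) \<inter> set (Cs ! i)) \<union> (?U \<inter> set (Cs ! i))" by auto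
      moreover have "card ((set (concat E) \<inter> set (Cs ! i)) \<union> (?U \<inter> set (Cs ! i)))
          = card (set (concat E) \<inter> set (Cs ! i)) + card (?U \<inter> set (Cs ! i))"
        using E(3) by (intro card_Un_disjoint) blast+
      ultimately show ?thesis using part[OF i] Es(3)[OF i] by (simp add: l'_def)
    qed
    show "(\<Sum>i<?N. l' i) = r * Suc t"
      using Es(4) sum_c[of "\<lambda>_. 1"] by (simp add: l'_def sum.distrib)
    have "(l' i)\<^sup>2 = (l i)\<^sup>2 + (if i \<in> set c then 2 * l i + 1 else 0)" for i
      by (simp add: l'_def power2_eq_square)
    then have "(\<Sum>i<?N. (l' i)\<^sup>2) = (\<Sum>i<?N. (l i)\<^sup>2) + (\<Sum>j<r. 2 * l (c ! j) + 1)"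
      by (simp add: sum.distrib sum_c[of "\<lambda>i. 2 * l i + 1", simplified])
    also have "(\<Sum>j<r. 2 * l (c ! j) + 1) = 2 * (\<Sum>j<r. l (c ! j)) + r"
      by (simp add: sum_Suc sum_distrib_left)
    finally have "?N * (\<Sum>i<?N. (l' i)\<^sup>2) = ?N * (\<Sum>i<?N. (l i)\<^sup>2) + 2 * (?N * (\<Sum>j<r. l (c ! j))) + ?N * r"
      by (simp add: algebra_simps)
    also have "\<dots> \<le> ((r * t)\<^sup>2 + ?N * (r * t)) + 2 * (r * (r * t)) + ?N * r"
      using Es(5) load by linarith
    also have "\<dots> \<le> (r * Suc t)\<^sup>2 + ?N * (r * Suc t)"
      by (simp add: power2_eq_square algebra_simps)
    finally show "?N * (\<Sum>i<?N. (l' i)\<^sup>2) \<le> (r * Suc t)\<^sup>2 + ?N * (r * Suc t)" .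
  qed
qed

section \<open>Recutting old tiles and one round of improvement\<close>

lemma subtiles:
  assumes "length F = r" "\<And>f. f \<in> set F \<Longrightarrow> m * b \<le> length f" "distinct (concat F)"
    "\<And>h. h \<in> listset (map set F) \<Longrightarrow> set h \<in> K"
  shows "\<exists>Ss. (\<forall>S\<in>set Ss. tile K r m S) \<and> length Ss = b \<and> distinct (concat (concat Ss)) \<and>
     set (concat (concat Ss)) \<subseteq> set (concat F)"
  using assms
proof (induction b arbitrary: F)
  case 0
  show ?case by (intro exI[of _ "[]"]) simp
next
  case (Suc b)
  let ?S = "map (take m) F" and ?F = "map (drop m) F"
  have "mset (concat ?S @ concat ?F) = mset (concat F)"
  proof (induction F)
    case (Cons f F)
    have "mset f = mset (take m f) + mset (drop m f)" by (metis append_take_drop_id mset_append)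
    then show ?case using Cons by simp
  qed simp
  then have ms: "distinct (concat ?S @ concat ?F)" "set (concat ?S @ concat ?F) = set (concat F)"
    using Suc.prems(3) mset_eq_imp_distinct_iff mset_eq_setD by blast+
  have "\<exists>Ss. (\<forall>S\<in>set Ss. tile K r m S) \<and> length Ss = b \<and> distinct (concat (concat Ss)) \<and>
     set (concat (concat Ss)) \<subseteq> set (concat ?F)"
  proof (rule Suc.IH)
    show "m * b \<le> length f" if f: "f \<in> set ?F" for f
    proof -
      obtain f' where f': "f' \<in> set F" "f = drop m f'" using f by auto
      then show ?thesis using Suc.prems(2)[OF f'(1)] by simp
    qed
    show "set h \<in> K" if "h \<in> listset (map set ?F)" for h
      using listset_map_set_mono[OF that set_drop_subset] Suc.prems(4) by blast
  qed (use Suc.prems(1) ms(1) in auto)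
  then obtain Ss where Ss: "\<forall>S\<in>set Ss. tile K r m S" "length Ss = b" "distinct (concat (concat Ss))"
     "set (concat (concat Ss)) \<subseteq> set (concat ?F)" by blast
  have "tile K r m ?S"
    unfolding tile_def
  proof (intro conjI ballI)
    show "length f = m" if f: "f \<in> set ?S" for f
    proof -
      obtain f' where f': "f' \<in> set F" "f = take m f'" using f by auto
      then show ?thesis using Suc.prems(2)[OF f'(1)] by simp
    qed
    show "set h \<in> K" if "h \<in> listset (map set ?S)" for h
      using listset_map_set_mono[OF that set_take_subset] Suc.prems(4) by blast
  qed (use Suc.prems(1) in simp)
  moreover have "distinct (concat (concat (?S # Ss)))"
    using ms(1) Ss(3,4) by auto
  moreover have "set (concat (concat (?S # Ss))) \<subseteq> set (concat F)"
  proof -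
    have "set (concat (concat (?S # Ss))) = set (concat ?S) \<union> set (concat (concat Ss))" by simp
    then show ?thesis using ms(2) Ss(4) unfolding set_append by blast
  qed
  ultimately show ?case using Ss(1,2) by (intro exI[of _ "?S # Ss"]) auto
qed

text \<open>When \<open>U\<close> is removed, every part of a tile keeps at least m (B -
  \<open>\<mu> F\<close>) vertices. All parts must be cut into equally many pieces, so the most
  heavily used one determines how many small tiles \<open>F\<close> still yields.\<close>

lemma retile:
  assumes U: "finite U" and "\<And>F. F \<in> set Ts \<Longrightarrow> tile K r (m * B) F" "distinct (concat (concat Ts))"
    "\<And>F C. F \<in> set Ts \<Longrightarrow> C \<in> set F \<Longrightarrow> card (U \<inter> set C) \<le> m * \<mu> F"
  shows "\<exists>Ss. (\<forall>S\<in>set Ss. tile K r m S) \<and> length Ss = (\<Sum>F\<leftarrow>Ts. B - \<mu> F) \<and> distinct (concat (concat Ss)) \<and>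
     set (concat (concat Ss)) \<subseteq> set (concat (concat Ts)) - U"
  using assms(2-)
proof (induction Ts)
  case Nil
  show ?case by (intro exI[of _ "[]"]) simp
next
  case (Cons F Ts)
  from Cons.IH Cons.prems obtain Ss where Ss: "\<forall>S\<in>set Ss. tile K r m S" "length Ss = (\<Sum>F\<leftarrow>Ts. B - \<mu> F)"
     "distinct (concat (concat Ss))" "set (concat (concat Ss)) \<subseteq> set (concat (concat Ts)) - U"
    by auto
  let ?F = "map (filter (\<lambda>v. v \<notin> U)) F"
  have tF: "tile K r (m * B) F" using Cons.prems(1) by simp
  have dF: "distinct (concat F)" using Cons.prems(2) by simp
  have filt: "concat ?F = filter (\<lambda>v. v \<notin> U) (concat F)" by (simp add: filter_concat)
  have "\<exists>Ss. (\<forall>S\<in>set Ss. tile K r m S) \<and> length Ss = B - \<mu> F \<and> distinct (concat (concat Ss)) \<and>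
     set (concat (concat Ss)) \<subseteq> set (concat ?F)"
  proof (rule subtiles)
    show "length ?F = r" using tF by (simp add: tile_def)
    show "distinct (concat ?F)" unfolding filt using dF by simp
    show "set h \<in> K" if "h \<in> listset (map set ?F)" for h
    proof -
      have "h \<in> listset (map set F)" by (rule listset_map_set_mono[OF that filter_is_subset])
      then show ?thesis using tF by (simp add: tile_def)
    qed
    show "m * (B - \<mu> F) \<le> length f" if f: "f \<in> set ?F" for f
    proof -
      obtain C where C: "C \<in> set F" "f = filter (\<lambda>v. v \<notin> U) C" using f by auto
      have dC: "distinct C" using dF C(1) unfolding distinct_concat_iff by blast
      have lC: "length C = m * B" using tF C(1) by (simp add: tile_def)
      have "length (filter (\<lambda>v. v \<in> U) C) = card (set (filter (\<lambda>v. v \<in> U) C))" 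
        using distinct_card[of "filter (\<lambda>v. v \<in> U) C"] dC by simp
      also have "set (filter (\<lambda>v. v \<in> U) C) = U \<inter> set C" by auto
      finally have "length (filter (\<lambda>v. v \<in> U) C) \<le> m * \<mu> F" using Cons.prems(3)[OF _ C(1)] by simp
      moreover have "length (filter (\<lambda>v. v \<in> U) C) + length f = m * B"
        using sum_length_filter_compl[of "\<lambda>v. v \<in> U" C] lC C(2) by simp
      ultimately show ?thesis unfolding diff_mult_distrib2 by linarith
    qed
  qed
  then obtain Sf where Sf: "\<forall>S\<in>set Sf. tile K r m S" "length Sf = B - \<mu> F" "distinct (concat (concat Sf))"
     "set (concat (concat Sf)) \<subseteq> set (concat ?F)" by blast
  have sF: "set (concat ?F) = set (concat F) - U" unfolding filt by auto
  have disj: "set (concat F) \<inter> set (concat (concat Ts)) = {}" using Cons.prems(2) by auto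
  have "set (concat (concat Sf)) \<inter> set (concat (concat Ss)) = {}" using Sf(4) Ss(4) disj sF by blast
  then have "distinct (concat (concat (Sf @ Ss)))" using Sf(3) Ss(3) by simp
  moreover have "set (concat (concat (Sf @ Ss))) \<subseteq> set (concat (concat (F # Ts))) - U"
  proof -
    have "set (concat (concat (Sf @ Ss))) = set (concat (concat Sf)) \<union> set (concat (concat Ss))" by simp
    moreover have "set (concat (concat (F # Ts))) = set (concat F) \<union> set (concat (concat Ts))" by simp
    ultimately show ?thesis using Sf(4) Ss(4) sF by blast
  qed
  moreover have "\<forall>S\<in>set (Sf @ Ss). tile K r m S" using Sf(1) Ss(1) by auto
  moreover have "length (Sf @ Ss) = (\<Sum>F\<leftarrow>F # Ts. B - \<mu> F)" using Sf(2) Ss(2) by simp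
  ultimately show ?case by blast
qed

text \<open>Arbitrary parts for the uncovered vertices, which can then take part in the extraction
  on the same terms as the parts of the old tiles.\<close>

lemma chunks:
  assumes "finite W" "0 < M"
  shows "\<exists>Ls. distinct (concat Ls) \<and> (\<forall>C\<in>set Ls. length C = M) \<and> set (concat Ls) \<subseteq> W \<and> card W \<le> length Ls * M + M"
  using assms(1)
proof (induction "card W" arbitrary: W rule: less_induct)
  case less
  show ?case
  proof (cases "card W < M")
    case True
    then show ?thesis by (intro exI[of _ "[]"]) simp
  next
    case False
    then obtain D where D: "D \<subseteq> W" "card D = M" using obtain_subset_with_card_n[of M W] by auto
    then have fD: "finite D" using less.prems finite_subset by blast
    have "card (W - D) = card W - M" using D fD by (simp add: card_Diff_subset)
    then have "card (W - D) < card W" using False assms(2) by simp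
    from less.hyps[OF this] less.prems obtain Ls where Ls: "distinct (concat Ls)" "\<forall>C\<in>set Ls. length C = M"
      "set (concat Ls) \<subseteq> W - D" "card (W - D) \<le> length Ls * M + M" by auto
    obtain d where d: "set d = D" "distinct d" using finite_distinct_list[OF fD] by blast
    have "length d = M" using d D(2) distinct_card by fastforce
    moreover have "distinct (concat (d # Ls))" using Ls(1,3) d by auto
    moreover have "set (concat (d # Ls)) \<subseteq> W" using Ls(3) d(1) D(1) by auto
    moreover have "card W \<le> length (d # Ls) * M + M" using Ls(4) \<open>card (W - D) = card W - M\<close> by simp
    ultimately show ?thesis using Ls(2) by (intro exI[of _ "d # Ls"]) auto
  qed
qed

text \<open>The hypothesis on second moments makes the sum of (l i - h)^2 at most h N. Each
  deviation is compared with its square by AM-GM with a free parameter \<tau>, which replaces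
  Cauchy-Schwarz and avoids roots.\<close>

lemma deviation_bound:
  fixes l :: "nat \<Rightarrow> nat" and h \<tau> :: real
  assumes S: "(\<Sum>i<N. l i) = S" "N * (\<Sum>i<N. (l i)\<^sup>2) \<le> S\<^sup>2 + N * S" and h: "h * N = S" and N: "0 < N" and \<tau>: "0 < \<tau>"
  shows "(\<Sum>i<N. \<bar>l i - h\<bar>) \<le> N * h / (2 * \<tau>) + \<tau> * N / 2"
proof -
  have "(\<Sum>i<N. (l i - h)\<^sup>2) = (\<Sum>i<N. (real (l i))\<^sup>2 - 2 * h * l i + h\<^sup>2)"
    by (intro sum.cong) (auto simp: power2_eq_square algebra_simps)
  also have "\<dots> = (\<Sum>i<N. (real (l i))\<^sup>2) - 2 * h * (\<Sum>i<N. real (l i)) + N * h\<^sup>2"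
    by (simp add: sum.distrib sum_subtractf sum_distrib_left)
  also have "(\<Sum>i<N. real (l i)) = S" using S(1) by (metis of_nat_sum)
  finally have e: "(\<Sum>i<N. (l i - h)\<^sup>2) = (\<Sum>i<N. (real (l i))\<^sup>2) - h * S"
    using h by (simp add: power2_eq_square algebra_simps)
  have "real (N * (\<Sum>i<N. (l i)\<^sup>2)) \<le> real (S\<^sup>2 + N * S)" using S(2) by (rule of_nat_mono)
  then have "N * (\<Sum>i<N. (real (l i))\<^sup>2) \<le> real S * S + N * real S" by (simp add: power2_eq_square)
  moreover have "real S * S = N * (h * S)" "N * real S = N * (h * N)" unfolding h[symmetric] by (simp_all add: mult_ac)
  ultimately have "N * (\<Sum>i<N. (l i - h)\<^sup>2) \<le> N * (h * N)" unfolding e right_diff_distrib by linarith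
  then have var: "(\<Sum>i<N. (l i - h)\<^sup>2) \<le> h * N" using N by simp
  have abs_le: "\<bar>y\<bar> \<le> y\<^sup>2 / (2 * \<tau>) + \<tau> / 2" for y :: real
  proof -
    have "0 \<le> (\<bar>y\<bar> - \<tau>)\<^sup>2" by simp
    then have "2 * \<tau> * \<bar>y\<bar> \<le> y\<^sup>2 + \<tau>\<^sup>2" by (simp add: power2_diff mult_ac)
    then show ?thesis using \<tau> by (simp add: field_simps power2_eq_square)
  qed
  have "(\<Sum>i<N. \<bar>l i - h\<bar>) \<le> (\<Sum>i<N. (l i - h)\<^sup>2 / (2 * \<tau>) + \<tau> / 2)" by (intro sum_mono abs_le)
  also have "\<dots> = (\<Sum>i<N. (l i - h)\<^sup>2) / (2 * \<tau>) + \<tau> * N / 2" by (simp add: sum.distrib sum_divide_distrib)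
  also have "\<dots> \<le> N * h / (2 * \<tau>) + \<tau> * N / 2" using var \<tau> by (simp add: divide_right_mono mult.commute)
  finally show ?thesis .
qed

lemma sum_list_concat_bound:
  fixes dev :: "'b \<Rightarrow> real" and b :: real
  assumes "\<And>F. F \<in> set Ts \<Longrightarrow> b - (\<Sum>C\<leftarrow>F. dev C) \<le> real (f F)"
  shows "length Ts * b - (\<Sum>C\<leftarrow>concat Ts. dev C) \<le> real (\<Sum>F\<leftarrow>Ts. f F)"
  using assms
proof (induction Ts)
  case (Cons F Ts)
  have "b - (\<Sum>C\<leftarrow>F. dev C) \<le> real (f F)" using Cons.prems by simp
  moreover have "length Ts * b - (\<Sum>C\<leftarrow>concat Ts. dev C) \<le> real (\<Sum>F\<leftarrow>Ts. f F)" using Cons by simp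
  ultimately show ?case by (simp add: algebra_simps)
qed simp

text \<open>The gain is \<open>x\<close> times the proportion of vertices covered by the extracted tiles, up to an error
  coming from the unbalanced use of the parts of the old tiles.\<close>

lemma round_arith:
  fixes n k0 B h N t x \<gamma> \<epsilon> \<delta> r m :: real
  assumes pos: "0 < r" "0 < m" "0 < B" "0 \<le> k0" "0 \<le> h" "0 \<le> t" "0 < \<gamma>" "0 < \<epsilon>" "0 \<le> N" "0 \<le> n"
    and x: "\<epsilon> \<le> x" "x \<le> 1" and \<delta>: "\<delta> = \<gamma> * \<epsilon> / (64 * r)"
    and k0: "(1 - x) * n \<le> k0 * (r * (m * B))" "k0 * (r * (m * B)) \<le> (1 - x) * n + r * (m * B)"
    and N: "n \<le> N * (m * B) + m * B" "N * (m * B) \<le> n"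
    and h: "h * N = r * t" and t: "\<gamma> * n / 16 \<le> r * m * t" and big: "(r + 1) * (m * B) \<le> \<epsilon> / 2 * n"
  shows "(1 - (x - \<gamma> * \<epsilon> / 64)) * n \<le> r * m * (t + (k0 * (B - h) - \<delta> * B * N))"
proof -
  define M where "M = m * B"
  have M: "0 < M" using pos by (simp add: M_def)
  have "\<epsilon> / 2 * n \<le> x / 2 * n" using x pos by (intro mult_right_mono) auto
  then have "(r + 1) * M \<le> x / 2 * n" using big unfolding M_def by linarith
  moreover have "k0 * r * M \<le> (1 - x) * n + r * M" using k0(2) by (simp add: M_def mult_ac)
  moreover have "(1 - x / 2) * (n - M) \<le> (1 - x / 2) * (N * M)" using N(1) x by (intro mult_left_mono) (auto simp: M_def)
  moreover have "(1 - x / 2) * (n - M) \<ge> n - M - x / 2 * n" using x pos M by (simp add: algebra_simps)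
  moreover have "(1 - x) * n = n - x * n" "(r + 1) * M = r * M + M" "x / 2 * n = x * n / 2"
    "(1 - x / 2) * N * M = (1 - x / 2) * (N * M)" by (simp_all add: algebra_simps)
  \<comment> \<open>The old tiles own at most a proportion 1 - x / 2 of the parts. Measured by the
    mean load \<open>h\<close>, at least a share x / 2 of the extracted tiles therefore consists of
    vertices outside them.\<close>
  ultimately have "k0 * r * M \<le> (1 - x / 2) * N * M" by linarith
  then have "k0 * r \<le> (1 - x / 2) * N" using M by simp
  then have "k0 * r * h \<le> (1 - x / 2) * N * h" using pos by (intro mult_right_mono) auto
  moreover have "(1 - x / 2) * N * h = (1 - x / 2) * (h * N)" by simp
  then have "(1 - x / 2) * N * h = (1 - x / 2) * (r * t)" by (simp only: h)
  moreover have "k0 * r * h = r * (k0 * h)" "(1 - x / 2) * (r * t) = r * ((1 - x / 2) * t)" by simp_all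
  ultimately have "r * (k0 * h) \<le> r * ((1 - x / 2) * t)" by argo
  then have kh: "k0 * h \<le> (1 - x / 2) * t" using pos by simp
  have "\<gamma> * n / 16 * (\<epsilon> / 2) \<le> r * m * t * (x / 2)" using t x pos by (intro mult_mono) auto
  also have "\<dots> = r * m * (t - (1 - x / 2) * t)" by (simp add: algebra_simps)
  also have "\<dots> \<le> r * m * (t - k0 * h)" using kh pos by (intro mult_left_mono) auto
  finally have gain: "\<gamma> * \<epsilon> * n / 32 \<le> r * m * (t - k0 * h)" by (simp add: mult_ac)
  have "r * m * (\<delta> * B * N) = r * \<delta> * (N * (m * B))" by (simp add: mult_ac)
  also have "\<dots> \<le> r * \<delta> * n" using N(2) pos \<delta> by (intro mult_left_mono) auto
  also have "\<dots> = \<gamma> * \<epsilon> * n / 64" using \<delta> pos by simp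
  finally have loss: "r * m * (\<delta> * B * N) \<le> \<gamma> * \<epsilon> * n / 64" .
  have "r * m * (t + (k0 * (B - h) - \<delta> * B * N)) = k0 * (r * (m * B)) + r * m * (t - k0 * h) - r * m * (\<delta> * B * N)"
    by (simp add: algebra_simps)
  moreover have "(1 - (x - \<gamma> * \<epsilon> / 64)) * n = (1 - x) * n + \<gamma> * \<epsilon> * n / 64" by (simp add: algebra_simps)
  ultimately show ?thesis using gain loss k0(1) by linarith
qed

text \<open>Large tiles covering about 1 - x of the vertices, together with chunks of the rest, are
  the parts from which \<open>t\<close> small tiles are extracted. These use covered and uncovered
  vertices nearly in proportion, and what remains of the large tiles is recut into small ones. The
  gain is the amount of uncovered vertices used.\<close>

lemma tiling_round:
  fixes \<gamma> \<epsilon> x :: real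
  assumes r: "2 \<le> r" and \<gamma>: "0 < \<gamma>" "\<gamma> \<le> 1" and \<epsilon>: "0 < \<epsilon>" and x: "\<epsilon> \<le> x" "x \<le> 1"
    and IH: "\<And>M. 0 < M \<Longrightarrow> \<exists>n0. \<forall>(V :: 'a set) K. ext_dense r \<gamma> V K \<longrightarrow> n0 \<le> card V \<longrightarrow>
      (\<exists>Ts. tiling V K r M Ts \<and> (1 - x) * card V \<le> r * M * length Ts)"
    and m: "0 < m"
  shows "\<exists>n0. \<forall>(V :: 'a set) K. ext_dense r \<gamma> V K \<longrightarrow> n0 \<le> card V \<longrightarrow>
      (\<exists>Ts. tiling V K r m Ts \<and> (1 - (x - \<gamma> * \<epsilon> / 64)) * card V \<le> r * m * length Ts)"
proof -
  define \<delta> where "\<delta> = \<gamma> * \<epsilon> / (64 * r)"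
  have \<delta>: "0 < \<delta>" using \<gamma> \<epsilon> r by (simp add: \<delta>_def)
  define \<kappa> where "\<kappa> = ((\<gamma> / 4) ^ (r - 1) / 2 / real r ^ r) ^ (m ^ r)"
  have \<kappa>: "0 < \<kappa>" using \<gamma> r by (simp add: \<kappa>_def)
  \<comment> \<open>The first bound makes the load deviations sum to at most \<delta> B N; the
    second lets r parts of size \<open>m * B\<close> contain the blow-up that yields a small
    tile.\<close>
  define B where "B = Suc (nat \<lceil>1 / \<delta>\<^sup>2\<rceil> + nat \<lceil>2 * real (r * m * (r * m)) / \<kappa>\<rceil>)"
  have B: "1 / \<delta>\<^sup>2 \<le> B" "2 * real (r * m * (r * m)) / \<kappa> \<le> B" "0 < B" unfolding B_def by linarith+
  define M where "M = m * B"
  have M: "0 < M" using m B by (simp add: M_def)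
  have "2 * real (r * m * (r * m)) \<le> \<kappa> * B" using B(2) \<kappa> by (simp add: field_simps)
  also have "\<dots> \<le> \<kappa> * (r * M)"
  proof -
    have "1 * B \<le> r * m * B" using m r by (intro mult_right_mono) auto
    then have "real B \<le> real (r * M)" unfolding M_def by (intro of_nat_mono) (simp add: mult_ac)
    then show ?thesis using \<kappa> by simp
  qed
  finally have big: "2 * real (r * m * (r * m)) \<le> \<kappa> * (r * M)" .
  obtain n0 where n0: "\<And>(V :: 'a set) K. ext_dense r \<gamma> V K \<Longrightarrow> n0 \<le> card V \<Longrightarrow>
      \<exists>Ts. tiling V K r M Ts \<and> (1 - x) * card V \<le> r * M * length Ts"
    using IH[OF M] by blast
  define n1 where "n1 = n0 + nat \<lceil>16 * (real r * m) / \<gamma>\<rceil> + nat \<lceil>8 * real ((r + 2) * M) / \<gamma>\<rceil> + nat \<lceil>(real r + 1) * (2 * (real m * B) / \<epsilon>)\<rceil> + 2 * M"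
  have "\<exists>Ts. tiling V K r m Ts \<and> (1 - (x - \<gamma> * \<epsilon> / 64)) * card V \<le> r * m * length Ts"
    if ED: "ext_dense r \<gamma> V K" and n: "n1 \<le> card V" for V :: "'a set" and K
  proof -
    let ?n = "real (card V)"
    have V: "finite V" using ED by (simp add: ext_dense_def)
    have "16 * (real r * m) / \<gamma> \<le> ?n" "8 * real ((r + 2) * M) / \<gamma> \<le> ?n" "(real r + 1) * (2 * (real m * B) / \<epsilon>) \<le> ?n" "n0 \<le> card V" "2 * M \<le> card V"
      using n unfolding n1_def by linarith+
    then have nb: "16 * (real r * m) \<le> \<gamma> * ?n" "8 * real ((r + 2) * M) \<le> \<gamma> * ?n" "(real r + 1) * (real m * B) \<le> \<epsilon> / 2 * ?n"
        "n0 \<le> card V" "2 * M \<le> card V"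
      using \<gamma> \<epsilon> by (auto simp: field_simps)
    obtain Ts0 where Ts0: "tiling V K r M Ts0" "(1 - x) * ?n \<le> real r * M * length Ts0" using n0[OF ED nb(4)] by auto
    \<comment> \<open>Surplus tiles are dropped: if the old tiles covered much more than 1 - x, the
      uncovered share from which the gain is computed would be lost.\<close>
    define k0 where "k0 = nat \<lceil>(1 - x) * ?n / (real r * M)\<rceil>"
    have rM: "0 < real r * M" using r M by simp
    have x0: "0 \<le> (1 - x) * ?n" using x by simp
    have k0: "(1 - x) * ?n / (real r * M) \<le> k0" "k0 \<le> (1 - x) * ?n / (real r * M) + 1"
      unfolding k0_def using x0 rM by (auto simp: ceiling_le_iff of_nat_ceiling)
    have "(1 - x) * ?n / (real r * M) \<le> length Ts0" using Ts0(2) rM by (simp add: field_simps)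
    then have k0l: "k0 \<le> length Ts0" unfolding k0_def by (simp add: ceiling_le_iff)
    define Ts where "Ts = take k0 Ts0"
    have "Ts0 = Ts @ drop k0 Ts0" by (simp add: Ts_def)
    then have "concat (concat Ts0) = concat (concat Ts) @ concat (concat (drop k0 Ts0))" by (metis concat_append)
    then have Ts: "\<forall>F\<in>set Ts. tile K r M F" "distinct (concat (concat Ts))" "set (concat (concat Ts)) \<subseteq> V"
      using Ts0(1) by (auto simp: tiling_def Ts_def dest: in_set_takeD)
    have lTs: "length Ts = k0" using k0l by (simp add: Ts_def)
    let ?W = "V - set (concat (concat Ts))"
    obtain Ls where Ls: "distinct (concat Ls)" "\<And>C. C \<in> set Ls \<Longrightarrow> length C = M" "set (concat Ls) \<subseteq> ?W" "card ?W \<le> length Ls * M + M"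
      using chunks[of ?W M] V M by auto
    define Cs where "Cs = concat Ts @ Ls"
    define N where "N = length Cs"
    have Cs: "distinct (concat Cs)" "\<And>C. C \<in> set Cs \<Longrightarrow> length C = M" "set (concat Cs) \<subseteq> V"
    proof -
      have "set (concat (concat Ts)) \<inter> set (concat Ls) = {}" using Ls(3) by blast
      then show "distinct (concat Cs)" unfolding Cs_def using Ts(2) Ls(1) by simp
      show "set (concat Cs) \<subseteq> V" unfolding Cs_def using Ts(3) Ls(3) by auto
      show "length C = M" if "C \<in> set Cs" for C
        using that Ts(1) Ls(2) unfolding Cs_def tile_def by auto
    qed
    have lenC: "length (concat Cs) = N * M"
    proof -
      have "map length Cs = replicate N M" using Cs(2) by (simp add: N_def list_eq_iff_nth_eq)
      then show ?thesis by (simp add: length_concat sum_list_replicate)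
    qed
    have NM: "card V \<le> N * M + M" "N * M \<le> card V"
    proof -
      have "card (set (concat (concat Ts))) = length (concat (concat Ts))" using Ts(2) by (rule distinct_card)
      moreover have "card ?W = card V - card (set (concat (concat Ts)))" using Ts(3) V by (intro card_Diff_subset) auto
      moreover have "length (concat Ls) = length Ls * M"
      proof -
        have "map length Ls = replicate (length Ls) M" using Ls(2) by (simp add: list_eq_iff_nth_eq)
        then show ?thesis by (simp add: length_concat sum_list_replicate)
      qed
      moreover have "length (concat Cs) = length (concat (concat Ts)) + length (concat Ls)" by (simp add: Cs_def)
      ultimately show "card V \<le> N * M + M" using Ls(4) lenC by linarith
      have "card (set (concat Cs)) = length (concat Cs)" using Cs(1) by (rule distinct_card)
      then show "N * M \<le> card V" using card_mono[OF V Cs(3)] lenC by simp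
    qed
    have N: "0 < N" using NM(1) nb(5) M by (cases N) auto
    \<comment> \<open>The largest number of small tiles that together use at most \<gamma> n / 8
      vertices.\<close>
    define t where "t = nat \<lfloor>\<gamma> * ?n / (8 * (real r * m))\<rfloor>"
    have rm: "0 < real r * m" using r m by simp
    have t1: "real t \<le> \<gamma> * ?n / (8 * (real r * m))" "\<gamma> * ?n / (8 * (real r * m)) - 1 \<le> real t"
      unfolding t_def using \<gamma> rm by (auto simp: of_nat_floor)
    have t2: "real r * real m * real t \<le> \<gamma> / 8 * ?n" "\<gamma> * ?n / 8 - real r * m \<le> real r * real m * real t"
    proof -
      have e: "real r * m * (\<gamma> * ?n / (8 * (real r * m))) = \<gamma> * ?n / 8" using rm by auto
      have "real r * m * real t \<le> real r * m * (\<gamma> * ?n / (8 * (real r * m)))" using t1(1) rm by (intro mult_left_mono) auto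
      then show "real r * real m * real t \<le> \<gamma> / 8 * ?n" unfolding e by simp
      have "real r * m * (\<gamma> * ?n / (8 * (real r * m)) - 1) \<le> real r * m * real t" using t1(2) rm by (intro mult_left_mono) auto
      then show "\<gamma> * ?n / 8 - real r * m \<le> real r * real m * real t" unfolding right_diff_distrib e by simp
    qed
    have nb2: "8 * ((real r + 2) * real M) \<le> \<gamma> * ?n" using nb(2) by (simp add: algebra_simps)
    have big': "2 * real (r * m * (r * m)) \<le> ((\<gamma> / 4) ^ (r - 1) / 2 / real r ^ r) ^ m ^ r * (real r * real M)"
      using big by (simp only: \<kappa>_def of_nat_mult)
    have "\<exists>Es l. tiling V K r m Es \<and> length Es = t \<and>
       (\<forall>i<N. card (set (concat (concat Es)) \<inter> set (Cs ! i)) = m * l i) \<and>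
       (\<Sum>i<N. l i) = r * t \<and> N * (\<Sum>i<N. (l i)\<^sup>2) \<le> (r * t)\<^sup>2 + N * (r * t)"
      unfolding N_def by (rule extract_tiles[OF ED r \<gamma> m M Cs NM(1)[unfolded N_def] t2(1) nb2 big'])
    then obtain Es l where Es: "tiling V K r m Es" "length Es = t"
       "\<And>i. i < N \<Longrightarrow> card (set (concat (concat Es)) \<inter> set (Cs ! i)) = m * l i"
       "(\<Sum>i<N. l i) = r * t" "N * (\<Sum>i<N. (l i)\<^sup>2) \<le> (r * t)\<^sup>2 + N * (r * t)" by blast
    let ?U = "set (concat (concat Es))"
    define h where "h = real (r * t) / N"
    have h: "h * N = r * t" "0 \<le> h" using N by (auto simp: h_def)
    have hB: "h \<le> B"
    proof -
      have "\<gamma> * ?n \<le> 1 * ?n" using \<gamma> by (intro mult_right_mono) auto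
      then have "8 * (real r * real m * real t) \<le> ?n" using t2(1) by linarith
      also have "?n \<le> 2 * real (N * M)"
      proof -
        have "1 * M \<le> N * M" using N by (intro mult_le_mono1) simp
        then have "card V \<le> 2 * (N * M)" using NM(1) by linarith
        then have "real (card V) \<le> real (2 * (N * M))" by (rule of_nat_mono)
        then show ?thesis by simp
      qed
      finally have "real m * (4 * (real r * t)) \<le> real m * (real B * N)" by (simp add: M_def mult_ac)
      then have "4 * (real r * t) \<le> real B * N" using m by simp
      moreover have "0 \<le> real r * t" by simp
      ultimately have "real r * t \<le> real B * N" by linarith
      then show ?thesis using N by (simp add: h_def divide_le_eq)
    qed
    \<comment> \<open>The load as a function of the part itself rather than of its index, so that it
      can be summed over lists of parts.\<close>
    define ld where "ld C = card (?U \<inter> set C) div m" for C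
    have ld: "card (?U \<inter> set C) = m * ld C" if "C \<in> set Cs" for C
      using that Es(3) m by (auto simp: ld_def in_set_conv_nth N_def)
    have ldi: "ld (Cs ! i) = l i" if "i < N" for i using Es(3)[OF that] m by (simp add: ld_def)
    define dev where "dev C = \<bar>real (ld C) - h\<bar>" for C
    have "(\<Sum>C\<leftarrow>Cs. dev C) = (\<Sum>i<N. \<bar>real (l i) - h\<bar>)"
      using ldi by (simp add: sum_list_sum_nth N_def atLeast0LessThan dev_def)
    also have "\<dots> \<le> N * h / (2 * (\<delta> * B)) + \<delta> * B * N / 2"
      using deviation_bound[OF Es(4,5) _ N, of h "\<delta> * B"] h \<delta> B by simp
    \<comment> \<open>The deviation bound was used with \<tau> = \<delta> B. Its first term is
      brought down to the size of the second by h \<le> B and B \<ge> 1 / \<delta>^2.\<close>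
    also have "N * h / (2 * (\<delta> * B)) \<le> \<delta> * B * N / 2"
    proof -
      have "N * h \<le> N * real B" using hB by (intro mult_left_mono) auto
      then have "N * h / (2 * (\<delta> * B)) \<le> N * B / (2 * (\<delta> * B))" using \<delta> B(3) by (intro divide_right_mono) auto
      also have "\<dots> = N / (2 * \<delta>)" using B(3) by simp
      also have "\<dots> = N * \<delta> / 2 * (1 / \<delta>\<^sup>2)" using \<delta> by (simp add: power2_eq_square)
      also have "\<dots> \<le> N * \<delta> / 2 * B" using B(1) \<delta> by (intro mult_left_mono) auto
      finally show ?thesis by (simp add: mult_ac)
    qed
    finally have dev: "(\<Sum>C\<leftarrow>Cs. dev C) \<le> \<delta> * B * N" by simp
    define \<mu> where "\<mu> F = Max (ld ` set F)" for F
    have F0: "set F \<noteq> {}" if "F \<in> set Ts" for F using that Ts(1) r by (auto simp: tile_def)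
    have \<mu>: "card (?U \<inter> set C) \<le> m * \<mu> F" if "F \<in> set Ts" "C \<in> set F" for F C
    proof -
      have "C \<in> set Cs" using that by (auto simp: Cs_def)
      moreover have "ld C \<le> \<mu> F" using that(2) by (auto simp: \<mu>_def)
      ultimately show ?thesis using ld by simp
    qed
    obtain Ss where Ss: "\<forall>S\<in>set Ss. tile K r m S" "length Ss = (\<Sum>F\<leftarrow>Ts. B - \<mu> F)" "distinct (concat (concat Ss))"
      "set (concat (concat Ss)) \<subseteq> set (concat (concat Ts)) - ?U"
      using retile[of ?U Ts K r m B \<mu>] Ts(1,2) \<mu> unfolding M_def by auto
    have "real B - h - (\<Sum>C\<leftarrow>F. dev C) \<le> real (B - \<mu> F)" if F: "F \<in> set Ts" for F
    proof -
      have "\<mu> F \<in> ld ` set F" unfolding \<mu>_def using F0[OF F] by (intro Max_in) auto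
      then obtain C where C: "C \<in> set F" "\<mu> F = ld C" by auto
      \<comment> \<open>A crude estimate suffices: the largest load in a tile exceeds
        \<open>h\<close> by at most the sum of all deviations in that tile.\<close>
      have "dev C \<le> (\<Sum>C\<leftarrow>F. dev C)" using C(1) by (intro member_le_sum_list) (auto simp: dev_def)
      then show "real B - h - (\<Sum>C\<leftarrow>F. dev C) \<le> real (B - \<mu> F)" using C(2) unfolding dev_def by linarith
    qed
    then have "k0 * (B - h) - (\<Sum>C\<leftarrow>concat Ts. dev C) \<le> real (\<Sum>F\<leftarrow>Ts. B - \<mu> F)"
      using sum_list_concat_bound[of Ts "real B - h" dev "\<lambda>F. B - \<mu> F"] lTs by simp
    moreover have "(\<Sum>C\<leftarrow>concat Ts. dev C) \<le> (\<Sum>C\<leftarrow>Cs. dev C)"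
    proof -
      have "0 \<le> (\<Sum>C\<leftarrow>Ls. dev C)" by (intro sum_list_nonneg) (auto simp: dev_def)
      then show ?thesis by (simp add: Cs_def)
    qed
    ultimately have lSs: "k0 * (B - h) - \<delta> * B * N \<le> length Ss" using dev Ss(2) by linarith
    have "(1 - (x - \<gamma> * \<epsilon> / 64)) * ?n \<le> real r * m * (real t + (k0 * (B - h) - \<delta> * B * N))"
    proof (rule round_arith[of "real r" "real m" "real B" "real k0" h "real t" \<gamma> \<epsilon> "real N" ?n x \<delta>])
      show "\<delta> = \<gamma> * \<epsilon> / (64 * real r)" by (simp add: \<delta>_def)
      show "(1 - x) * ?n \<le> real k0 * (real r * (real m * real B))"
        using k0(1) rM by (simp add: field_simps M_def)
      show "real k0 * (real r * (real m * real B)) \<le> (1 - x) * ?n + real r * (real m * real B)"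
      proof -
        have "real k0 * (real r * M) \<le> ((1 - x) * ?n / (real r * M) + 1) * (real r * M)"
          using k0(2) rM by (intro mult_right_mono) auto
        moreover have "(a / c + 1) * c = a + c" if "0 < c" for a c :: real using that by (simp add: field_simps)
        ultimately have "real k0 * (real r * M) \<le> (1 - x) * ?n + real r * M" using rM by simp
        then show ?thesis by (simp add: M_def)
      qed
      have "real (card V) \<le> real (N * M + M)" using NM(1) by (rule of_nat_mono)
      then show "?n \<le> real N * (real m * real B) + real m * real B" by (simp add: M_def)
      have "real (N * M) \<le> real (card V)" using NM(2) by (rule of_nat_mono)
      then show "real N * (real m * real B) \<le> ?n" by (simp add: M_def)
      show "h * real N = real r * real t" using h(1) by simp
      show "\<gamma> * ?n / 16 \<le> real r * real m * real t" using t2(2) nb(1) by linarith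
      show "(real r + 1) * (real m * real B) \<le> \<epsilon> / 2 * ?n" by (rule nb(3))
    qed (use r m B \<gamma> \<epsilon> h x in auto)
    also have "\<dots> \<le> real r * m * (real t + length Ss)" using lSs by (intro mult_left_mono) auto
    finally have "(1 - (x - \<gamma> * \<epsilon> / 64)) * ?n \<le> r * m * length (Ss @ Es)" using Es(2) by (simp add: add.commute)
    moreover have "tiling V K r m (Ss @ Es)"
    proof -
      have "set (concat (concat Ss)) \<inter> ?U = {}" "set (concat (concat Ss)) \<subseteq> V" using Ss(4) Ts(3) by blast+
      then show ?thesis using Ss(1,3) Es(1) unfolding tiling_def by auto
    qed
    ultimately show ?thesis by blast
  qed
  then show ?thesis by blast
qed

lemma almost_tiling:
  fixes \<gamma> \<epsilon> :: real
  assumes r: "2 \<le> r" and \<gamma>: "0 < \<gamma>" "\<gamma> \<le> 1" and \<epsilon>: "0 < \<epsilon>" and m: "0 < m"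
  shows "\<exists>n0. \<forall>(V :: 'a set) K. ext_dense r \<gamma> V K \<longrightarrow> n0 \<le> card V \<longrightarrow>
      (\<exists>Ts. tiling V K r m Ts \<and> (1 - \<epsilon>) * card V \<le> r * m * length Ts)"
proof -
  define \<kappa> where "\<kappa> = \<gamma> * \<epsilon> / 64"
  define Q where "Q x \<longleftrightarrow> (\<forall>m>0. \<exists>n0. \<forall>(V :: 'a set) K. ext_dense r \<gamma> V K \<longrightarrow> n0 \<le> card V \<longrightarrow>
      (\<exists>Ts. tiling V K r m Ts \<and> (1 - x) * card V \<le> r * m * length Ts))" for x :: real
  have \<kappa>: "0 < \<kappa>" using \<gamma> \<epsilon> by (simp add: \<kappa>_def)
  have mono: "Q y" if Qx: "Q x" and xy: "x \<le> y" for x y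
    unfolding Q_def
  proof (intro allI impI)
    fix m :: nat assume "0 < m"
    then obtain n0 where n0: "\<forall>(V :: 'a set) K. ext_dense r \<gamma> V K \<longrightarrow> n0 \<le> card V \<longrightarrow>
      (\<exists>Ts. tiling V K r m Ts \<and> (1 - x) * card V \<le> r * m * length Ts)" using Qx unfolding Q_def by blast
    have le: "(1 - y) * real (card V) \<le> (1 - x) * card V" for V :: "'a set" using xy by (intro mult_right_mono) auto
    show "\<exists>n0. \<forall>(V :: 'a set) K. ext_dense r \<gamma> V K \<longrightarrow> n0 \<le> card V \<longrightarrow>
      (\<exists>Ts. tiling V K r m Ts \<and> (1 - y) * card V \<le> r * m * length Ts)"
    proof (intro exI[of _ n0] allI impI)
      fix V :: "'a set" and K assume "ext_dense r \<gamma> V K" "n0 \<le> card V"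
      with n0 have "\<exists>Ts. tiling V K r m Ts \<and> (1 - x) * card V \<le> r * m * length Ts" by simp
      then obtain Ts where "tiling V K r m Ts" "(1 - x) * card V \<le> r * m * length Ts" by blast
      then show "\<exists>Ts. tiling V K r m Ts \<and> (1 - y) * card V \<le> r * m * length Ts"
        using le[of V] by (intro exI[of _ Ts]) auto
    qed
  qed
  have "Q (max \<epsilon> (1 - j * \<kappa>))" for j :: nat
  proof (induction j)
    case 0
    have "\<exists>Ts. tiling V K r m Ts \<and> (1 - 1) * real (card V) \<le> r * m * length Ts" for V :: "'a set" and K and m :: nat
      by (intro exI[of _ "[]"]) (simp add: tiling_def)
    then have "Q 1" unfolding Q_def by blast
    then show ?case by (rule mono) simp
  next
    case (Suc j)
    show ?case
    proof (cases "\<epsilon> \<le> 1 - j * \<kappa>")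
      case True
      then have Qj: "Q (1 - j * \<kappa>)" using Suc by (simp add: max_def split: if_splits)
      have eq: "1 - Suc j * \<kappa> = 1 - j * \<kappa> - \<gamma> * \<epsilon> / 64" by (simp add: \<kappa>_def algebra_simps)
      have "Q (1 - Suc j * \<kappa>)"
        unfolding Q_def eq
      proof (intro allI impI)
        fix m :: nat assume m: "0 < m"
        show "\<exists>n0. \<forall>(V :: 'a set) K. ext_dense r \<gamma> V K \<longrightarrow> n0 \<le> card V \<longrightarrow>
          (\<exists>Ts. tiling V K r m Ts \<and> (1 - (1 - j * \<kappa> - \<gamma> * \<epsilon> / 64)) * card V \<le> r * m * length Ts)"
          by (rule tiling_round[OF r \<gamma> \<epsilon> True _ _ m]) (use Qj \<kappa> in \<open>simp_all add: Q_def\<close>)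
      qed
      then show ?thesis by (rule mono) simp
    next
      case False
      then have "Q \<epsilon>" using Suc by (simp add: max_def split: if_splits)
      then show ?thesis by (rule mono) simp
    qed
  qed
  moreover obtain j :: nat where "1 / \<kappa> < j" using reals_Archimedean2 by blast
  then have "1 < j * \<kappa>" using \<kappa> by (simp add: field_simps)
  then have "max \<epsilon> (1 - j * \<kappa>) = \<epsilon>" using \<epsilon> by simp
  ultimately have "Q \<epsilon>" by metis
  then show ?thesis using m unfolding Q_def by blast
qed

text \<open>The parts are visited cyclically, round after round, so any r consecutive vertices lie
  in different parts and form a clique.\<close>

lemma tile_path:
  assumes F: "tile K r m F" "distinct (concat F)" and down: "down K" "{} \<in> K" and r: "0 < r"
  shows "\<exists>p. tight K r p \<and> distinct p \<and> set p = set (concat F) \<and> length p = r * m"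
proof -
  define \<omega> where "\<omega> = map (\<lambda>t. t mod r) [0..<r * m]"
  define p where "p = map (\<lambda>t. F ! (\<omega> ! t) ! (t div r)) [0..<length \<omega>]"
  have len: "length F = r" "\<And>f. f \<in> set F \<Longrightarrow> length f = m" using F(1) by (auto simp: tile_def)
  have Fi: "length (F ! i) = m" if "i < r" for i using len that by simp
  have \<omega>: "length \<omega> = r * m" "\<And>t. t < r * m \<Longrightarrow> \<omega> ! t = t mod r" by (auto simp: \<omega>_def)
  have tdiv: "t div r < m" if "t < r * m" for t using that by (metis less_mult_imp_div_less mult.commute)
  have dp: "distinct p"
    unfolding p_def distinct_map
  proof (intro conjI inj_onI)
    fix t t' assume t: "t \<in> set [0..<length \<omega>]" "t' \<in> set [0..<length \<omega>]" "F ! (\<omega> ! t) ! (t div r) = F ! (\<omega> ! t') ! (t' div r)"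
    then have tt: "t < r * m" "t' < r * m" using \<omega>(1) by auto
    then have "t mod r = t' mod r \<and> t div r = t' div r"
      using distinct_concat_nth[OF F(2), of "t mod r" "t' mod r" "t div r" "t' div r"] t(3) \<omega>(2) r len(1) Fi tdiv by simp
    then show "t = t'" by (metis div_mult_mod_eq)
  qed simp
  have lp: "length p = r * m" by (simp add: p_def \<omega>)
  have "set p \<subseteq> set (concat F)"
  proof
    fix v assume "v \<in> set p"
    then obtain t where t: "t < r * m" "v = F ! (t mod r) ! (t div r)" using \<omega> by (auto simp: p_def)
    then have "F ! (t mod r) \<in> set F" "v \<in> set (F ! (t mod r))" using r len(1) Fi tdiv by auto
    then show "v \<in> set (concat F)" by auto
  qed
  moreover have "card (set p) = card (set (concat F))"
    using distinct_card[OF dp] distinct_card[OF F(2)] lp tile_length[OF F(1)] by simp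
  ultimately have sp: "set p = set (concat F)" by (intro card_subset_eq) auto
  have "tight K r p"
    unfolding p_def
  proof (rule tight_lift[OF down len(2) order_refl])
    fix h assume h: "h \<in> listset (map set F)"
    have hK: "set h \<in> K" using F(1) h by (simp add: tile_def)
    have lh: "length h = r" "\<And>i. i < r \<Longrightarrow> h ! i \<in> set (F ! i)" using h len(1) by (auto simp: listset_map_set_iff)
    have hinj: "i = j" if "i < r" "j < r" "h ! i = h ! j" for i j
      using distinct_concat_nth[OF F(2)] lh(2) that len(1) by (metis in_set_conv_nth)
    show "tight K r (map (nth h) \<omega>)"
      unfolding tight_def
    proof (intro allI impI)
      fix ys assume ys: "sublist ys (map (nth h) \<omega>) \<and> length ys \<le> r"
      then have "sublist ys (map (\<lambda>t. h ! (t mod r)) [0..<r * m])" by (simp add: \<omega>_def comp_def)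
      then obtain ts where ts: "sublist ts [0..<r * m]" "ys = map (\<lambda>t. h ! (t mod r)) ts" by (auto simp: sublist_map_conv)
      obtain ps ss where split: "[0..<r * m] = ps @ ts @ ss" using ts(1) by (auto simp: sublist_def)
      have tsi: "ts ! i = length ps + i" if "i < length ts" for i
      proof -
        have "length ps + i < r * m" using that arg_cong[OF split, of length] by simp
        then have "[0..<r * m] ! (length ps + i) = length ps + i" by simp
        then show ?thesis using that unfolding split by (simp add: nth_append)
      qed
      have modlt: "t mod r \<noteq> t' mod r" if "t < t'" "t' < t + r" for t t' :: nat
      proof
        assume "t mod r = t' mod r"
        then have "r dvd t' - t" using that(1) by (metis mod_eq_dvd_iff_nat less_imp_le)
        then show False using that by (auto dest: dvd_imp_le)
      qed
      have "distinct ys"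
        unfolding distinct_conv_nth
      proof (intro allI impI)
        fix i j assume ij: "i < length ys" "j < length ys" "i \<noteq> j"
        have "ts ! i mod r \<noteq> ts ! j mod r"
          using modlt[of "ts ! i" "ts ! j"] modlt[of "ts ! j" "ts ! i"] tsi[of i] tsi[of j] ij ts(2) ys by (cases "i < j") auto
        then show "ys ! i \<noteq> ys ! j" using hinj[of "ts ! i mod r" "ts ! j mod r"] r ij ts(2) by auto
      qed
      moreover have "set ys \<subseteq> set h" using ts(2) lh(1) r by auto
      ultimately show "distinct ys \<and> set ys \<in> K" using downD[OF down(1) hK] by blast
    qed
  next
    show "set \<omega> \<subseteq> {..<length F}" using r len(1) by (auto simp: \<omega>_def)
    show "t div r < m" if "t < length \<omega>" for t using that tdiv \<omega>(1) by simp
    show "distinct (map (\<lambda>t. F ! (\<omega> ! t) ! (t div r)) [0..<length \<omega>])" using dp by (simp add: p_def)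
  qed
  then show ?thesis using dp sp lp by blast
qed

lemma almost_path_cover:
  fixes \<gamma> \<epsilon> :: real
  assumes r: "2 \<le> r" and \<gamma>: "0 < \<gamma>" "\<gamma> \<le> 1" and \<epsilon>: "0 < \<epsilon>" and m: "0 < m"
  shows "\<exists>n0. \<forall>(V :: 'a set) K. ext_dense r \<gamma> V K \<longrightarrow> n0 \<le> card V \<longrightarrow>
      (\<exists>ps. (\<forall>p\<in>set ps. tight K r p \<and> length p = r * m) \<and> distinct (concat ps) \<and> set (concat ps) \<subseteq> V \<and>
         (1 - \<epsilon>) * card V \<le> card (set (concat ps)))"
proof -
  obtain n0 where n0: "\<And>(V :: 'a set) K. ext_dense r \<gamma> V K \<Longrightarrow> n0 \<le> card V \<Longrightarrow>
      \<exists>Ts. tiling V K r m Ts \<and> (1 - \<epsilon>) * card V \<le> r * m * length Ts"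
    using almost_tiling[OF assms, where 'a = 'a] by blast
  have "\<exists>ps. (\<forall>p\<in>set ps. tight K r p \<and> length p = r * m) \<and> distinct (concat ps) \<and> set (concat ps) \<subseteq> V \<and>
         (1 - \<epsilon>) * card V \<le> card (set (concat ps))" if ED: "ext_dense r \<gamma> V K" and n: "n0 \<le> card V" for V :: "'a set" and K
  proof -
    obtain Ts where Ts: "tiling V K r m Ts" "(1 - \<epsilon>) * card V \<le> r * m * length Ts" using n0[OF ED n] by blast
    have down: "down K" "{} \<in> K" using ED by (auto simp: ext_dense_def)
    have "\<exists>ps. (\<forall>p\<in>set ps. tight K r p \<and> length p = r * m) \<and> distinct (concat ps) \<and> set (concat ps) = set (concat (concat Ts)) \<and> length ps = length Ts"
      if "\<forall>F\<in>set Ts. tile K r m F" "distinct (concat (concat Ts))" for Ts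
      using that
    proof (induction Ts)
      case (Cons F Ts)
      then obtain ps where ps: "\<forall>p\<in>set ps. tight K r p \<and> length p = r * m" "distinct (concat ps)"
         "set (concat ps) = set (concat (concat Ts))" "length ps = length Ts" by auto
      obtain p where p: "tight K r p" "distinct p" "set p = set (concat F)" "length p = r * m"
        using tile_path[of K r m F] Cons.prems down r by auto
      have "set (concat F) \<inter> set (concat (concat Ts)) = {}" using Cons.prems(2) by auto
      then have "distinct (concat (p # ps))" using p ps by auto
      then show ?case using p ps by (intro exI[of _ "p # ps"]) auto
    qed simp
    then obtain ps where ps: "\<forall>p\<in>set ps. tight K r p \<and> length p = r * m" "distinct (concat ps)"
         "set (concat ps) = set (concat (concat Ts))" "length ps = length Ts"
      using Ts(1) unfolding tiling_def by blast
    have "card (set (concat ps)) = length (concat (concat Ts))"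
      using Ts(1) ps(3) distinct_card unfolding tiling_def by metis
    also have "\<dots> = length Ts * (r * m)" using Ts(1) tiling_length[of Ts K r m] by (simp add: tiling_def)
    finally show ?thesis using ps Ts by (intro exI[of _ ps]) (auto simp: tiling_def mult_ac)
  qed
  then show ?thesis by blast
qed

section \<open>Tight Hamilton cycles\<close>

lemma log_small:
  fixes \<eta> C :: real
  assumes "0 < \<eta>" "0 \<le> C"
  shows "\<exists>n0::nat. \<forall>n\<ge>n0. C * (1 + ln (real n)) \<le> \<eta> * n"
proof -
  define n0 where "n0 = Suc (nat \<lceil>(3 * C / \<eta>)\<^sup>2\<rceil>)"
  have "C * (1 + ln (real n)) \<le> \<eta> * n" if n: "n0 \<le> n" for n
  proof -
    have "(3 * C / \<eta>)\<^sup>2 \<le> n" "1 \<le> n" using n unfolding n0_def by linarith+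
    then have s: "3 * C / \<eta> \<le> sqrt n" "1 \<le> sqrt n" using assms by (auto intro: real_le_rsqrt)
    have "ln (real n) = 2 * ln (sqrt n)" using \<open>1 \<le> n\<close> by (simp add: ln_sqrt)
    also have "\<dots> \<le> 2 * sqrt n" using s(2) ln_bound[of "sqrt n"] by simp
    finally have "1 + ln (real n) \<le> 3 * sqrt n" using s(2) by linarith
    then have "C * (1 + ln (real n)) \<le> C * (3 * sqrt n)" using assms(2) by (intro mult_left_mono) auto
    also have "\<dots> = 3 * C * sqrt n" by simp
    also have "\<dots> \<le> (\<eta> * sqrt n) * sqrt n"
      using s assms(1) by (intro mult_right_mono) (auto simp: field_simps)
    also have "\<dots> = \<eta> * n" by (simp add: mult.assoc)
    finally show ?thesis .
  qed
  then show ?thesis by blast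
qed

section \<open>Absorbing path and reservoir\<close>

lemma words_avoiding:
  fixes c :: real
  assumes V: "finite V" "0 < card V" and A: "A \<subseteq> words V N" "c * card V ^ N \<le> card A" and c: "0 < c" and N: "0 < N"
    and U: "finite U" "2 * real (N * card U) \<le> c * card V"
  shows "\<exists>g\<in>A. set g \<inter> U = {}"
proof -
  have "c / 2 * card V ^ N \<le> card {xs \<in> A. \<not> set xs \<inter> U \<noteq> {}}"
    by (rule card_words_Diff[OF V(1) A card_words_meeting[OF V(1) U(1)] U(2) N])
  moreover have "0 < c / 2 * real (card V ^ N)" using c V by simp
  ultimately have "{xs \<in> A. \<not> set xs \<inter> U \<noteq> {}} \<noteq> {}" by (metis card.empty of_nat_0 not_le)
  then show ?thesis by blast
qed

lemma connector_path:
  assumes "g \<in> words V N \<inter> connectors K r X Y" "set g \<inter> U = {}"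
  shows "\<exists>z. distinct z \<and> set z \<subseteq> set g - U \<and> length z \<le> N \<and> tight K r (X @ z @ Y)"
proof -
  obtain z where z: "set z \<subseteq> set g" "distinct z" "tight K r (X @ z @ Y)" using assms by (auto simp: connectors_def)
  have "length z = card (set z)" using z(2) by (simp add: distinct_card)
  also have "\<dots> \<le> card (set g)" using z(1) by (intro card_mono) auto
  also have "\<dots> \<le> N" using assms(1) card_length[of g] by (simp add: words_def)
  finally show ?thesis using z assms(2) by (intro exI[of _ z]) blast
qed

text \<open>Disjoint absorbers are selected so that each vertex gets linearly many, and are strung
  together by connectors that avoid everything used so far. No prepared reservoir is needed here,
  since the used vertices are so few that they cannot meet all connectors.\<close>

lemma absorbing_blocks:
  fixes \<gamma> \<beta>0 :: real
  assumes r: "2 \<le> r" and \<gamma>: "0 < \<gamma>" "\<gamma> \<le> 1" and \<beta>0: "0 < \<beta>0"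
  shows "\<exists>\<epsilon> n0. 0 < \<epsilon> \<and> (\<forall>(V :: 'a set) K. dense_complex r \<gamma> V K \<longrightarrow> n0 \<le> card V \<longrightarrow>
    (\<exists>bs \<A>. tight K r (concat bs) \<and> distinct (concat bs) \<and> r \<le> Suc (length (concat bs)) \<and> set (concat bs) \<subseteq> V \<and>
      card (set (concat bs)) \<le> \<beta>0 * real (card V) \<and> finite \<A> \<and> \<A> \<subseteq> set bs \<and>
      (\<forall>v\<in>V. \<epsilon> * real (card V) \<le> card (\<A> \<inter> absorbers K r v))))"
proof -
  obtain N c n1 where N: "0 < N" and c: "0 < c" "c \<le> 1" and conn: "\<And>(V :: 'a set) K X Y. dense_complex r \<gamma> V K \<Longrightarrow> n1 \<le> card V \<Longrightarrow>
     ordered_clique K r X \<Longrightarrow> ordered_clique K r Y \<Longrightarrow> c * real (card V) ^ N \<le> card (words V N \<inter> connectors K r X Y)"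
    using card_connectors[OF r \<gamma>, where 'a = 'a] by blast
  define R where "R = 2 * (r - 1)"
  define a where "a = (\<gamma> / 2) ^ R"
  have R: "0 < R" using r by (simp add: R_def)
  have a: "0 < a" "a \<le> 1" using \<gamma> by (auto simp: a_def intro: power_le_one)
  \<comment> \<open>In this order: the absorbers are few enough for the greedy selection, the
    connectors can avoid what has been used, and the joined path has at most
    \<open>\<beta>0 * n\<close> vertices.\<close>
  define \<beta> where "\<beta> = min (a / (2 * R * R)) (min (c / (2 * N * (N + R))) (\<beta>0 / (N + R)))"
  have \<beta>: "0 < \<beta>" using a R c N \<beta>0 by (simp add: \<beta>_def)
  have "\<beta> \<le> a / (2 * R * R)" "\<beta> \<le> c / (2 * N * (N + R))" "\<beta> \<le> \<beta>0 / (N + R)" by (auto simp: \<beta>_def)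
  moreover have "d * x \<le> y" if "x \<le> y / d" "0 < d" for x y d :: real using that by (simp add: field_simps)
  ultimately have \<beta>': "2 * R * R * \<beta> \<le> a" "2 * N * (N + R) * \<beta> \<le> c" "(N + R) * \<beta> \<le> \<beta>0"
    using R N by simp_all
  \<comment> \<open>With about \<beta> n selected words each vertex is promised about a \<beta> n /
    4 absorbers; half of this is given up to the logarithm and to rounding.\<close>
  define \<epsilon> where "\<epsilon> = a * \<beta> / 8"
  have \<epsilon>: "0 < \<epsilon>" using a \<beta> by (simp add: \<epsilon>_def)
  obtain n2 where n2: "\<And>n. n2 \<le> n \<Longrightarrow> 1 * (1 + ln (real n)) \<le> \<epsilon> * n" using log_small[of \<epsilon> 1] \<epsilon> by auto
  define n0 where "n0 = Suc (n1 + n2 + nat \<lceil>2 * (2 * real r) / \<gamma>\<rceil>)"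
  have main: "\<exists>bs \<A>. tight K r (concat bs) \<and> distinct (concat bs) \<and> r \<le> Suc (length (concat bs)) \<and> set (concat bs) \<subseteq> V \<and>
      card (set (concat bs)) \<le> \<beta>0 * real (card V) \<and> finite \<A> \<and> \<A> \<subseteq> set bs \<and>
      (\<forall>v\<in>V. \<epsilon> * real (card V) \<le> card (\<A> \<inter> absorbers K r v))"
    if K: "dense_complex r \<gamma> V K" and n: "n0 \<le> card V" for V :: "'a set" and K
  proof -
    let ?n = "real (card V)"
    note V = dense_complexD(1)[OF K]
    have n': "n1 \<le> card V" "n2 \<le> card V" "0 < card V" "2 * (2 * real r) / \<gamma> \<le> ?n"
      using n unfolding n0_def by linarith+
    have Vne: "V \<noteq> {}" using n'(3) by auto
    define t where "t = nat \<lfloor>\<beta> * ?n\<rfloor>"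
    have t: "real t \<le> \<beta> * ?n" "\<beta> * ?n - 1 \<le> real t"
      unfolding t_def using \<beta> by (auto simp: of_nat_floor)
    have scale: "x * real t \<le> y * ?n" if "0 \<le> x" "x * \<beta> \<le> y" for x y
    proof -
      have "x * real t \<le> x * (\<beta> * ?n)" using t(1) that(1) by (intro mult_left_mono)
      also have "\<dots> = (x * \<beta>) * ?n" by simp
      also have "\<dots> \<le> y * ?n" using that(2) by (intro mult_right_mono) auto
      finally show ?thesis .
    qed
    define A where "A v = words V R \<inter> absorbers K r v" for v
    have "2 * (2 * real r) \<le> \<gamma> * ?n" using n'(4) \<gamma> by (simp add: field_simps)
    then have cA: "a * card V ^ R \<le> card (A v)" if "v \<in> V" for v
      using card_absorbers[OF K r that \<gamma>(1)] by (simp add: a_def A_def R_def)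
    have Aw: "A v \<subseteq> words V R" for v by (simp add: A_def)
    have smallA: "2 * real (R * (card {} + t * R)) \<le> a * card V"
      using scale[of "2 * R * R" a] \<beta>'(1) by (simp add: mult_ac)
    have "\<exists>\<A>. finite \<A> \<and> card \<A> \<le> t \<and> \<A> \<subseteq> (\<Union>v\<in>V. A v) \<and> (\<forall>f\<in>\<A>. \<forall>g\<in>\<A>. f \<noteq> g \<longrightarrow> set f \<inter> set g = {})
       \<and> (\<forall>f\<in>\<A>. set f \<inter> {} = {}) \<and> (\<forall>v\<in>V. a * t / 4 - ln (card V) \<le> card (\<A> \<inter> A v))"
      by (rule greedy_selection[OF V n'(3) V Vne R Aw cA a finite.emptyI smallA])
    then obtain \<A> where \<A>: "finite \<A>" "card \<A> \<le> t" "\<A> \<subseteq> (\<Union>v\<in>V. A v)"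
      "\<forall>f\<in>\<A>. \<forall>g\<in>\<A>. f \<noteq> g \<longrightarrow> set f \<inter> set g = {}"
      "\<forall>v\<in>V. a * t / 4 - ln (card V) \<le> card (\<A> \<inter> A v)"
      by (elim exE conjE)
    have hits: "\<epsilon> * ?n \<le> card (\<A> \<inter> absorbers K r v)" if v: "v \<in> V" for v
    proof -
      have "a / 4 * (\<beta> * ?n - 1) \<le> a / 4 * t" using t(2) a by (intro mult_left_mono) auto
      then have "2 * (\<epsilon> * ?n) - a / 4 \<le> a * t / 4" by (simp add: \<epsilon>_def algebra_simps)
      moreover have "1 + ln ?n \<le> \<epsilon> * ?n" using n2[OF n'(2)] by simp
      moreover have "card (\<A> \<inter> A v) \<le> card (\<A> \<inter> absorbers K r v)" using \<A>(1) by (intro card_mono) (auto simp: A_def)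
      ultimately show ?thesis using \<A>(5)[rule_format, OF v] a by linarith
    qed
    have "0 < \<epsilon> * ?n" using \<epsilon> n'(3) by simp
    then have "\<A> \<noteq> {}" using hits Vne by fastforce
    obtain ps where ps: "set ps = \<A>" "distinct ps" using finite_distinct_list[OF \<A>(1)] by blast
    have p: "tight K r p \<and> r \<le> Suc (length p) \<and> distinct p \<and> set p \<subseteq> V \<and> length p = R" if "p \<in> \<A>" for p
      using that \<A>(3) r by (auto simp: A_def absorbers_def words_def R_def)
    have dps: "distinct (concat ps)" using ps \<A>(4) p by (intro distinct_concat) auto
    have lps: "length ps \<le> t" using ps \<A>(2) distinct_card by fastforce
    define P where "P = set (concat ps)"
    have PV: "P \<subseteq> V" using p ps(1) by (auto simp: P_def)
    have "map length ps = replicate (length ps) R" using p ps(1) by (intro replicate_eqI) auto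
    then have "length (concat ps) = length ps * R" by (simp add: length_concat sum_list_replicate)
    then have "card P \<le> length ps * R" using card_length[of "concat ps"] by (simp add: P_def)
    then have cP: "card P \<le> t * R" using mult_le_mono1[OF lps, of R] by linarith
    have "\<exists>bs. tight K r (concat bs) \<and> distinct (concat bs) \<and> set ps \<subseteq> set bs \<and> r \<le> Suc (length (concat bs)) \<and>
       set (concat bs) \<subseteq> set (concat ps) \<union> (V - P) \<and> card (set (concat bs) \<inter> (V - P)) \<le> (length ps - 1) * N"
    proof (rule join_paths[where t = t])
      fix X Y U assume X: "ordered_clique K r X" and Y: "ordered_clique K r Y" and U: "U \<subseteq> V - P" "finite U" "card U \<le> t * N"
      have "card (U \<union> P) \<le> t * (N + R)" using U(3) cP card_Un_le[of U P] by (simp add: algebra_simps)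
      then have "real (N * card (U \<union> P)) \<le> real (N * (t * (N + R)))" by (intro of_nat_mono mult_le_mono2)
      moreover have "2 * real (N * (t * (N + R))) \<le> c * ?n" using scale[of "2 * N * (N + R)" c] \<beta>'(2) by (simp add: mult_ac)
      ultimately have "2 * real (N * card (U \<union> P)) \<le> c * ?n" by linarith
      moreover have "finite (U \<union> P)" using U(2) by (simp add: P_def)
      ultimately obtain g where g: "g \<in> words V N \<inter> connectors K r X Y" "set g \<inter> (U \<union> P) = {}"
        using words_avoiding[OF V n'(3) _ _ c(1) N, of "words V N \<inter> connectors K r X Y" "U \<union> P"] conn[OF K n'(1) X Y] by auto
      have "set g \<subseteq> V" using g(1) by (auto simp: words_def)
      then show "\<exists>z. distinct z \<and> set z \<subseteq> V - P - U \<and> length z \<le> N \<and> tight K r (X @ z @ Y)"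
        using connector_path[OF g] by blast
    qed (use r ps(1) \<open>\<A> \<noteq> {}\<close> lps p dps in \<open>auto simp: P_def\<close>)
    then obtain bs where bs: "tight K r (concat bs)" "distinct (concat bs)" "set ps \<subseteq> set bs" "r \<le> Suc (length (concat bs))"
       "set (concat bs) \<subseteq> P \<union> (V - P)" "card (set (concat bs) \<inter> (V - P)) \<le> (length ps - 1) * N"
      unfolding P_def by blast
    have "card (set (concat bs)) \<le> card (P \<union> (set (concat bs) \<inter> (V - P)))"
      using bs(5) by (intro card_mono) (auto simp: P_def)
    also have "\<dots> \<le> card P + card (set (concat bs) \<inter> (V - P))" by (rule card_Un_le)
    also have "\<dots> \<le> t * R + t * N"
    proof -
      have "(length ps - 1) * N \<le> t * N" using lps by (intro mult_le_mono1) simp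
      then show ?thesis using cP bs(6) by linarith
    qed
    finally have "real (card (set (concat bs))) \<le> real (t * R + t * N)" by (rule of_nat_mono)
    also have "\<dots> \<le> \<beta>0 * ?n" using scale[of "N + R" \<beta>0] \<beta>'(3) by (simp add: algebra_simps)
    finally have "card (set (concat bs)) \<le> \<beta>0 * ?n" .
    moreover have "set (concat bs) \<subseteq> V" using bs(5) PV by blast
    ultimately show ?thesis using bs(1-4) hits \<A>(1) ps(1)
      by (intro exI[of _ bs] exI[of _ \<A>] conjI ballI) simp_all
  qed
  show ?thesis
    by (intro exI[of _ \<epsilon>] exI[of _ n0] conjI allI impI \<epsilon>) (rule main)
qed

text \<open>\<open>Z\<close> is a union of disjoint connectors, with at least \<epsilon> n of them
  for each pair of ordered cliques. Fewer than \<epsilon> n vertices cannot meet all of these, so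
  one is always intact. The bound \<delta> on the avoided set \<open>P\<close> is fixed before
  \<beta>0, because \<beta>0 will depend on how much the absorbing path \<open>P\<close> can
  absorb.\<close>

lemma reservoir:
  fixes \<gamma> :: real
  assumes r: "2 \<le> r" and \<gamma>: "0 < \<gamma>" "\<gamma> \<le> 1"
  shows "\<exists>N \<delta>. 0 < N \<and> 0 < \<delta> \<and> (\<forall>\<beta>0>0. \<exists>\<epsilon> n0. 0 < \<epsilon> \<and> (\<forall>(V :: 'a set) K P. dense_complex r \<gamma> V K \<longrightarrow> n0 \<le> card V \<longrightarrow>
    P \<subseteq> V \<longrightarrow> card P \<le> \<delta> * real (card V) \<longrightarrow>
    (\<exists>Z. Z \<subseteq> V - P \<and> card Z \<le> \<beta>0 * real (card V) \<and>
      (\<forall>X Y U. ordered_clique K r X \<longrightarrow> ordered_clique K r Y \<longrightarrow> U \<subseteq> Z \<longrightarrow> card U < \<epsilon> * real (card V) \<longrightarrow>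
        (\<exists>z. distinct z \<and> set z \<subseteq> Z - U \<and> length z \<le> N \<and> tight K r (X @ z @ Y))))))"
proof -
  obtain N c n1 where N: "0 < N" and c: "0 < c" "c \<le> 1" and conn: "\<And>(V :: 'a set) K X Y. dense_complex r \<gamma> V K \<Longrightarrow> n1 \<le> card V \<Longrightarrow>
     ordered_clique K r X \<Longrightarrow> ordered_clique K r Y \<Longrightarrow> c * real (card V) ^ N \<le> card (words V N \<inter> connectors K r X Y)"
    using card_connectors[OF r \<gamma>, where 'a = 'a] by blast
  define \<delta> where "\<delta> = c / (4 * N)"
  have \<delta>: "0 < \<delta>" using c N by (simp add: \<delta>_def)
  have "\<exists>\<epsilon> n0. 0 < \<epsilon> \<and> (\<forall>(V :: 'a set) K P. dense_complex r \<gamma> V K \<longrightarrow> n0 \<le> card V \<longrightarrow>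
    P \<subseteq> V \<longrightarrow> card P \<le> \<delta> * real (card V) \<longrightarrow>
    (\<exists>Z. Z \<subseteq> V - P \<and> card Z \<le> \<beta>0 * real (card V) \<and>
      (\<forall>X Y U. ordered_clique K r X \<longrightarrow> ordered_clique K r Y \<longrightarrow> U \<subseteq> Z \<longrightarrow> card U < \<epsilon> * real (card V) \<longrightarrow>
        (\<exists>z. distinct z \<and> set z \<subseteq> Z - U \<and> length z \<le> N \<and> tight K r (X @ z @ Y)))))"
    if \<beta>0: "0 < \<beta>0" for \<beta>0 :: real
  proof -
    define \<beta> where "\<beta> = min (c / (4 * N * N)) (\<beta>0 / N)"
    have \<beta>: "0 < \<beta>" using c N \<beta>0 by (simp add: \<beta>_def)
    have "\<beta> \<le> c / (4 * N * N)" "\<beta> \<le> \<beta>0 / N" by (auto simp: \<beta>_def)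
    then have \<beta>': "4 * N * N * \<beta> \<le> c" "N * \<beta> \<le> \<beta>0" using N by (auto simp: field_simps)
    define \<epsilon> where "\<epsilon> = c * \<beta> / 8"
    have \<epsilon>: "0 < \<epsilon>" using c \<beta> by (simp add: \<epsilon>_def)
    \<comment> \<open>There are at most n^D pairs of ordered cliques, so serving all of them costs D
      ln n in the greedy selection.\<close>
    define D where "D = 2 * (r - 1)"
    obtain n2 where n2: "\<And>n. n2 \<le> n \<Longrightarrow> real (Suc D) * (1 + ln (real n)) \<le> \<epsilon> * n" using log_small[of \<epsilon> "Suc D"] \<epsilon> by auto
    define n0 where "n0 = Suc (n1 + n2)"
    have "\<exists>Z. Z \<subseteq> V - P \<and> card Z \<le> \<beta>0 * real (card V) \<and>
      (\<forall>X Y U. ordered_clique K r X \<longrightarrow> ordered_clique K r Y \<longrightarrow> U \<subseteq> Z \<longrightarrow> card U < \<epsilon> * real (card V) \<longrightarrow>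
        (\<exists>z. distinct z \<and> set z \<subseteq> Z - U \<and> length z \<le> N \<and> tight K r (X @ z @ Y)))"
      if K: "dense_complex r \<gamma> V K" and n: "n0 \<le> card V" and P: "P \<subseteq> V" "card P \<le> \<delta> * real (card V)" for V :: "'a set" and K P
    proof -
      let ?n = "real (card V)"
      note V = dense_complexD(1)[OF K]
      have n': "n1 \<le> card V" "n2 \<le> card V" "0 < card V" using n unfolding n0_def by linarith+
      define I where "I = {(X, Y). ordered_clique K r X \<and> ordered_clique K r Y}"
      have "I \<subseteq> words V (r - 1) \<times> words V (r - 1)"
        using dense_complexD(4)[OF K] by (auto simp: I_def ordered_clique_def words_def)
      then have I: "finite I" "card I \<le> card V ^ D"
        using V card_mono[of "words V (r - 1) \<times> words V (r - 1)" I] finite_subset[of I]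
        by (auto simp: card_cartesian_product D_def power_add[symmetric] mult_2)
      show ?thesis
      proof (cases "I = {}")
        case True
        then have "\<not> (ordered_clique K r X \<and> ordered_clique K r Y)" for X Y by (auto simp: I_def)
        then show ?thesis using \<beta>0 by (intro exI[of _ "{}"]) auto
      next
        case False
        define t where "t = nat \<lfloor>\<beta> * ?n\<rfloor>"
        have t: "real t \<le> \<beta> * ?n" "\<beta> * ?n - 1 \<le> real t"
          unfolding t_def using \<beta> by (auto simp: of_nat_floor)
        have scale: "x * real t \<le> y * ?n" if "0 \<le> x" "x * \<beta> \<le> y" for x y
        proof -
          have "x * real t \<le> x * (\<beta> * ?n)" using t(1) that(1) by (intro mult_left_mono)
          also have "\<dots> = (x * \<beta>) * ?n" by simp
          also have "\<dots> \<le> y * ?n" using that(2) by (intro mult_right_mono) auto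
          finally show ?thesis .
        qed
        define A where "A i = words V N \<inter> connectors K r (fst i) (snd i)" for i
        have cA: "c * card V ^ N \<le> card (A i)" if "i \<in> I" for i
          using conn[OF K n'(1), of "fst i" "snd i"] that by (auto simp: A_def I_def)
        have Aw: "A i \<subseteq> words V N" for i by (simp add: A_def)
        have small: "2 * real (N * (card P + t * N)) \<le> c * card V"
        proof -
          have "real N * card P \<le> real N * (\<delta> * ?n)" using P(2) by (intro mult_left_mono) auto
          also have "\<dots> = c / 4 * ?n" using N by (simp add: \<delta>_def)
          finally have "real N * card P \<le> c / 4 * ?n" .
          moreover have "real N * (t * real N) \<le> c / 4 * ?n" using scale[of "N * N" "c / 4"] \<beta>'(1) by (simp add: mult_ac)
          ultimately show ?thesis by (simp add: distrib_left)
        qed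
        have "\<exists>\<F>. finite \<F> \<and> card \<F> \<le> t \<and> \<F> \<subseteq> (\<Union>i\<in>I. A i) \<and> (\<forall>f\<in>\<F>. \<forall>g\<in>\<F>. f \<noteq> g \<longrightarrow> set f \<inter> set g = {})
           \<and> (\<forall>f\<in>\<F>. set f \<inter> P = {}) \<and> (\<forall>i\<in>I. c * t / 4 - ln (card I) \<le> card (\<F> \<inter> A i))"
          by (rule greedy_selection[OF V n'(3) I(1) False N Aw cA c finite_subset[OF P(1) V] small])
        then obtain \<F> where \<F>: "finite \<F>" "card \<F> \<le> t" "\<F> \<subseteq> (\<Union>i\<in>I. A i)"
          "\<forall>f\<in>\<F>. \<forall>g\<in>\<F>. f \<noteq> g \<longrightarrow> set f \<inter> set g = {}" "\<forall>f\<in>\<F>. set f \<inter> P = {}"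
          "\<forall>i\<in>I. c * t / 4 - ln (card I) \<le> card (\<F> \<inter> A i)"
          by (elim exE conjE)
        define Z where "Z = \<Union> (set ` \<F>)"
        have fV: "set f \<subseteq> V \<and> length f = N" if f: "f \<in> \<F>" for f
        proof -
          obtain i where "f \<in> A i" using \<F>(3) f by blast
          then show ?thesis using Aw[of i] by (auto simp: words_def)
        qed
        have "Z \<subseteq> V - P" using fV \<F>(5) by (auto simp: Z_def)
        moreover have "card Z \<le> \<beta>0 * ?n"
        proof -
          have "card Z \<le> (\<Sum>f\<in>\<F>. card (set f))" unfolding Z_def by (rule card_UN_le[OF \<F>(1)])
          also have "\<dots> \<le> (\<Sum>f\<in>\<F>. N)"
          proof (rule sum_mono)
            show "card (set f) \<le> N" if "f \<in> \<F>" for f using fV[OF that] card_length[of f] by simp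
          qed
          also have "\<dots> \<le> t * N" using \<F>(2) by simp
          finally have "real (card Z) \<le> real (t * N)" by (rule of_nat_mono)
          then show ?thesis using scale[of N \<beta>0] \<beta>'(2) by (simp add: mult_ac)
        qed
        moreover have "\<exists>z. distinct z \<and> set z \<subseteq> Z - U \<and> length z \<le> N \<and> tight K r (X @ z @ Y)"
          if X: "ordered_clique K r X" and Y: "ordered_clique K r Y" and U: "U \<subseteq> Z" "card U < \<epsilon> * ?n" for X Y U
        proof -
          have i: "(X, Y) \<in> I" using X Y by (simp add: I_def)
          have "real (card I) \<le> ?n ^ D" using I(2) by (metis of_nat_le_iff of_nat_power)
          moreover have "0 < card I" using i I(1) card_gt_0_iff by blast
          ultimately have "ln (card I) \<le> ln (?n ^ D)" by (intro ln_mono) auto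
          also have "\<dots> = D * ln ?n" using n'(3) by (simp add: ln_realpow)
          finally have lnI: "ln (card I) \<le> D * ln ?n" .
          have "real (Suc D) * (1 + ln ?n) = D * ln ?n + real (Suc D) + ln ?n" by (simp add: algebra_simps)
          moreover have "0 \<le> ln ?n" using n'(3) by simp
          ultimately have "D * ln ?n + 1 \<le> \<epsilon> * ?n" using n2[OF n'(2)] by simp
          moreover have "c / 4 * (\<beta> * ?n - 1) \<le> c / 4 * t" using t(2) c by (intro mult_left_mono) auto
          then have "2 * (\<epsilon> * ?n) - c / 4 \<le> c * t / 4" by (simp add: \<epsilon>_def algebra_simps)
          ultimately have many: "\<epsilon> * ?n \<le> card (\<F> \<inter> A (X, Y))" using \<F>(6)[rule_format, OF i] lnI c by linarith
          have fZ: "finite Z" using \<F>(1) by (simp add: Z_def)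
          have fU: "finite U" using finite_subset[OF U(1) fZ] .
          have "\<exists>f\<in>\<F> \<inter> A (X, Y). set f \<inter> U = {}"
          proof (rule ccontr)
            assume no: "\<not> ?thesis"
            \<comment> \<open>Disjoint connectors are hit in different vertices, which injects the
              hit connectors into \<open>U\<close>.\<close>
            define h where "h f = (SOME u. u \<in> set f \<inter> U)" for f
            have h: "h f \<in> set f \<inter> U" if "f \<in> \<F> \<inter> A (X, Y)" for f
            proof -
              have "\<exists>u. u \<in> set f \<inter> U" using no that by blast
              then show ?thesis unfolding h_def by (rule someI_ex)
            qed
            have "inj_on h (\<F> \<inter> A (X, Y))"
            proof (rule inj_onI)
              fix f g assume fg: "f \<in> \<F> \<inter> A (X, Y)" "g \<in> \<F> \<inter> A (X, Y)" "h f = h g"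
              then show "f = g" using h[OF fg(1)] h[OF fg(2)] \<F>(4) by fastforce
            qed
            then have "card (\<F> \<inter> A (X, Y)) \<le> card U" using h fU by (intro card_inj_on_le[of h]) auto
            then show False using many U(2) by linarith
          qed
          then obtain f where f: "f \<in> \<F>" "f \<in> words V N \<inter> connectors K r X Y" "set f \<inter> U = {}" by (auto simp: A_def)
          have "set f \<subseteq> Z" using f(1) by (auto simp: Z_def)
          then show ?thesis using connector_path[OF f(2,3)] by blast
        qed
        ultimately show ?thesis by blast
      qed
    qed
    then show ?thesis using \<epsilon> by blast
  qed
  then show ?thesis using N \<delta> by blast
qed

lemma dense_complex_imp_ext_dense:
  fixes \<gamma> :: real
  assumes K: "dense_complex r \<gamma> V K" and \<gamma>: "0 < \<gamma>" and W: "W \<subseteq> V" "card W \<le> \<gamma> / 2 * card V"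
  shows "ext_dense r (\<gamma> / 2) (V - W) K"
  unfolding ext_dense_def
proof (intro conjI ballI impI)
  note KD = dense_complexD[OF K]
  fix A assume A: "A \<in> K" "A \<subseteq> V - W \<and> 0 < card A \<and> card A < r"
  let ?n = "real (card V)"
  have fW: "finite W" using W(1) KD(1) finite_subset by blast
  have "real (card A) / r \<le> 1" using A(2) by simp
  then have "(1 - card A / r + \<gamma> / 2) * real (card (V - W)) \<le> (1 - card A / r + \<gamma> / 2) * ?n"
    using \<gamma> KD(1) by (intro mult_left_mono of_nat_mono card_mono) auto
  also have "\<dots> = (1 - card A / r + \<gamma>) * ?n - \<gamma> / 2 * ?n" by (simp add: algebra_simps)
  also have "\<dots> \<le> card (ext K A) - real (card W)" using KD(6)[OF A(1)] A(2) W(2) by auto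
  also have "\<dots> \<le> card (ext K A - W)" using diff_card_le_card_Diff[OF fW, of "ext K A"] by linarith
  also have "ext K A - W = ext K A \<inter> (V - W)" using KD(9) by auto
  finally show "(1 - card A / r + \<gamma> / 2) * real (card (V - W)) \<le> card (ext K A \<inter> (V - W))" .
qed (use dense_complexD[OF K] in auto)

theorem tight_hamilton_cycle:
  fixes \<gamma> :: real
  assumes r: "2 \<le> r" and \<gamma>: "0 < \<gamma>" "\<gamma> \<le> 1"
  shows "\<exists>n0. \<forall>(V :: 'a set) K. dense_complex r \<gamma> V K \<longrightarrow> n0 \<le> card V \<longrightarrow>
    (\<exists>xs. distinct xs \<and> set xs = V \<and> tight K r (xs @ take (r - 1) xs))"
proof -
  obtain N \<delta> where N: "0 < N" and \<delta>: "0 < \<delta>" and res: "\<forall>\<beta>0>0. \<exists>\<epsilon> n0. 0 < \<epsilon> \<and> (\<forall>(V :: 'a set) K P. dense_complex r \<gamma> V K \<longrightarrow> n0 \<le> card V \<longrightarrow>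
    P \<subseteq> V \<longrightarrow> card P \<le> \<delta> * real (card V) \<longrightarrow>
    (\<exists>Z. Z \<subseteq> V - P \<and> card Z \<le> \<beta>0 * real (card V) \<and>
      (\<forall>X Y U. ordered_clique K r X \<longrightarrow> ordered_clique K r Y \<longrightarrow> U \<subseteq> Z \<longrightarrow> card U < \<epsilon> * real (card V) \<longrightarrow>
        (\<exists>z. distinct z \<and> set z \<subseteq> Z - U \<and> length z \<le> N \<and> tight K r (X @ z @ Y)))))"
    using reservoir[OF r \<gamma>, where 'a = 'a] by (elim exE conjE)
  define \<beta>1 where "\<beta>1 = min \<delta> (\<gamma> / 4)"
  have \<beta>1: "0 < \<beta>1" using \<delta> \<gamma> by (simp add: \<beta>1_def)
  obtain \<epsilon>1 n1 where \<epsilon>1: "0 < \<epsilon>1" and abs: "\<forall>(V :: 'a set) K. dense_complex r \<gamma> V K \<longrightarrow> n1 \<le> card V \<longrightarrow>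
    (\<exists>bs \<A>. tight K r (concat bs) \<and> distinct (concat bs) \<and> r \<le> Suc (length (concat bs)) \<and> set (concat bs) \<subseteq> V \<and>
      card (set (concat bs)) \<le> \<beta>1 * real (card V) \<and> finite \<A> \<and> \<A> \<subseteq> set bs \<and>
      (\<forall>v\<in>V. \<epsilon>1 * real (card V) \<le> card (\<A> \<inter> absorbers K r v)))"
    using absorbing_blocks[OF r \<gamma> \<beta>1, where 'a = 'a] by (elim exE conjE)
  define \<beta>2 where "\<beta>2 = min (\<epsilon>1 / 2) (\<gamma> / 4)"
  have \<beta>2: "0 < \<beta>2" using \<epsilon>1 \<gamma> by (simp add: \<beta>2_def)
  obtain \<epsilon>2 n2 where \<epsilon>2: "0 < \<epsilon>2" and res2: "\<forall>(V :: 'a set) K P. dense_complex r \<gamma> V K \<longrightarrow> n2 \<le> card V \<longrightarrow>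
    P \<subseteq> V \<longrightarrow> card P \<le> \<delta> * real (card V) \<longrightarrow>
    (\<exists>Z. Z \<subseteq> V - P \<and> card Z \<le> \<beta>2 * real (card V) \<and>
      (\<forall>X Y U. ordered_clique K r X \<longrightarrow> ordered_clique K r Y \<longrightarrow> U \<subseteq> Z \<longrightarrow> card U < \<epsilon>2 * real (card V) \<longrightarrow>
        (\<exists>z. distinct z \<and> set z \<subseteq> Z - U \<and> length z \<le> N \<and> tight K r (X @ z @ Y))))"
    using res[rule_format, OF \<beta>2] by (elim exE conjE)
  \<comment> \<open>Paths of r q vertices are at most n / q in number, so joining them with up to N
    vertices per connection uses fewer than the \<open>\<epsilon>2 * n\<close> vertices that the
    reservoir can spare.\<close>
  define q where "q = Suc (nat \<lceil>2 * N / \<epsilon>2\<rceil>)"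
  have q: "0 < q" "2 * N / \<epsilon>2 \<le> q" unfolding q_def by linarith+
  have g2: "0 < \<gamma> / 2" "\<gamma> / 2 \<le> 1" and e2: "0 < \<epsilon>1 / 2" using \<gamma> \<epsilon>1 by auto
  obtain n3 where cover: "\<And>(V :: 'a set) K. ext_dense r (\<gamma> / 2) V K \<Longrightarrow> n3 \<le> card V \<Longrightarrow>
      \<exists>ps. (\<forall>p\<in>set ps. tight K r p \<and> length p = r * q) \<and> distinct (concat ps) \<and> set (concat ps) \<subseteq> V \<and>
         (1 - \<epsilon>1 / 2) * card V \<le> card (set (concat ps))"
    using almost_path_cover[OF r g2 e2 q(1), where 'a = 'a] by blast
  define n0 where "n0 = Suc (n1 + n2 + 2 * n3 + nat \<lceil>4 * N / \<epsilon>2\<rceil>)"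
  have "\<exists>xs. distinct xs \<and> set xs = V \<and> tight K r (xs @ take (r - 1) xs)"
    if K: "dense_complex r \<gamma> V K" and n: "n0 \<le> card V" for V :: "'a set" and K
  proof -
    let ?n = "real (card V)"
    note KD = dense_complexD[OF K] and V = dense_complexD(1)[OF K]
    have n': "n1 \<le> card V" "n2 \<le> card V" "2 * n3 \<le> card V" "4 * N / \<epsilon>2 < ?n" "0 < card V"
      using n unfolding n0_def by linarith+
    obtain bs \<A> where bs: "tight K r (concat bs)" "distinct (concat bs)" "r \<le> Suc (length (concat bs))" "set (concat bs) \<subseteq> V"
      "card (set (concat bs)) \<le> \<beta>1 * ?n" and \<A>: "finite \<A>" "\<A> \<subseteq> set bs" "\<forall>v\<in>V. \<epsilon>1 * ?n \<le> card (\<A> \<inter> absorbers K r v)"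
      using abs[rule_format, OF K n'(1)] by (elim exE conjE)
    define P where "P = set (concat bs)"
    have "\<beta>1 * ?n \<le> \<delta> * ?n" "\<beta>1 * ?n \<le> \<gamma> / 4 * ?n" by (intro mult_right_mono; simp add: \<beta>1_def)+
    then have cP: "card P \<le> \<delta> * ?n" "card P \<le> \<gamma> / 4 * ?n" using bs(5) by (auto simp: P_def)
    have PV: "P \<subseteq> V" using bs(4) by (simp add: P_def)
    obtain Z where Z: "Z \<subseteq> V - P" "card Z \<le> \<beta>2 * ?n" and conn0: "\<forall>X Y U. ordered_clique K r X \<longrightarrow> ordered_clique K r Y \<longrightarrow> U \<subseteq> Z \<longrightarrow>
       card U < \<epsilon>2 * ?n \<longrightarrow> (\<exists>z. distinct z \<and> set z \<subseteq> Z - U \<and> length z \<le> N \<and> tight K r (X @ z @ Y))"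
      using res2[rule_format, OF K n'(2) PV cP(1)] by (elim exE conjE)
    note conn = conn0[rule_format]
    have "\<beta>2 * ?n \<le> \<epsilon>1 / 2 * ?n" "\<beta>2 * ?n \<le> \<gamma> / 4 * ?n" by (intro mult_right_mono; simp add: \<beta>2_def)+
    then have cZ: "card Z \<le> \<epsilon>1 / 2 * ?n" "card Z \<le> \<gamma> / 4 * ?n" using Z(2) by auto
    have fin: "finite P" "finite Z" using finite_subset[OF PV V] finite_subset[OF subset_trans[OF Z(1) Diff_subset] V] by auto
    define V0 where "V0 = V - (P \<union> Z)"
    have PZ: "P \<union> Z \<subseteq> V" using bs(4) Z(1) by (auto simp: P_def)
    have cPZ: "real (card (P \<union> Z)) \<le> \<gamma> / 2 * ?n"
    proof -
      have "real (card (P \<union> Z)) \<le> real (card P + card Z)" by (intro of_nat_mono card_Un_le)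
      then show ?thesis using cP(2) cZ(2) by simp
    qed
    have ED: "ext_dense r (\<gamma> / 2) V0 K"
      unfolding V0_def by (rule dense_complex_imp_ext_dense[OF K \<gamma>(1) PZ cPZ])
    have cV0: "card V0 + card (P \<union> Z) = card V"
      unfolding V0_def using PZ V fin card_mono[OF V PZ] by (simp add: card_Diff_subset)
    have "\<gamma> / 2 * ?n \<le> 1 / 2 * ?n" using \<gamma> by (intro mult_right_mono) auto
    then have "card V \<le> 2 * card V0" using cPZ cV0 by linarith
    then have "n3 \<le> card V0" using n'(3) by linarith
    from cover[OF ED this] obtain ps where ps: "\<And>p. p \<in> set ps \<Longrightarrow> tight K r p \<and> length p = r * q" "distinct (concat ps)"
      "set (concat ps) \<subseteq> V0" "(1 - \<epsilon>1 / 2) * card V0 \<le> card (set (concat ps))" by blast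
    have lps: "(length ps + 1) * N < \<epsilon>2 * ?n"
    proof -
      have "map length ps = replicate (length ps) (r * q)" using ps(1) by (simp add: list_eq_iff_nth_eq)
      then have "length (concat ps) = length ps * (r * q)" by (simp add: length_concat sum_list_replicate)
      moreover have "card (set (concat ps)) = length (concat ps)" using ps(2) by (rule distinct_card)
      moreover have "card (set (concat ps)) \<le> card V" using ps(3) V by (intro card_mono) (auto simp: V0_def)
      moreover have "length ps * q \<le> length ps * (r * q)" using r by simp
      ultimately have "length ps * q \<le> card V" by linarith
      then have "real (length ps * q) \<le> ?n" by (rule of_nat_mono)
      moreover have "length ps * (2 * N / \<epsilon>2) \<le> length ps * real q" using q(2) by (intro mult_left_mono) auto
      ultimately have "length ps * (2 * N / \<epsilon>2) \<le> ?n" by simp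
      then have "2 * (length ps * real N) \<le> \<epsilon>2 * ?n" using \<epsilon>2 by (simp add: field_simps)
      moreover have "4 * real N < \<epsilon>2 * ?n" using n'(4) \<epsilon>2 by (simp add: field_simps)
      moreover have "0 < \<epsilon>2 * ?n" using \<epsilon>2 n'(5) by simp
      ultimately show ?thesis by (simp add: algebra_simps)
    qed
    have qs_len: "r \<le> Suc (length p)" if "p \<in> set ps" for p
      using ps(1)[OF that] q(1) by (simp add: trans_le_add1 le_SucI)
    have "\<exists>cs. tight K r (concat cs) \<and> distinct (concat cs) \<and> set (concat bs # ps) \<subseteq> set cs \<and> r \<le> Suc (length (concat cs)) \<and>
       set (concat cs) \<subseteq> set (concat (concat bs # ps)) \<union> Z \<and> card (set (concat cs) \<inter> Z) \<le> (length (concat bs # ps) - 1) * N"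
    proof (rule join_paths[where t = "length ps + 1"])
      fix X Y U assume XY: "ordered_clique K r X" "ordered_clique K r Y" and U: "U \<subseteq> Z" "card U \<le> (length ps + 1) * N"
      have "real (card U) \<le> real ((length ps + 1) * N)" using U(2) by (rule of_nat_mono)
      then have "card U < \<epsilon>2 * ?n" using lps by linarith
      then show "\<exists>z. distinct z \<and> set z \<subseteq> Z - U \<and> length z \<le> N \<and> tight K r (X @ z @ Y)" by (rule conn[OF XY U(1)])
    next
      show "distinct (concat (concat bs # ps))" using bs(2) ps(2,3) by (auto simp: V0_def P_def)
      show "set (concat (concat bs # ps)) \<inter> Z = {}" using Z(1) ps(3) by (auto simp: V0_def P_def)
    qed (use r bs(1,3) ps(1) qs_len in auto)
    then obtain cs where cs: "tight K r (concat cs)" "distinct (concat cs)" "set (concat bs # ps) \<subseteq> set cs" "r \<le> Suc (length (concat cs))"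
       "set (concat cs) \<subseteq> set (concat (concat bs # ps)) \<union> Z" "card (set (concat cs) \<inter> Z) \<le> length ps * N"
      by auto
    obtain c1 c2 where "cs = c1 @ concat bs # c2" using cs(3) by (auto dest: split_list)
    \<comment> \<open>The absorbing path was joined as one block; it is split into its own blocks
      again, so that its absorbers are accessible.\<close>
    define ds where "ds = c1 @ bs @ c2"
    have ds: "concat ds = concat cs" "set bs \<subseteq> set ds" using \<open>cs = _\<close> by (auto simp: ds_def)
    let ?Y = "take (r - 1) (concat cs)"
    have "real (card (set (concat cs) \<inter> Z)) \<le> real (length ps * N)" using cs(6) by (rule of_nat_mono)
    then have "card (set (concat cs) \<inter> Z) < \<epsilon>2 * ?n" using lps by (simp add: distrib_right)
    then obtain z where z: "distinct z" "set z \<subseteq> Z - (set (concat cs) \<inter> Z)"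
        "tight K r (drop (Suc (length (concat cs)) - r) (concat cs) @ z @ ?Y)"
      using conn[OF ordered_clique_ends(2)[OF cs(1,4)] ordered_clique_ends(1)[OF cs(1,4)], of "set (concat cs) \<inter> Z"] r by auto
    have tY: "tight K r ?Y" using cs(1) by (rule tight_take)
    have lY: "length ?Y = r - 1" using cs(4) by simp
    have "tight K r (concat cs @ z @ ?Y)"
      using tight_join[OF cs(1) tY cs(4)] lY z(3) r by simp
    then have t1: "tight K r (concat (ds @ [z]) @ ?Y)" using ds(1) by simp
    have t2: "take (r - 1) (concat (ds @ [z])) = ?Y" using ds(1) cs(4) by simp
    have t3: "distinct (concat (ds @ [z]))" using ds(1) cs(2) z(1,2) by auto
    have csV: "set (concat cs) \<subseteq> V" 
    proof -
      have "set (concat (concat bs # ps)) = P \<union> set (concat ps)" by (simp add: P_def)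
      then show ?thesis using cs(5) PV ps(3) Z(1) unfolding V0_def by blast
    qed
    define W where "W = V - set (concat (ds @ [z]))"
    have "W \<subseteq> (V0 - set (concat ps)) \<union> Z"
    proof
      fix v assume v: "v \<in> W"
      have "concat bs \<in> set cs" "set ps \<subseteq> set cs" using cs(3) by simp_all
      then have "set (concat ps) \<subseteq> set (concat cs)" "P \<subseteq> set (concat cs)"
        unfolding P_def set_concat[of cs] set_concat[of ps] by blast+
      then show "v \<in> (V0 - set (concat ps)) \<union> Z" using v ds(1) by (auto simp: W_def V0_def)
    qed
    then have "card W \<le> card (V0 - set (concat ps)) + card Z"
      using card_mono[of "(V0 - set (concat ps)) \<union> Z" W] card_Un_le[of "V0 - set (concat ps)" Z] fin V by (auto simp: V0_def intro: order_trans)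
    moreover have "card (V0 - set (concat ps)) + card (set (concat ps)) = card V0"
      using ps(3) V card_mono[OF _ ps(3)] by (simp add: card_Diff_subset V0_def)
    ultimately have "real (card W) \<le> card V0 - real (card (set (concat ps))) + card Z" by linarith
    also have "\<dots> \<le> \<epsilon>1 / 2 * card V0 + card Z" using ps(4) by (simp add: algebra_simps)
    also have "\<dots> \<le> \<epsilon>1 / 2 * ?n + \<epsilon>1 / 2 * ?n"
      using cV0 cZ(1) \<epsilon>1 by (intro add_mono mult_left_mono) auto
    finally have cW: "real (card W) \<le> \<epsilon>1 * ?n" by simp
    have "\<exists>xs. tight K r (xs @ ?Y) \<and> take (r - 1) xs = ?Y \<and> distinct xs \<and> set xs = set (concat (ds @ [z])) \<union> W"
    proof (rule absorb_all[OF _ t1 t2 t3 _ \<A>(1)])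
      show "finite W" using V by (simp add: W_def)
      show "card W \<le> card (\<A> \<inter> absorbers K r w)" if "w \<in> W" for w
        using \<A>(3) that cW by (auto simp: W_def dest!: bspec[of V _ w])
    qed (use \<A>(2) ds(2) r in \<open>auto simp: W_def\<close>)
    then obtain xs where xs: "tight K r (xs @ take (r - 1) xs)" "distinct xs" "set xs = set (concat (ds @ [z])) \<union> W" by metis
    have "set (concat (ds @ [z])) \<subseteq> V" using csV ds(1) z(2) Z(1) by auto
    then have "set xs = V" using xs(3) by (auto simp: W_def)
    then show ?thesis using xs by blast
  qed
  then show ?thesis by blast
qed

section \<open>Hypergraphs\<close>

text \<open>Sets of fewer than k vertices belong vacuously, so the complex contains the empty set
  and (as k is at least 2) all single vertices.\<close>

definition cliques :: "nat \<Rightarrow> 'a hypergraph \<Rightarrow> 'a set set" where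
  "cliques k H = {A. A \<subseteq> verts H \<and> (\<forall>e. e \<subseteq> A \<and> card e = k \<longrightarrow> e \<in> edges H)}"

lemma min_codegree_le:
  assumes H: "k_graph k H" and S: "S \<subseteq> verts H" "card S = k - 1"
  shows "min_codegree k H \<le> card {e \<in> edges H. S \<subseteq> e}"
proof -
  let ?P = "\<lambda>m. \<forall>S. S \<subseteq> verts H \<and> card S = k - 1 \<longrightarrow> m \<le> card {e \<in> edges H. S \<subseteq> e}"
  have "?P (GREATEST m. ?P m)"
  \<comment> \<open>The value 0 satisfies the condition and \<open>S\<close> bounds every value that
    does, so the greatest one exists.\<close>
  proof (rule GreatestI_nat[of ?P 0])
    show "m \<le> card {e \<in> edges H. S \<subseteq> e}" if "?P m" for m using that S by blast
  qed simp
  then show ?thesis using S unfolding min_codegree_def by blast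
qed

text \<open>The vertices of \<open>S\<close> are included, so that a vertex of \<open>H\<close>
  outside this set is new and forms an edge with \<open>S\<close>.\<close>

definition nonneighbours :: "'a hypergraph \<Rightarrow> 'a set \<Rightarrow> 'a set" where
  "nonneighbours H S = {v \<in> verts H. v \<in> S \<or> insert v S \<notin> edges H}"

lemma card_nonneighbours:
  assumes H: "k_graph k H" and k: "0 < k" and S: "S \<subseteq> verts H" "card S = k - 1"
  shows "card (nonneighbours H S) + min_codegree k H \<le> card (verts H)"
proof -
  let ?N = "{v \<in> verts H. v \<notin> S \<and> insert v S \<in> edges H}"
  have V: "finite (verts H)" using H by (simp add: k_graph_def)
  have "{e \<in> edges H. S \<subseteq> e} \<subseteq> (\<lambda>v. insert v S) ` ?N"
  proof
    fix e assume e: "e \<in> {e \<in> edges H. S \<subseteq> e}"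
    then have "e \<subseteq> verts H" "card e = k" using H by (auto simp: k_graph_def)
    moreover have "finite S" using S V finite_subset by blast
    ultimately have "card (e - S) = 1" using e S k by (simp add: card_Diff_subset)
    then obtain v where v: "e - S = {v}" using card_1_singletonE by blast
    then have "e = insert v S" "v \<notin> S" using e by auto
    then show "e \<in> (\<lambda>v. insert v S) ` ?N" using e \<open>e \<subseteq> verts H\<close> by auto
  qed
  then have "card {e \<in> edges H. S \<subseteq> e} \<le> card ((\<lambda>v. insert v S) ` ?N)" using V by (intro card_mono) auto
  also have "\<dots> \<le> card ?N" using V by (intro card_image_le) auto
  finally have "card {e \<in> edges H. S \<subseteq> e} \<le> card ?N" .
  then have "min_codegree k H \<le> card ?N" using min_codegree_le[OF H S] by linarith
  moreover have "verts H = nonneighbours H S \<union> ?N" by (auto simp: nonneighbours_def)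
  then have "card (verts H) = card (nonneighbours H S) + card ?N"
    using V by (subst card_Un_disjoint[symmetric]) (auto simp: nonneighbours_def)
  ultimately show ?thesis by linarith
qed

lemma card_common_neighbours:
  assumes H: "k_graph k H" and k: "0 < k" and \<S>: "finite \<S>" "\<And>S. S \<in> \<S> \<Longrightarrow> S \<subseteq> verts H \<and> card S = k - 1" "card \<S> \<le> t"
    and R: "finite R" "card R \<le> r" and E: "\<And>v. v \<in> verts H \<Longrightarrow> v \<notin> R \<Longrightarrow> (\<And>S. S \<in> \<S> \<Longrightarrow> v \<notin> nonneighbours H S) \<Longrightarrow> v \<in> E"
    and E': "E \<subseteq> verts H"
  shows "card (verts H) \<le> card E + t * (card (verts H) - min_codegree k H) + r"
proof -
  have V: "finite (verts H)" using H by (simp add: k_graph_def)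
  let ?B = "\<Union>S\<in>\<S>. nonneighbours H S"
  have fB: "finite ?B" using \<S>(1) V by (auto simp: nonneighbours_def)
  have "card ?B \<le> (\<Sum>S\<in>\<S>. card (nonneighbours H S))" by (rule card_UN_le[OF \<S>(1)])
  also have "\<dots> \<le> (\<Sum>S\<in>\<S>. card (verts H) - min_codegree k H)"
  proof (rule sum_mono)
    show "card (nonneighbours H S) \<le> card (verts H) - min_codegree k H" if "S \<in> \<S>" for S
      using card_nonneighbours[OF H k] \<S>(2)[OF that] by (meson le_diff_conv2 add_leD2)
  qed
  also have "\<dots> \<le> t * (card (verts H) - min_codegree k H)" using \<S>(3) by simp
  finally have B: "card ?B \<le> t * (card (verts H) - min_codegree k H)" .
  have "verts H \<subseteq> E \<union> (?B \<union> R)" using E by auto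
  then have "card (verts H) \<le> card (E \<union> (?B \<union> R))"
    using fB R(1) finite_subset[OF E' V] by (intro card_mono) auto
  also have "\<dots> \<le> card E + (card ?B + card R)" using card_Un_le[of E "?B \<union> R"] card_Un_le[of ?B R] by linarith
  finally show ?thesis using B R(2) by linarith
qed

lemma insert_in_cliques:
  assumes A: "A \<in> cliques k H" and v: "v \<in> verts H" and k: "0 < k"
    and nb: "\<And>S. S \<subseteq> A \<Longrightarrow> card S = k - 1 \<Longrightarrow> v \<notin> nonneighbours H S"
  shows "insert v A \<in> cliques k H"
  unfolding cliques_def
proof (intro CollectI conjI allI impI)
  show "insert v A \<subseteq> verts H" using A v by (auto simp: cliques_def)
  fix e assume e: "e \<subseteq> insert v A \<and> card e = k"
  show "e \<in> edges H"
  proof (cases "v \<in> e")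
    case True
    have "card (e - {v}) = k - 1" using e True by (simp add: card_Diff_singleton)
    moreover have "e - {v} \<subseteq> A" using e by auto
    ultimately have "v \<notin> nonneighbours H (e - {v})" using nb by blast
    then show ?thesis using v True by (auto simp: nonneighbours_def insert_absorb)
  qed (use A e in \<open>auto simp: cliques_def\<close>)
qed

text \<open>Multiplied by k - 1, binom(j, k-1) becomes j binom(j-1, k-2), which is at most j
  binom(r-2, k-2), and the bracket on the right becomes (r + k - 2) binom(r-2, k-2). It remains to
  use r \<le> r + k - 2.\<close>

lemma choose_ratio:
  assumes k: "2 \<le> k" "k \<le> r" and j: "0 < j" "j < r"
  shows "r * (j choose (k - 1)) \<le> j * (((r - 1) choose (k - 1)) + ((r - 2) choose (k - 2)))"
proof -
  obtain k' where k': "k = Suc (Suc k')" using k by (metis Suc_le_D add_2_eq_Suc le_Suc_ex)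
  obtain r' where r': "r = Suc (Suc r')" using k by (metis Suc_le_D add_2_eq_Suc le_Suc_ex le_trans)
  obtain j' where j': "j = Suc j'" using j by (cases j) auto
  let ?c = "r' choose k'"
  have absorb: "Suc k' * (Suc n choose Suc k') = Suc n * (n choose k')" for n by (metis Suc_times_binomial_eq mult.commute)
  have mono: "j' choose k' \<le> ?c" using j r' j' by (intro binomial_right_mono) auto
  have "Suc k' * (r * (j choose Suc k')) = r * (j * (j' choose k'))"
    using absorb[of j'] j' by (metis mult.left_commute)
  also have "\<dots> \<le> r * (j * ?c)" using mono by simp
  also have "\<dots> \<le> j * ((Suc r' + Suc k') * ?c)"
  proof -
    have "r \<le> Suc r' + Suc k'" using r' by simp
    then have "r * ?c \<le> (Suc r' + Suc k') * ?c" by (rule mult_le_mono1)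
    then have "j * (r * ?c) \<le> j * ((Suc r' + Suc k') * ?c)" by (rule mult_le_mono2)
    then show ?thesis by (simp only: mult.left_commute)
  qed
  also have "\<dots> = Suc k' * (j * ((Suc r' choose Suc k') + ?c))"
  proof -
    have "j * ((R + K) * c) = K * (j * (X + c))" if "K * X = R * c" for R K X c :: nat
    proof -
      have "j * ((R + K) * c) = j * (R * c) + j * K * c" by (simp add: algebra_simps)
      also have "\<dots> = K * (j * (X + c))" unfolding that[symmetric] by (simp add: algebra_simps)
      finally show ?thesis .
    qed
    then show ?thesis using absorb by blast
  qed
  finally have "r * (j choose Suc k') \<le> j * ((Suc r' choose Suc k') + ?c)" by (simp only: Suc_mult_le_cancel1)
  then show ?thesis by (simp add: k' r')
qed

text \<open>A vertex extends a clique if it avoids, for each (k-1)-subset, the at most (1 / t -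
  \<alpha>) n nonneighbours. The number of these subsets decides both bounds; the additive r
  accounts for the vertices of the cliques themselves.\<close>

lemma cliques_dense_complex:
  fixes \<alpha> :: real
  assumes k: "2 \<le> k" "k \<le> r" and \<alpha>: "0 < \<alpha>" and H: "k_graph k H"
    and t: "t = ((r - 1) choose (k - 1)) + ((r - 2) choose (k - 2))"
    and deg: "(1 - 1 / real t + \<alpha>) * card (verts H) \<le> min_codegree k H"
    and \<gamma>: "\<gamma> \<le> \<alpha> / 2" "\<gamma> \<le> 1 / (2 * r)" and n: "2 * real r / \<alpha> \<le> card (verts H)" "2 * real r * r \<le> card (verts H)"
  shows "dense_complex r \<gamma> (verts H) (cliques k H)"
proof -
  let ?n = "real (card (verts H))" and ?K = "cliques k H"
  have V: "finite (verts H)" using H by (simp add: k_graph_def)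
  have kpos: "0 < k" using k by simp
  have r: "2 \<le> r" using k by simp
  define s where "s = card (verts H) - min_codegree k H"
  have "0 < (r - 1) choose (k - 1)" using k by (simp add: zero_less_binomial_iff)
  then have tpos: "0 < t" by (simp add: t)
  have "2 * real r * 1 \<le> 2 * real r * r" using r by (intro mult_left_mono) auto
  then have "real r \<le> ?n" using n(2) by linarith
  then have "k - 1 \<le> card (verts H)" using k by linarith
  then obtain S0 where "S0 \<subseteq> verts H" "card S0 = k - 1" using obtain_subset_with_card_n by metis
  then have "min_codegree k H \<le> card (verts H)" using card_nonneighbours[OF H kpos] by (meson add_leD2)
  then have "real s = ?n - min_codegree k H" by (simp add: s_def of_nat_diff)
  then have "real s \<le> (1 / t - \<alpha>) * ?n" using deg by (simp add: algebra_simps)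
  then have ts: "real t * s \<le> t * ((1 / t - \<alpha>) * ?n)" by (intro mult_left_mono) auto
  have an: "real r \<le> \<alpha> / 2 * ?n" using n(1) \<alpha> by (simp add: field_simps)
  have down: "down ?K" unfolding down_def cliques_def by blast
  have sets: "finite {S. S \<subseteq> A \<and> card S = k - 1}" "card {S. S \<subseteq> A \<and> card S = k - 1} = card A choose (k - 1)"
    if "A \<in> ?K" for A
  proof -
    have "finite A" using that V finite_subset by (auto simp: cliques_def)
    then show "finite {S. S \<subseteq> A \<and> card S = k - 1}" "card {S. S \<subseteq> A \<and> card S = k - 1} = card A choose (k - 1)"
      by (auto simp: n_subsets)
  qed
  have finK: "finite A" "A \<subseteq> verts H" if "A \<in> ?K" for A using that V finite_subset by (auto simp: cliques_def)
  have extV: "ext ?K A \<subseteq> verts H" for A by (auto simp: ext_def cliques_def)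
  have single: "(1 - card A / r + \<gamma>) * ?n \<le> card (ext ?K A)" if A: "A \<in> ?K" "0 < card A" "card A < r" for A
  proof -
    let ?j = "card A"
    have "card (verts H) \<le> card (ext ?K A) + (?j choose (k - 1)) * (card (verts H) - min_codegree k H) + r"
    proof (rule card_common_neighbours[OF H kpos sets(1)[OF A(1)]])
      show "v \<in> ext ?K A" if v: "v \<in> verts H" "v \<notin> A" "\<And>S. S \<in> {S. S \<subseteq> A \<and> card S = k - 1} \<Longrightarrow> v \<notin> nonneighbours H S" for v
        using insert_in_cliques[OF A(1) v(1) kpos] v(2,3) by (auto simp: ext_def)
    qed (use finK[OF A(1)] sets(2)[OF A(1)] A(3) extV in auto)
    then have "real (card (verts H)) \<le> real (card (ext ?K A) + (?j choose (k - 1)) * s + r)" unfolding s_def by (rule of_nat_mono)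
    then have e: "?n \<le> card (ext ?K A) + real (?j choose (k - 1)) * s + r" by simp
    have "real (r * (?j choose (k - 1))) \<le> real (?j * t)" unfolding t by (intro of_nat_mono choose_ratio k A)
    then have ratio: "real (?j choose (k - 1)) \<le> ?j / r * t" using r by (simp add: field_simps)
    show ?thesis
    proof (cases "?j choose (k - 1) = 0")
      \<comment> \<open>A clique with fewer than k - 1 vertices has nothing to exclude, hence no
        surplus from \<alpha>. The surplus comes from 1 / r \<le> j / r, which is the reason for
        \<gamma> \<le> 1 / (2 r).\<close>
      case True
      have "?n - r \<le> card (ext ?K A)" using e unfolding True by simp
      moreover have "1 / r \<le> ?j / r" using A(2) by (intro divide_right_mono) auto
      then have "1 - ?j / r + \<gamma> \<le> 1 - 1 / (2 * r)" using \<gamma>(2) by simp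
      then have "(1 - ?j / r + \<gamma>) * ?n \<le> (1 - 1 / (2 * r)) * ?n" by (intro mult_right_mono) auto
      moreover have "real r \<le> 1 / (2 * r) * ?n" using n(2) r by (simp add: field_simps)
      ultimately show ?thesis by (simp add: left_diff_distrib)
    next
      case False
      then have "1 \<le> ?j choose (k - 1)" by linarith
      then have c1: "1 \<le> real (?j choose (k - 1))" using of_nat_mono[of 1 "?j choose (k - 1)", where 'a = real] by simp
      have "real (?j choose (k - 1)) * s \<le> real (?j choose (k - 1)) * ((1 / t - \<alpha>) * ?n)"
        using \<open>real s \<le> (1 / t - \<alpha>) * ?n\<close> by (intro mult_left_mono) auto
      also have "\<dots> = real (?j choose (k - 1)) * (1 / t) * ?n - real (?j choose (k - 1)) * (\<alpha> * ?n)" by (simp add: algebra_simps)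
      also have "\<dots> \<le> ?j / r * ?n - 1 * (\<alpha> * ?n)"
      proof -
        have "real (?j choose (k - 1)) * (1 / t) \<le> ?j / r * t * (1 / t)" using ratio by (intro mult_right_mono) auto
        then have "real (?j choose (k - 1)) * (1 / t) \<le> ?j / r" using tpos by simp
        then have "real (?j choose (k - 1)) * (1 / t) * ?n \<le> ?j / r * ?n" by (intro mult_right_mono) auto
        moreover have "1 * (\<alpha> * ?n) \<le> real (?j choose (k - 1)) * (\<alpha> * ?n)" using c1 \<alpha> by (intro mult_right_mono) auto
        ultimately show ?thesis by linarith
      qed
      finally have "?n \<le> card (ext ?K A) + (?j / r * ?n - \<alpha> * ?n) + r" using e by linarith
      moreover have "\<gamma> * ?n \<le> \<alpha> / 2 * ?n" using \<gamma>(1) by (intro mult_right_mono) auto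
      moreover have "(1 - ?j / r + \<gamma>) * ?n = ?n - ?j / r * ?n + \<gamma> * ?n" by (simp add: algebra_simps)
      ultimately show ?thesis using an by linarith
    qed
  qed
  have common: "\<gamma> * ?n \<le> card (ext ?K (insert a C) \<inter> ext ?K (insert b C))"
    if C: "a \<notin> C" "b \<notin> C" "insert a C \<in> ?K" "insert b C \<in> ?K" "Suc (card C) < r" for a b C
  proof -
    have fC: "finite C" using finK(1)[OF C(3)] by simp
    \<comment> \<open>The (k-1)-subsets of C + a, and those of C + b that contain b; the other
      subsets of C + b lie in C and are already among the former. The two binomials in
      \<open>t\<close> bound these two families.\<close>
    let ?A = "{S. S \<subseteq> insert a C \<and> card S = k - 1}" and ?B = "insert b ` {S. S \<subseteq> C \<and> card S = k - 2}"
    have cA: "finite ?A" "card ?A = Suc (card C) choose (k - 1)" using sets[OF C(3)] C(1) fC by auto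
    have cB: "finite ?B" "card ?B \<le> card C choose (k - 2)"
      using fC card_image_le[of "{S. S \<subseteq> C \<and> card S = k - 2}" "insert b"] by (auto simp: n_subsets)
    have "Suc (card C) choose (k - 1) \<le> (r - 1) choose (k - 1)" "card C choose (k - 2) \<le> (r - 2) choose (k - 2)"
      using C(5) by (intro binomial_right_mono; simp)+
    then have cAB: "card (?A \<union> ?B) \<le> t" using cA(2) cB(2) card_Un_le[of ?A ?B] unfolding t by linarith
    have "card (verts H) \<le> card (ext ?K (insert a C) \<inter> ext ?K (insert b C)) + t * (card (verts H) - min_codegree k H) + r"
    proof (rule card_common_neighbours[OF H kpos _ _ cAB, where R = "insert a (insert b C)"])
      show "finite (?A \<union> ?B)" using cA cB by simp
      show "S \<subseteq> verts H \<and> card S = k - 1" if "S \<in> ?A \<union> ?B" for S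
        using that finK(2)[OF C(3)] finK(2)[OF C(4)] C(2) k(1) finite_subset[OF _ fC] by (auto simp: card_insert_if)
      show "finite (insert a (insert b C))" using fC by simp
      show "card (insert a (insert b C)) \<le> r"
        using C(5) card_insert_le_m1[of "r - 1" C b] card_insert_le_m1[of r "insert b C" a] by simp
      show "v \<in> ext ?K (insert a C) \<inter> ext ?K (insert b C)"
        if v: "v \<in> verts H" "v \<notin> insert a (insert b C)" "\<And>S. S \<in> ?A \<union> ?B \<Longrightarrow> v \<notin> nonneighbours H S" for v
      proof -
        have "insert v (insert a C) \<in> ?K" using v(3) by (intro insert_in_cliques[OF C(3) v(1) kpos]) auto
        moreover have "insert v (insert b C) \<in> ?K"
        proof (intro insert_in_cliques[OF C(4) v(1) kpos])
          fix S assume S: "S \<subseteq> insert b C" "card S = k - 1"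
          show "v \<notin> nonneighbours H S"
          proof (cases "b \<in> S")
            case True
            then have "S = insert b (S - {b})" "S - {b} \<subseteq> C" "card (S - {b}) = k - 2" using S k(1) by (auto simp: card_Diff_singleton)
            then have "S \<in> ?B" by blast
            then show ?thesis using v(3) by blast
          next
            case False
            then show ?thesis using S by (intro v(3)) auto
          qed
        qed
        ultimately show ?thesis using v(2) by (simp add: ext_def)
      qed
    qed (use extV in auto)
    then have "real (card (verts H)) \<le> real (card (ext ?K (insert a C) \<inter> ext ?K (insert b C)) + t * s + r)"
      unfolding s_def by (rule of_nat_mono)
    then have "?n \<le> card (ext ?K (insert a C) \<inter> ext ?K (insert b C)) + real t * s + r" by simp
    moreover have "t * ((1 / t - \<alpha>) * ?n) = ?n - t * (\<alpha> * ?n)" using tpos by (simp add: field_simps)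
    moreover have "1 * (\<alpha> * ?n) \<le> t * (\<alpha> * ?n)" using tpos \<alpha> by (intro mult_right_mono) auto
    moreover have "\<gamma> * ?n \<le> \<alpha> / 2 * ?n" using \<gamma>(1) by (intro mult_right_mono) auto
    ultimately show ?thesis using ts an by linarith
  qed
  have small: "A \<in> ?K" if "A \<subseteq> verts H" "card A < 2" for A
  proof -
    have "e \<in> edges H" if "e \<subseteq> A" "card e = k" for e
      using card_mono[OF finite_subset[OF \<open>A \<subseteq> verts H\<close> V] that(1)] that(2) \<open>card A < 2\<close> k(1) by linarith
    then show ?thesis using that by (simp add: cliques_def)
  qed
  have "\<Union> ?K \<subseteq> verts H" by (auto simp: cliques_def)
  moreover have "{} \<in> ?K" "\<forall>v\<in>verts H. {v} \<in> ?K" using small by simp_all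
  ultimately show ?thesis unfolding dense_complex_def using V down single common by simp
qed

text \<open>The cycle power uses intervals of k + (r - k + 1) - 1 = r vertices. Appending the first
  r - 1 vertices to the list makes each cyclic interval of length r, also one across the end, a
  contiguous window.\<close>

lemma contains_copy_cycle_power:
  assumes k: "1 \<le> k" "k \<le> r" and n: "r \<le> n" and xs: "distinct xs" "set xs = verts H" "length xs = n"
    and t: "tight (cliques k H) r (xs @ take (r - 1) xs)"
  shows "contains_copy H (cycle_power (r - k + 1) k n)"
  unfolding contains_copy_def
proof (intro exI[of _ "nth xs"] conjI ballI)
  show inj: "inj_on (nth xs) (verts (cycle_power (r - k + 1) k n))"
    using xs by (intro inj_on_nth) (auto simp: cycle_power_def)
  show "nth xs ` verts (cycle_power (r - k + 1) k n) \<subseteq> verts H"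
  proof (rule image_subsetI)
    fix i assume "i \<in> verts (cycle_power (r - k + 1) k n)"
    then have "i < length xs" using xs(3) by (simp add: cycle_power_def)
    then show "xs ! i \<in> verts H" using nth_mem xs(2) by blast
  qed
  fix e assume e': "e \<in> edges (cycle_power (r - k + 1) k n)"
  have "k + (r - k + 1) - 1 = r" using k by simp
  then have "card e = k \<and> (\<exists>i<n. e \<subseteq> cyclic_interval n i r)" using e' by (simp add: cycle_power_def)
  then obtain i where i: "i < n" and e: "card e = k" "e \<subseteq> cyclic_interval n i r" by blast
  define L where "L = xs @ take (r - 1) xs"
  define ys where "ys = take r (drop i L)"
  have "sublist ys L" unfolding ys_def using sublist_order.order_trans[OF sublist_take sublist_drop] by blast
  moreover have "length ys \<le> r" by (simp add: ys_def)
  ultimately have K: "set ys \<in> cliques k H" using t unfolding tight_def L_def[symmetric] by blast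
  have lenL: "length L = n + (r - 1)" using xs(3) n by (simp add: L_def)
  have nth_ys: "xs ! ((i + s) mod n) \<in> set ys" if s: "s < r" for s
  proof -
    have len: "i + s < length L" using s i lenL by linarith
    have "xs ! ((i + s) mod n) = L ! (i + s)"
    proof (cases "i + s < n")
      case True
      then show ?thesis using xs(3) by (simp add: nth_append L_def)
    next
      case False
      then have "(i + s) mod n = i + s - n" using i s n by (simp add: le_mod_geq)
      moreover have "i + s - n < r - 1" using False i s by linarith
      ultimately show ?thesis using False xs(3) by (simp add: nth_append L_def)
    qed
    also have "\<dots> = ys ! s" using s len by (simp add: ys_def)
    also have "ys ! s \<in> set ys" using s len by (intro nth_mem) (simp add: ys_def)
    finally show ?thesis .
  qed
  then have "nth xs ` e \<subseteq> set ys" using e(2) by (auto simp: cyclic_interval_def)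
  moreover have "card (nth xs ` e) = k"
  proof -
    have "e \<subseteq> {..<n}" using e(2) i by (auto simp: cyclic_interval_def)
    then have "inj_on (nth xs) e" using xs by (intro inj_on_nth) auto
    then show ?thesis using e(1) by (simp add: card_image)
  qed
  ultimately show "nth xs ` e \<in> edges H" using K unfolding cliques_def by blast
qed

theorem theorem1p1:
  fixes r k :: nat and \<alpha> :: real
  assumes "2 \<le> k" and "k \<le> r" and "\<alpha> > 0"
  shows "\<exists>n\<^sub>0::nat. \<forall>n\<ge>n\<^sub>0. \<forall>H :: 'a hypergraph.
           k_graph k H \<and> card (verts H) = n \<and>
           real (min_codegree k H)
             \<ge> (1 - 1 / (real ((r - 1) choose (k - 1)) + real ((r - 2) choose (k - 2))) + \<alpha>) * real n
           \<longrightarrow> contains_copy H (cycle_power (r - k + 1) k n)"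
proof -
  \<comment> \<open>The first two bounds make the cliques of \<open>H\<close> a dense complex;
    \<gamma> \<le> 1 is what the Hamilton cycle theorem asks for.\<close>
  define \<gamma> where "\<gamma> = min (min (\<alpha> / 2) (1 / (2 * r))) 1"
  have r: "2 \<le> r" using assms by simp
  have \<gamma>: "0 < \<gamma>" "\<gamma> \<le> 1" "\<gamma> \<le> \<alpha> / 2" "\<gamma> \<le> 1 / (2 * r)" using assms r by (auto simp: \<gamma>_def)
  obtain n1 where n1: "\<forall>(V :: 'a set) K. dense_complex r \<gamma> V K \<longrightarrow> n1 \<le> card V \<longrightarrow>
      (\<exists>xs. distinct xs \<and> set xs = V \<and> tight K r (xs @ take (r - 1) xs))"
    using tight_hamilton_cycle[OF r \<gamma>(1,2), where 'a = 'a] by (elim exE)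
  define n0 where "n0 = n1 + r + nat \<lceil>2 * real r / \<alpha>\<rceil> + nat \<lceil>2 * real r * r\<rceil>"
  show ?thesis
  proof (intro exI[of _ n0] allI impI)
    fix n and H :: "'a hypergraph"
    assume n: "n0 \<le> n" and H: "k_graph k H \<and> card (verts H) = n \<and> real (min_codegree k H)
             \<ge> (1 - 1 / (real ((r - 1) choose (k - 1)) + real ((r - 2) choose (k - 2))) + \<alpha>) * real n"
    have n': "n1 \<le> n" "r \<le> n" "2 * real r / \<alpha> \<le> n" "2 * real r * r \<le> n" using n unfolding n0_def by linarith+
    have "dense_complex r \<gamma> (verts H) (cliques k H)"
      using H n' \<gamma>(3,4) by (intro cliques_dense_complex[OF assms(1,2,3) _ refl]) auto
    then obtain xs where xs: "distinct xs" "set xs = verts H" "tight (cliques k H) r (xs @ take (r - 1) xs)"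
      using n1 n'(1) H by blast
    have "length xs = n" using xs(1,2) H distinct_card by metis
    then show "contains_copy H (cycle_power (r - k + 1) k n)"
      using contains_copy_cycle_power[OF _ assms(2) n'(2) xs(1,2) _ xs(3)] assms(1) by simp
  qed
qed

end
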